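(* Let $\phi$ be a linear fractional self-map of the unit disk $\mathbb{D}$, not the identity. Then there exists $\lambda\in\mathbb{C}$ such that $C_\phi-\lambda I$ is universal on $H^2(\mathbb{D})$ if and only if $\phi$ has two distinct fixed points outside $\mathbb{D}$ (fixed points being taken in $\widehat{\mathbb{C}}=\mathbb{C}\cup\{\infty\}$).
   Context: A linear fractional self-map of $\mathbb{D}$ is a map $\phi(z)=\frac{az+b}{cz+d}$ with $a,b,c,d\in\mathbb{C}$, $ad-bc\neq0$, and $\phi(\mathbb{D})\subset\mathbb{D}$; it is regarded as a map of $\widehat{\mathbb{C}}$ when speaking of fixed points. $H^2(\mathbb{D})$ is the Hardy space of the open unit disk $\mathbb{D}$ and $C_\phi f=f\circ\phi$ is the (bounded) composition operator. A bounded linear operator $U$ on a Hilbert space $\mathcal{H}$ is universal for (or on) $\mathcal{H}$ if for every bounded linear operator $T$ on $\mathcal{H}$ there exist a constant $\alpha\neq 0$ and a closed subspace $\mathcal{M}\subset\mathcal{H}$ with $U\mathcal{M}\subset\mathcal{M}$ such that $U|_{\mathcal{M}}$ is similar to $\alpha T$. *)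

theory Defs
  imports "HOL-Complex_Analysis.Complex_Analysis"
begin

section \<open>Complex Hilbert spaces and universal operators\<close>

text \<open>The inner product is linear in its first argument.  The norm, and hence the topology, is the
  one of \<^class>\<open>real_inner\<close> for the real part of the complex inner product.\<close>

class complex_hilbert_space = real_inner + complete_space +
  fixes scaleC :: "complex \<Rightarrow> 'a \<Rightarrow> 'a"  (infixr "*\<^sub>C" 75)
    and cinner :: "'a \<Rightarrow> 'a \<Rightarrow> complex"
  assumes scaleC_add_right: "c *\<^sub>C (x + y) = c *\<^sub>C x + c *\<^sub>C y"
    and scaleC_add_left: "(c + d) *\<^sub>C x = c *\<^sub>C x + d *\<^sub>C x"
    and scaleC_scaleC: "c *\<^sub>C d *\<^sub>C x = (c * d) *\<^sub>C x"
    and scaleC_of_real: "of_real r *\<^sub>C x = r *\<^sub>R x"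
    and cinner_commute: "cinner x y = cnj (cinner y x)"
    and cinner_add_left: "cinner (x + y) z = cinner x z + cinner y z"
    and cinner_scaleC_left: "cinner (c *\<^sub>C x) y = c * cinner x y"
    and inner_eq_Re_cinner: "inner x y = Re (cinner x y)"

definition bounded_clinear :: "('a::complex_hilbert_space \<Rightarrow> 'b::complex_hilbert_space) \<Rightarrow> bool" where
  "bounded_clinear T \<longleftrightarrow> bounded_linear T \<and> (\<forall>c x. T (c *\<^sub>C x) = c *\<^sub>C T x)"

definition csubspace :: "'a::complex_hilbert_space set \<Rightarrow> bool" where
  "csubspace M \<longleftrightarrow> 0 \<in> M \<and> (\<forall>x\<in>M. \<forall>y\<in>M. x + y \<in> M) \<and> (\<forall>c. \<forall>x\<in>M. c *\<^sub>C x \<in> M)"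

text \<open>\<open>U\<close> restricted to the invariant subspace \<open>M\<close> is similar to the operator \<open>A\<close> on the whole space:
  \<open>V\<inverse> U V = A\<close> for a bounded linear bijection \<open>V\<close> onto \<open>M\<close> with bounded inverse \<open>W\<close>.\<close>

definition restriction_similar ::
    "('a::complex_hilbert_space \<Rightarrow> 'a) \<Rightarrow> 'a set \<Rightarrow> ('a \<Rightarrow> 'a) \<Rightarrow> bool" where
  "restriction_similar U M A \<longleftrightarrow>
     (\<exists>V W. bounded_clinear V \<and> homeomorphism UNIV M V W \<and> (\<forall>x. W (U (V x)) = A x))"

definition universal_operator :: "('a::complex_hilbert_space \<Rightarrow> 'a) \<Rightarrow> bool" where
  "universal_operator U \<longleftrightarrow> bounded_clinear U \<and>
     (\<forall>T. bounded_clinear T \<longrightarrow>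
        (\<exists>\<alpha> M. \<alpha> \<noteq> 0 \<and> closed M \<and> csubspace M \<and> U ` M \<subseteq> M \<and>
           restriction_similar U M (\<lambda>x. \<alpha> *\<^sub>C T x)))"


section \<open>The Hardy space of the unit disk\<close>

text \<open>Functions on the disk are represented by functions that vanish outside it.\<close>

definition hardy2_set :: "(complex \<Rightarrow> complex) set" where
  "hardy2_set = {f. f holomorphic_on ball 0 1 \<and> (\<forall>z. z \<notin> ball 0 1 \<longrightarrow> f z = 0) \<and>
     summable (\<lambda>n. (cmod (fps_nth (fps_expansion f 0) n))\<^sup>2)}"

lemma fps_expansion_ball:
  assumes "f holomorphic_on ball 0 1"
  shows "f has_fps_expansion fps_expansion f 0"
  by (rule has_fps_expansion_fps_expansion[of "ball 0 1"]) (use assms in auto)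

lemma hardy2_sums:
  assumes "f holomorphic_on ball 0 1" "cmod z < 1"
  shows "(\<lambda>n. fps_nth (fps_expansion f 0) n * z ^ n) sums f z"
  using holomorphic_power_series[of f 0 1 z] assms by (simp add: fps_expansion_def)

lemma summable_norm_power:
  assumes "summable (\<lambda>n. (cmod (b n))\<^sup>2)" "0 \<le> r" "r < 1"
  shows "summable (\<lambda>n. cmod (b n) * r ^ n)"
proof (rule summable_comparison_test)
  show "summable (\<lambda>n. (cmod (b n))\<^sup>2 + (r\<^sup>2) ^ n)"
    using assms by (intro summable_add summable_geometric) (auto simp: power_less_one_iff abs_square_less_1)
  have "cmod (b n) * r ^ n \<le> (cmod (b n))\<^sup>2 + (r\<^sup>2) ^ n" for n
  proof -
    have "2 * (cmod (b n) * r ^ n) \<le> (cmod (b n))\<^sup>2 + (r ^ n)\<^sup>2"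
      using sum_squares_bound[of "cmod (b n)" "r ^ n"] by simp
    moreover have "0 \<le> cmod (b n) * r ^ n" using assms by simp
    ultimately show ?thesis by (simp add: power_mult[symmetric] mult.commute)
  qed
  then show "\<exists>N. \<forall>n\<ge>N. norm (cmod (b n) * r ^ n) \<le> (cmod (b n))\<^sup>2 + (r\<^sup>2) ^ n"
    using assms by simp
qed

lemma hardy2_power_series:
  assumes b: "summable (\<lambda>n. (cmod (b n))\<^sup>2)"
  defines "f \<equiv> \<lambda>z. if z \<in> ball 0 1 then (\<Sum>n. b n * z ^ n) else 0"
  shows "f \<in> hardy2_set" "fps_nth (fps_expansion f 0) = b"
proof -
  have sm: "summable (\<lambda>n. b n * z ^ n)" if "cmod z < 1" for z
    using summable_norm_power[OF b _ that]
    by (intro summable_norm_cancel[of "\<lambda>n. b n * z ^ n"]) (simp add: norm_mult norm_power)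
  have "(\<lambda>n. b n * (z - 0) ^ n) sums f z" if "z \<in> ball 0 1" for z
    using sm[of z] that by (auto simp: f_def summable_sums)
  then have hol: "f holomorphic_on ball 0 1"
    by (rule power_series_holomorphic)
  have R: "fps_conv_radius (Abs_fps b) \<ge> 1"
    unfolding fps_conv_radius_def
  proof (rule conv_radius_geI_ex)
    fix r :: real assume "0 < r" "ereal r < 1"
    then show "\<exists>z. norm z = r \<and> summable (\<lambda>n. fps_nth (Abs_fps b) n * z ^ n)"
      using sm[of "of_real r"] by (intro exI[of _ "of_real r"]) auto
  qed
  have "eventually (\<lambda>z. z \<in> ball 0 1) (nhds (0::complex))"
    by (intro eventually_nhds_in_open) auto
  then have "eventually (\<lambda>z. eval_fps (Abs_fps b) z = f z) (nhds 0)"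
    by eventually_elim (simp add: f_def eval_fps_def)
  moreover have "fps_conv_radius (Abs_fps b) > 0"
    using R by (rule less_le_trans[rotated]) simp
  ultimately have "f has_fps_expansion Abs_fps b"
    by (simp add: has_fps_expansion_def)
  then show *: "fps_nth (fps_expansion f 0) = b"
    using fps_expansion_eqI by fastforce
  have "f z = 0" if "z \<notin> ball 0 1" for z
    using that by (simp add: f_def)
  moreover have "summable (\<lambda>n. (cmod (fps_nth (fps_expansion f 0) n))\<^sup>2)"
    unfolding * by (rule b)
  ultimately show "f \<in> hardy2_set"
    unfolding hardy2_set_def using hol by blast
qed

lemma cmod_add_power2_le: "(cmod (x + y))\<^sup>2 \<le> 2 * (cmod x)\<^sup>2 + 2 * (cmod y)\<^sup>2"
proof -
  have "(cmod (x + y))\<^sup>2 \<le> (cmod x + cmod y)\<^sup>2"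
    by (intro power_mono norm_triangle_ineq) auto
  also have "\<dots> \<le> 2 * (cmod x)\<^sup>2 + 2 * (cmod y)\<^sup>2"
    using sum_squares_bound[of "cmod x" "cmod y"] by (simp add: power2_sum)
  finally show ?thesis .
qed

lemma summable_power2_add:
  assumes "summable (\<lambda>n. (cmod (a n))\<^sup>2)" "summable (\<lambda>n. (cmod (b n))\<^sup>2)"
  shows "summable (\<lambda>n. (cmod (a n + b n))\<^sup>2)"
  by (rule summable_comparison_test[of _ "\<lambda>n. 2 * (cmod (a n))\<^sup>2 + 2 * (cmod (b n))\<^sup>2"])
     (use assms cmod_add_power2_le in \<open>auto intro!: summable_add summable_mult\<close>)

lemma hardy2_zero: "(\<lambda>z. 0) \<in> hardy2_set" "fps_expansion (\<lambda>z. 0) 0 = 0"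
proof -
  show *: "fps_expansion (\<lambda>z. 0) 0 = 0" by (rule fps_expansion_eqI) simp
  show "(\<lambda>z. 0) \<in> hardy2_set" by (simp add: hardy2_set_def *)
qed

lemma hardy2_add:
  assumes "f \<in> hardy2_set" "g \<in> hardy2_set"
  shows "(\<lambda>z. f z + g z) \<in> hardy2_set"
    "fps_expansion (\<lambda>z. f z + g z) 0 = fps_expansion f 0 + fps_expansion g 0"
proof -
  show *: "fps_expansion (\<lambda>z. f z + g z) 0 = fps_expansion f 0 + fps_expansion g 0"
    using assms by (intro fps_expansion_eqI has_fps_expansion_add fps_expansion_ball)
      (auto simp: hardy2_set_def)
  show "(\<lambda>z. f z + g z) \<in> hardy2_set"
    using assms unfolding hardy2_set_def mem_Collect_eq *
    by (auto intro!: holomorphic_intros summable_power2_add)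
qed

lemma hardy2_scale:
  assumes "f \<in> hardy2_set"
  shows "(\<lambda>z. c * f z) \<in> hardy2_set"
    "fps_expansion (\<lambda>z. c * f z) 0 = fps_const c * fps_expansion f 0"
proof -
  show *: "fps_expansion (\<lambda>z. c * f z) 0 = fps_const c * fps_expansion f 0"
    using assms by (intro fps_expansion_eqI has_fps_expansion_cmult_left fps_expansion_ball)
      (auto simp: hardy2_set_def)
  show "(\<lambda>z. c * f z) \<in> hardy2_set"
    using assms unfolding hardy2_set_def mem_Collect_eq *
    by (auto intro!: holomorphic_intros summable_mult simp: norm_mult power_mult_distrib)
qed

typedef hardy2 = hardy2_set
  morphisms hardy2_apply Abs_hardy2
  using hardy2_zero(1) by blast

definition taylor_coeff :: "hardy2 \<Rightarrow> nat \<Rightarrow> complex" where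
  "taylor_coeff f n = fps_nth (fps_expansion (hardy2_apply f) 0) n"

lemma hardy2_holomorphic: "hardy2_apply f holomorphic_on ball 0 1"
  and hardy2_outside: "z \<notin> ball 0 1 \<Longrightarrow> hardy2_apply f z = 0"
  and taylor_coeff_summable: "summable (\<lambda>n. (cmod (taylor_coeff f n))\<^sup>2)"
  using hardy2_apply[of f] by (auto simp: hardy2_set_def taylor_coeff_def)

lemma taylor_coeff_sums:
  "cmod z < 1 \<Longrightarrow> (\<lambda>n. taylor_coeff f n * z ^ n) sums hardy2_apply f z"
  unfolding taylor_coeff_def by (rule hardy2_sums[OF hardy2_holomorphic])

lemma hardy2_eqI:
  assumes "\<And>n. taylor_coeff f n = taylor_coeff g n"
  shows "f = g"
proof -
  have "hardy2_apply f z = hardy2_apply g z" for z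
  proof (cases "cmod z < 1")
    case True
    show ?thesis
      using taylor_coeff_sums[OF True, of f] taylor_coeff_sums[OF True, of g] assms
      by (simp add: sums_iff)
  qed (simp add: hardy2_outside)
  then show ?thesis by (metis ext hardy2_apply_inject)
qed

lemma hardy2_of_coeffs:
  assumes "summable (\<lambda>n. (cmod (b n))\<^sup>2)"
  obtains f where "taylor_coeff f = b"
proof
  show "taylor_coeff (Abs_hardy2 (\<lambda>z. if z \<in> ball 0 1 then (\<Sum>n. b n * z ^ n) else 0)) = b"
    using hardy2_power_series[OF assms] by (auto simp: taylor_coeff_def Abs_hardy2_inverse)
qed

lemma taylor_coeff_product_summable:
  "summable (\<lambda>n. taylor_coeff f n * cnj (taylor_coeff g n))"
proof (rule summable_comparison_test)
  show "summable (\<lambda>n. (cmod (taylor_coeff f n))\<^sup>2 + (cmod (taylor_coeff g n))\<^sup>2)"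
    by (intro summable_add taylor_coeff_summable)
  have "x * y \<le> x\<^sup>2 + y\<^sup>2" if "0 \<le> x" "0 \<le> y" for x y :: real
    using sum_squares_bound[of x y] mult_nonneg_nonneg[OF that] by linarith
  then show "\<exists>N. \<forall>n\<ge>N. norm (taylor_coeff f n * cnj (taylor_coeff g n))
      \<le> (cmod (taylor_coeff f n))\<^sup>2 + (cmod (taylor_coeff g n))\<^sup>2"
    by (simp add: norm_mult)
qed

instantiation hardy2 :: real_inner
begin

definition "0 = Abs_hardy2 (\<lambda>z. 0)"
definition "f + g = Abs_hardy2 (\<lambda>z. hardy2_apply f z + hardy2_apply g z)"
definition "r *\<^sub>R f = Abs_hardy2 (\<lambda>z. of_real r * hardy2_apply f z)"
definition "- f = (- 1) *\<^sub>R (f :: hardy2)"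
definition "f - g = f + - (g :: hardy2)"
definition "inner f g = Re (\<Sum>n. taylor_coeff f n * cnj (taylor_coeff g n))"
definition "norm f = sqrt (inner f (f :: hardy2))"
definition "sgn f = inverse (norm f) *\<^sub>R (f :: hardy2)"
definition "dist f g = norm (f - g :: hardy2)"
definition uniformity_hardy2 :: "(hardy2 \<times> hardy2) filter" where
  "uniformity_hardy2 = (INF e\<in>{0 <..}. principal {(f, g). dist f g < e})"
definition open_hardy2 :: "hardy2 set \<Rightarrow> bool" where
  "open_hardy2 S \<longleftrightarrow> (\<forall>f\<in>S. \<forall>\<^sub>F (f', g) in uniformity. f' = f \<longrightarrow> g \<in> S)"

lemma taylor_coeff_zero: "taylor_coeff 0 n = 0"
  by (simp add: taylor_coeff_def zero_hardy2_def Abs_hardy2_inverse hardy2_zero)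

lemma taylor_coeff_add: "taylor_coeff (f + g) n = taylor_coeff f n + taylor_coeff g n"
  using hardy2_add[OF hardy2_apply hardy2_apply, of f g]
  by (simp add: taylor_coeff_def plus_hardy2_def Abs_hardy2_inverse)

lemma taylor_coeff_scaleR: "taylor_coeff (r *\<^sub>R f) n = of_real r * taylor_coeff f n"
  using hardy2_scale[OF hardy2_apply, of "of_real r" f]
  by (simp add: taylor_coeff_def scaleR_hardy2_def Abs_hardy2_inverse)

lemma taylor_coeff_uminus: "taylor_coeff (- f) n = - taylor_coeff f n"
  by (simp add: uminus_hardy2_def taylor_coeff_scaleR)

lemma taylor_coeff_diff: "taylor_coeff (f - g) n = taylor_coeff f n - taylor_coeff g n"
  by (simp add: minus_hardy2_def taylor_coeff_add taylor_coeff_uminus)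

lemmas taylor_coeff_simps = taylor_coeff_zero taylor_coeff_add taylor_coeff_scaleR
  taylor_coeff_uminus taylor_coeff_diff

lemma inner_hardy2_self: "inner f f = (\<Sum>n. (cmod (taylor_coeff f n))\<^sup>2)" for f :: hardy2
proof -
  have "inner f f = (\<Sum>n. Re (taylor_coeff f n * cnj (taylor_coeff f n)))"
    unfolding inner_hardy2_def by (rule Re_suminf[OF taylor_coeff_product_summable])
  then show ?thesis by (simp only: complex_norm_square[symmetric] Re_complex_of_real)
qed

instance
proof
  fix f g h :: hardy2 and r s :: real
  show "f + g + h = f + (g + h)" "f + g = g + f" "0 + f = f" "- f + f = 0" "f - g = f + - g"
    "r *\<^sub>R (f + g) = r *\<^sub>R f + r *\<^sub>R g" "(r + s) *\<^sub>R f = r *\<^sub>R f + s *\<^sub>R f"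
    "r *\<^sub>R s *\<^sub>R f = (r * s) *\<^sub>R f" "1 *\<^sub>R f = f"
    by (auto intro!: hardy2_eqI simp: taylor_coeff_simps algebra_simps)
  show "sgn f = inverse (norm f) *\<^sub>R f" by (rule sgn_hardy2_def)
  show "dist f g = norm (f - g)" by (rule dist_hardy2_def)
  show "(uniformity :: (hardy2 \<times> hardy2) filter) = (INF e\<in>{0<..}. principal {(f, g). dist f g < e})"
    by (rule uniformity_hardy2_def)
  show "open S \<longleftrightarrow> (\<forall>f\<in>S. \<forall>\<^sub>F (f', g) in uniformity. f' = f \<longrightarrow> g \<in> S)" for S :: "hardy2 set"
    by (rule open_hardy2_def)
  show "inner f g = inner g f"
    unfolding inner_hardy2_def Re_suminf[OF taylor_coeff_product_summable]
    by (rule suminf_cong) simp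
  show "inner (f + g) h = inner f h + inner g h"
    unfolding inner_hardy2_def taylor_coeff_add distrib_right
      suminf_add[OF taylor_coeff_product_summable taylor_coeff_product_summable, symmetric] by simp
  show "inner (r *\<^sub>R f) g = r * inner f g"
    unfolding inner_hardy2_def taylor_coeff_scaleR mult.assoc
      suminf_mult[OF taylor_coeff_product_summable] by simp
  show "0 \<le> inner f f"
    unfolding inner_hardy2_self by (rule suminf_nonneg[OF taylor_coeff_summable]) simp
  show "inner f f = 0 \<longleftrightarrow> f = 0"
  proof
    assume "inner f f = 0"
    then have "\<forall>n. (cmod (taylor_coeff f n))\<^sup>2 = 0"
      unfolding inner_hardy2_self using suminf_eq_zero_iff[OF taylor_coeff_summable] by simp
    then show "f = 0" by (auto intro!: hardy2_eqI simp: taylor_coeff_simps)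
  qed (simp add: inner_hardy2_self taylor_coeff_simps)
  show "norm f = sqrt (inner f f)" by (rule norm_hardy2_def)
qed

end

lemma norm_hardy2_power2: "(norm f)\<^sup>2 = (\<Sum>n. (cmod (taylor_coeff f n))\<^sup>2)"
  by (simp add: power2_norm_eq_inner inner_hardy2_self)

lemma taylor_coeff_norm_le: "cmod (taylor_coeff f n) \<le> norm f"
proof (rule power2_le_imp_le)
  show "(cmod (taylor_coeff f n))\<^sup>2 \<le> (norm f)\<^sup>2"
    using sum_le_suminf[OF taylor_coeff_summable, of "{n}" f] by (simp add: norm_hardy2_power2)
qed simp

instance hardy2 :: complete_space
proof
  fix X :: "nat \<Rightarrow> hardy2"
  assume X: "Cauchy X"
  have "convergent (\<lambda>k. taylor_coeff (X k) n)" for n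
  proof (rule Cauchy_convergent, rule metric_CauchyI)
    fix e :: real assume "e > 0"
    then obtain N where N: "\<forall>m\<ge>N. \<forall>k\<ge>N. dist (X m) (X k) < e"
      using X unfolding Cauchy_def by blast
    have "dist (taylor_coeff (X m) n) (taylor_coeff (X k) n) < e" if "m \<ge> N" "k \<ge> N" for m k
    proof -
      have "dist (taylor_coeff (X m) n) (taylor_coeff (X k) n) \<le> dist (X m) (X k)"
        using taylor_coeff_norm_le[of "X m - X k" n] by (simp add: dist_norm taylor_coeff_simps)
      also have "\<dots> < e" using N that by blast
      finally show ?thesis .
    qed
    then show "\<exists>N. \<forall>m\<ge>N. \<forall>k\<ge>N. dist (taylor_coeff (X m) n) (taylor_coeff (X k) n) < e"
      by blast
  qed
  then obtain b where b: "\<And>n. (\<lambda>k. taylor_coeff (X k) n) \<longlonglongrightarrow> b n"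
    unfolding convergent_def by metis
  have part: "\<exists>N. \<forall>m\<ge>N. \<forall>P. (\<Sum>n<P. (cmod (taylor_coeff (X m) n - b n))\<^sup>2) \<le> e\<^sup>2" if "e > 0" for e
  proof -
    obtain N where N: "\<forall>m\<ge>N. \<forall>k\<ge>N. dist (X m) (X k) < e"
      using X \<open>e > 0\<close> unfolding Cauchy_def by blast
    have "(\<Sum>n<P. (cmod (taylor_coeff (X m) n - b n))\<^sup>2) \<le> e\<^sup>2" if "m \<ge> N" for m P
    proof (rule LIMSEQ_le_const2)
      show "(\<lambda>k. \<Sum>n<P. (cmod (taylor_coeff (X m) n - taylor_coeff (X k) n))\<^sup>2)
              \<longlonglongrightarrow> (\<Sum>n<P. (cmod (taylor_coeff (X m) n - b n))\<^sup>2)"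
        by (intro tendsto_intros b)
      have "(\<Sum>n<P. (cmod (taylor_coeff (X m) n - taylor_coeff (X k) n))\<^sup>2) \<le> e\<^sup>2" if "k \<ge> N" for k
      proof -
        have "(\<Sum>n<P. (cmod (taylor_coeff (X m - X k) n))\<^sup>2) \<le> (norm (X m - X k))\<^sup>2"
          unfolding norm_hardy2_power2 by (rule sum_le_suminf[OF taylor_coeff_summable]) auto
        also have "\<dots> \<le> e\<^sup>2"
          using N \<open>m \<ge> N\<close> \<open>k \<ge> N\<close> by (intro power_mono) (auto simp: dist_norm less_imp_le)
        finally show ?thesis by (simp add: taylor_coeff_simps)
      qed
      then show "\<exists>K. \<forall>k\<ge>K. (\<Sum>n<P. (cmod (taylor_coeff (X m) n - taylor_coeff (X k) n))\<^sup>2) \<le> e\<^sup>2"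
        by blast
    qed
    then show ?thesis by blast
  qed
  have diff: "summable (\<lambda>n. (cmod (taylor_coeff (X m) n - b n))\<^sup>2)"
    if "\<forall>P. (\<Sum>n<P. (cmod (taylor_coeff (X m) n - b n))\<^sup>2) \<le> e\<^sup>2" for m e
    using that by (intro summableI_nonneg_bounded[where x = "e\<^sup>2"]) auto
  obtain m where "\<forall>P. (\<Sum>n<P. (cmod (taylor_coeff (X m) n - b n))\<^sup>2) \<le> 1\<^sup>2"
    using part[of 1] by auto
  from diff[OF this] have "summable (\<lambda>n. (cmod (- (taylor_coeff (X m) n - b n)))\<^sup>2)"
    unfolding norm_minus_cancel .
  from summable_power2_add[OF taylor_coeff_summable[of "X m"] this]
  have "summable (\<lambda>n. (cmod (b n))\<^sup>2)" by simp
  then obtain f where f: "taylor_coeff f = b" by (rule hardy2_of_coeffs)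
  have "X \<longlonglongrightarrow> f"
  proof (rule metric_LIMSEQ_I)
    fix e :: real assume "e > 0"
    then obtain N where N: "\<forall>m\<ge>N. \<forall>P. (\<Sum>n<P. (cmod (taylor_coeff (X m) n - b n))\<^sup>2) \<le> (e / 2)\<^sup>2"
      using part[of "e / 2"] by auto
    have "dist (X m) f < e" if "m \<ge> N" for m
    proof -
      have "(\<Sum>n. (cmod (taylor_coeff (X m) n - b n))\<^sup>2) \<le> (e / 2)\<^sup>2"
        using N that diff[of m "e / 2"] by (intro suminf_le_const) auto
      then have "(norm (X m - f))\<^sup>2 \<le> (e / 2)\<^sup>2"
        by (simp add: norm_hardy2_power2 taylor_coeff_simps f)
      then have "norm (X m - f) \<le> e / 2"
        by (rule power2_le_imp_le) (use \<open>e > 0\<close> in simp)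
      then show ?thesis using \<open>e > 0\<close> by (simp add: dist_norm)
    qed
    then show "\<exists>N. \<forall>m\<ge>N. dist (X m) f < e" by blast
  qed
  then show "convergent X" by (rule convergentI)
qed

instantiation hardy2 :: complex_hilbert_space
begin

definition "c *\<^sub>C f = Abs_hardy2 (\<lambda>z. c * hardy2_apply f z)"
definition "cinner f g = (\<Sum>n. taylor_coeff f n * cnj (taylor_coeff g n))"

lemma taylor_coeff_scaleC: "taylor_coeff (c *\<^sub>C f) n = c * taylor_coeff f n"
  using hardy2_scale[OF hardy2_apply, of c f]
  by (simp add: taylor_coeff_def scaleC_hardy2_def Abs_hardy2_inverse)

instance
proof
  fix f g h :: hardy2 and c d :: complex and r :: real
  show "c *\<^sub>C (f + g) = c *\<^sub>C f + c *\<^sub>C g" "(c + d) *\<^sub>C f = c *\<^sub>C f + d *\<^sub>C f"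
    "c *\<^sub>C d *\<^sub>C f = (c * d) *\<^sub>C f" "of_real r *\<^sub>C f = r *\<^sub>R f"
    by (auto intro!: hardy2_eqI simp: taylor_coeff_simps taylor_coeff_scaleC algebra_simps)
  have "(\<lambda>n. cnj (taylor_coeff g n * cnj (taylor_coeff f n))) sums cnj (cinner g f)"
    unfolding sums_cnj cinner_hardy2_def
    by (rule summable_sums[OF taylor_coeff_product_summable])
  then show "cinner f g = cnj (cinner g f)"
    unfolding cinner_hardy2_def by (simp add: sums_iff mult.commute)
  show "cinner (f + g) h = cinner f h + cinner g h"
    unfolding cinner_hardy2_def taylor_coeff_add distrib_right
      suminf_add[OF taylor_coeff_product_summable taylor_coeff_product_summable, symmetric] ..
  show "cinner (c *\<^sub>C f) g = c * cinner f g"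
    unfolding cinner_hardy2_def taylor_coeff_scaleC mult.assoc
      suminf_mult[OF taylor_coeff_product_summable] ..
  show "inner f g = Re (cinner f g)"
    by (simp add: inner_hardy2_def cinner_hardy2_def)
qed

end

text \<open>The definition by square-summable Taylor coefficients agrees with the one by bounded
  integral means over the circles of radius \<open>r < 1\<close>, with the same norm.\<close>

lemma cis_integral:
  "((\<lambda>t. cis (real_of_int k * t)) has_integral (if k = 0 then 2 * pi else 0)) {0..2 * pi}"
proof (cases "k = 0")
  case True
  then show ?thesis
    using has_integral_const_real[of "1::complex" 0 "2 * pi"] by (simp add: scaleR_conv_of_real)
next
  case False
  have "((\<lambda>t. cis (real_of_int k * t) / (\<i> * of_int k)) has_vector_derivative cis (real_of_int k * x))
      (at x within {0..2 * pi})" for x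
    unfolding cis_conv_exp using False
    by (auto intro!: derivative_eq_intros has_vector_derivative_real_field simp: field_simps)
  from fundamental_theorem_of_calculus[OF _ this]
  have "((\<lambda>t. cis (real_of_int k * t)) has_integral
      cis (real_of_int k * (2 * pi)) / (\<i> * of_int k) - cis (real_of_int k * 0) / (\<i> * of_int k)) {0..2 * pi}"
    by simp
  moreover have "cis (real_of_int k * (2 * pi)) = 1"
    using cis_multiple_2pi[of "real_of_int k"] by (simp add: mult_ac)
  ultimately show ?thesis using False by simp
qed

lemma trig_polynomial_integral:
  "((\<lambda>t. (cmod (\<Sum>n<N. c n * cis (real n * t)))\<^sup>2) has_integral 2 * pi * (\<Sum>n<N. (cmod (c n))\<^sup>2)) {0..2 * pi}"
proof -
  have eq: "of_real ((cmod (\<Sum>n<N. c n * cis (real n * t)))\<^sup>2) =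
      (\<Sum>n<N. \<Sum>m<N. c n * cnj (c m) * cis (real_of_int (int n - int m) * t))" for t
  proof -
    have "c n * cis (real n * t) * cnj (c m * cis (real m * t)) =
        c n * cnj (c m) * cis (real_of_int (int n - int m) * t)" for n m
    proof -
      have "cis (real n * t) * cnj (cis (real m * t)) = cis (real_of_int (int n - int m) * t)"
        by (simp add: cis_cnj cis_mult left_diff_distrib)
      then show ?thesis by (metis (no_types, lifting) complex_cnj_mult mult.assoc mult.left_commute)
    qed
    then show ?thesis
      unfolding complex_norm_square cnj_sum sum_product by (simp only:)
  qed
  have "((\<lambda>t. \<Sum>n<N. \<Sum>m<N. c n * cnj (c m) * cis (real_of_int (int n - int m) * t)) has_integral
      (\<Sum>n<N. \<Sum>m<N. c n * cnj (c m) * (if int n - int m = 0 then 2 * pi else 0))) {0..2 * pi}"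
    by (intro has_integral_sum has_integral_mult_right cis_integral) auto
  also have "(\<Sum>n<N. \<Sum>m<N. c n * cnj (c m) * (if int n - int m = 0 then 2 * pi else 0)) =
      (\<Sum>n<N. of_real (2 * pi * (cmod (c n))\<^sup>2))"
  proof (rule sum.cong[OF refl])
    fix n assume n: "n \<in> {..<N}"
    have "(\<Sum>m<N. c n * cnj (c m) * (if int n - int m = 0 then 2 * pi else 0)) =
       (\<Sum>m<N. if n = m then c n * cnj (c m) * (2 * pi) else 0)"
      by (rule sum.cong) auto
    also have "\<dots> = c n * cnj (c n) * (2 * pi)" using n by (simp add: sum.delta')
    also have "\<dots> = of_real (2 * pi * (cmod (c n))\<^sup>2)"
      unfolding complex_norm_square[symmetric] by (simp add: mult.commute)
    finally show "(\<Sum>m<N. c n * cnj (c m) * (if int n - int m = 0 then 2 * pi else 0)) =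
      of_real (2 * pi * (cmod (c n))\<^sup>2)" .
  qed
  also have "\<dots> = of_real (2 * pi * (\<Sum>n<N. (cmod (c n))\<^sup>2))"
    by (simp add: sum_distrib_left)
  finally have "((\<lambda>t. complex_of_real ((cmod (\<Sum>n<N. c n * cis (real n * t)))\<^sup>2)) has_integral
      of_real (2 * pi * (\<Sum>n<N. (cmod (c n))\<^sup>2))) {0..2 * pi}"
    unfolding eq .
  from has_integral_linear[OF this bounded_linear_Re] show ?thesis
    unfolding o_def Re_complex_of_real .
qed

definition integral_mean :: "(complex \<Rightarrow> complex) \<Rightarrow> real \<Rightarrow> real" where
  "integral_mean f r = integral {0..2 * pi} (\<lambda>t. (cmod (f (of_real r * cis t)))\<^sup>2) / (2 * pi)"

lemma integral_mean_sums:
  assumes f: "f holomorphic_on ball 0 1" and r: "0 \<le> r" "r < 1"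
  shows "(\<lambda>n. (cmod (fps_nth (fps_expansion f 0) n))\<^sup>2 * (r ^ n)\<^sup>2) sums integral_mean f r"
proof -
  define c where "c n = fps_nth (fps_expansion f 0) n * of_real r ^ n" for n
  define g where "g t = f (of_real r * cis t)" for t
  define S where "S N t = (\<Sum>n<N. c n * cis (real n * t))" for N t
  have sums: "(\<lambda>n. c n * cis (real n * t)) sums g t" for t
  proof -
    have "c n * cis (real n * t) = fps_nth (fps_expansion f 0) n * (of_real r * cis t) ^ n" for n
      unfolding c_def power_mult_distrib Complex.DeMoivre mult.assoc ..
    then show ?thesis
      using hardy2_sums[OF f, of "of_real r * cis t"] r by (simp add: g_def norm_mult)
  qed
  have sm: "summable (\<lambda>n. cmod (c n))"
    unfolding c_def
    by (rule powser_insidea[where x = "of_real ((1 + r) / 2)"])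
       (use r in \<open>auto intro!: sums_summable[OF hardy2_sums[OF f]] simp del: of_real_divide of_real_add\<close>)
  have ul: "uniform_limit {0..2 * pi} S (\<lambda>t. \<Sum>n. c n * cis (real n * t)) sequentially"
    unfolding S_def by (rule Weierstrass_m_test[OF _ sm]) (simp add: norm_mult)
  have ul: "uniform_limit {0..2 * pi} S g sequentially"
    using ul sums by (simp add: sums_iff)
  have bg: "bounded (g ` {0..2 * pi})"
  proof (rule boundedI)
    fix w assume "w \<in> g ` {0..2 * pi}"
    then obtain t where "w = (\<Sum>n. c n * cis (real n * t))" using sums by (auto simp: sums_iff)
    then show "norm w \<le> (\<Sum>n. cmod (c n))"
      using summable_norm[of "\<lambda>n. c n * cis (real n * t)"] sm by (simp add: norm_mult)
  qed
  have bn: "bounded ((\<lambda>t. cmod (g t)) ` {0..2 * pi})"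
    using bg unfolding bounded_iff by auto
  have ul2: "uniform_limit {0..2 * pi} (\<lambda>N t. (cmod (S N t))\<^sup>2) (\<lambda>t. (cmod (g t))\<^sup>2) sequentially"
    unfolding power2_eq_square
    by (intro uniform_lim_mult uniform_limit_norm ul bn)
  have int: "((\<lambda>t. (cmod (S N t))\<^sup>2) has_integral 2 * pi * (\<Sum>n<N. (cmod (c n))\<^sup>2)) {0..2 * pi}" for N
    unfolding S_def by (rule trig_polynomial_integral)
  have cont: "continuous_on {0..2 * pi} (\<lambda>t. (cmod (S N t))\<^sup>2)" for N
    unfolding S_def by (intro continuous_intros)
  obtain I J where I: "\<And>N. ((\<lambda>t. (cmod (S N t))\<^sup>2) has_integral I N) {0..2 * pi}"
    and J: "((\<lambda>t. (cmod (g t))\<^sup>2) has_integral J) {0..2 * pi}" and lim: "I \<longlonglongrightarrow> J"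
    by (rule uniform_limit_integral[OF ul2 cont]) auto
  have "I = (\<lambda>N. 2 * pi * (\<Sum>n<N. (cmod (c n))\<^sup>2))"
    using I int by (auto intro: has_integral_unique)
  with lim have "(\<lambda>N. 2 * pi * (\<Sum>n<N. (cmod (c n))\<^sup>2) / (2 * pi)) \<longlonglongrightarrow> J / (2 * pi)"
    by (intro tendsto_intros) auto
  moreover have "J / (2 * pi) = integral_mean f r"
    using J unfolding integral_mean_def g_def by (simp add: integral_unique)
  ultimately have "(\<lambda>n. (cmod (c n))\<^sup>2) sums integral_mean f r"
    unfolding sums_def by simp
  then show ?thesis
    using r by (simp add: c_def norm_mult norm_power power_mult_distrib)
qed

lemma integral_mean_characterization:
  assumes f: "f holomorphic_on ball 0 1"
  defines "a \<equiv> \<lambda>n. (cmod (fps_nth (fps_expansion f 0) n))\<^sup>2"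
  shows "summable a \<longleftrightarrow> bdd_above (integral_mean f ` {0..<1})"
    and "summable a \<Longrightarrow> (\<Sum>n. a n) = (SUP r\<in>{0..<1}. integral_mean f r)"
proof -
  have s: "(\<lambda>n. a n * (r ^ n)\<^sup>2) sums integral_mean f r" if "0 \<le> r" "r < 1" for r
    unfolding a_def using integral_mean_sums[OF f] that by auto
  have a0: "a n \<ge> 0" for n by (simp add: a_def)
  have le: "integral_mean f r \<le> (\<Sum>n. a n)" if "summable a" "r \<in> {0..<1}" for r
  proof (rule sums_le[OF _ s summable_sums[OF \<open>summable a\<close>]])
    fix n
    show "a n * (r ^ n)\<^sup>2 \<le> a n"
      using that by (intro mult_left_le a0) (auto intro!: power_le_one)
  qed (use that in auto)
  have part: "(\<Sum>n<N. a n) \<le> B" if B: "\<And>r. r \<in> {0..<1} \<Longrightarrow> integral_mean f r \<le> B" for B N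
  proof (rule tendsto_upperbound)
    show "((\<lambda>r. \<Sum>n<N. a n * (r ^ n)\<^sup>2) \<longlongrightarrow> (\<Sum>n<N. a n)) (at_left 1)"
      by (auto intro!: tendsto_eq_intros)
    have "eventually (\<lambda>r::real. r \<in> {0<..<1}) (at_left 1)"
      by (rule eventually_at_left_real) simp
    then show "eventually (\<lambda>r. (\<Sum>n<N. a n * (r ^ n)\<^sup>2) \<le> B) (at_left 1)"
    proof eventually_elim
      case (elim r)
      have "(\<Sum>n<N. a n * (r ^ n)\<^sup>2) \<le> integral_mean f r"
        using sum_le_suminf[of "\<lambda>n. a n * (r ^ n)\<^sup>2" "{..<N}"] s[of r] elim a0
        by (simp add: sums_iff)
      also have "\<dots> \<le> B" using elim by (intro B) auto
      finally show ?case .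
    qed
  qed auto
  show iff: "summable a \<longleftrightarrow> bdd_above (integral_mean f ` {0..<1})"
  proof
    assume "bdd_above (integral_mean f ` {0..<1})"
    then obtain B where "\<And>r. r \<in> {0..<1} \<Longrightarrow> integral_mean f r \<le> B"
      unfolding bdd_above_def by blast
    from part[OF this] show "summable a"
      by (intro summableI_nonneg_bounded[where x = B] a0) auto
  qed (use le in \<open>auto intro!: bdd_aboveI2[where M = "suminf a"]\<close>)
  show "(\<Sum>n. a n) = (SUP r\<in>{0..<1}. integral_mean f r)" if sa: "summable a"
  proof (rule antisym)
    show "(\<Sum>n. a n) \<le> (SUP r\<in>{0..<1}. integral_mean f r)"
      using iff sa by (intro suminf_le_const[OF sa] part cSUP_upper) auto
    show "(SUP r\<in>{0..<1}. integral_mean f r) \<le> (\<Sum>n. a n)"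
      using le[OF sa] by (intro cSUP_least) auto
  qed
qed

lemma hardy2_set_iff_integral_means:
  "f \<in> hardy2_set \<longleftrightarrow> f holomorphic_on ball 0 1 \<and> (\<forall>z. z \<notin> ball 0 1 \<longrightarrow> f z = 0) \<and>
     bdd_above (integral_mean f ` {0..<1})"
  unfolding hardy2_set_def mem_Collect_eq using integral_mean_characterization(1)[of f] by metis

lemma norm_hardy2_integral_means: "(norm f)\<^sup>2 = (SUP r\<in>{0..<1}. integral_mean (hardy2_apply f) r)"
  using integral_mean_characterization(2)[OF hardy2_holomorphic, of f] taylor_coeff_summable[of f]
  by (simp add: norm_hardy2_power2 taylor_coeff_def)

text \<open>For a self-map \<open>\<phi>\<close> of the disk that is holomorphic there, \<open>f \<circ> \<phi>\<close> (cut off to the disk) is again in the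
  Hardy space by Littlewood's subordination theorem, so \<^const>\<open>Abs_hardy2\<close> is applied inside its domain.\<close>

definition composition_operator :: "(complex \<Rightarrow> complex) \<Rightarrow> hardy2 \<Rightarrow> hardy2" where
  "composition_operator \<phi> f =
     Abs_hardy2 (\<lambda>z. if z \<in> ball 0 1 then hardy2_apply f (\<phi> z) else 0)"


section \<open>Linear fractional maps\<close>

text \<open>The Riemann sphere is \<^typ>\<open>complex option\<close> with \<^const>\<open>None\<close> as the point at infinity, as in
  \<^const>\<open>Alexandroff_compactification\<close>.\<close>

definition lin_frac :: "complex \<Rightarrow> complex \<Rightarrow> complex \<Rightarrow> complex \<Rightarrow> complex \<Rightarrow> complex" where
  "lin_frac a b c d z = (a * z + b) / (c * z + d)"

fun lin_frac_sphere ::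
    "complex \<Rightarrow> complex \<Rightarrow> complex \<Rightarrow> complex \<Rightarrow> complex option \<Rightarrow> complex option" where
  "lin_frac_sphere a b c d (Some z) = (if c * z + d = 0 then None else Some (lin_frac a b c d z))"
| "lin_frac_sphere a b c d None = (if c = 0 then None else Some (a / c))"

definition disk_sphere :: "complex option set" where
  "disk_sphere = Some ` ball 0 1"

definition lin_frac_self_map :: "complex \<Rightarrow> complex \<Rightarrow> complex \<Rightarrow> complex \<Rightarrow> bool" where
  "lin_frac_self_map a b c d \<longleftrightarrow>
     a * d - b * c \<noteq> 0 \<and> lin_frac_sphere a b c d ` disk_sphere \<subseteq> disk_sphere"

end

theory Submission
  imports Defs
begin

text \<open>At a finite fixed point \<open>p\<close>, the coordinate
  \<open>1 / (z - p)\<close> turns \<open>\<phi>\<close> into an affine map, and for \<open>\<bar>p\<bar> = 1\<close> the coordinate \<open>u = p / (p - z)\<close> maps the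
  disk onto the half-plane \<open>Re u > 1/2\<close>, where \<open>\<phi>\<close> is \<open>u \<mapsto> A u + B\<close> with \<open>A > 0\<close>.

  If \<open>\<phi>\<close> has two fixed points outside the disk, \<open>C\<^sub>\<phi> - l\<close> has infinite-dimensional kernel (powers of \<open>u - w\<close>, \<open>w\<close> the
  finite fixed point) and a bounded right inverse, given by two Neumann series after splitting \<open>g\<close> into a part that is
  small at infinity and a part that is small, or extends holomorphically, near \<open>w\<close>.  For \<open>U R = 1\<close> and an isometry \<open>J\<close>
  into the kernel of \<open>U\<close>, the operator \<open>V = \<Sum>\<^sub>n R\<^sup>n J (\<alpha> T)\<^sup>n\<close> satisfies \<open>U V = V (\<alpha> T)\<close> and is bounded below, so \<open>U\<close> is
  universal (Caradus).

  Conversely a universal operator has nilpotent Jordan blocks of every size and an infinite-dimensional kernel.  An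
  interior fixed point diagonalises \<open>C\<^sub>\<phi>\<close> on Taylor coefficients, which rules out Jordan blocks.  For a
  parabolic automorphism a Jordan block of size three contradicts the linear growth of \<open>H\<^sup>2\<close> functions along orbits; for other
  parabolic maps eigenfunctions extend to entire functions and Liouville's theorem makes eigenspaces one-dimensional.\<close>

text \<open>Boundary values of H^2 functions are avoided. All norm estimates come from harmonic
  majorants: if |g|^2 <= Re F with F holomorphic on the disk, then the squared norm of g is at most
  Re F(0). A majorant for f composed with a self-map psi is obtained by composing one for f with
  psi, so each estimate depends only on where psi sends 0.

  Which l works is dictated by the decay rates of the two pieces. In the coordinate u the map is u
  -> w + A (u - w). If w lies strictly left of the line Re u = 1/2, one piece decays like A^(-n/2)
  under powers of the operator and the other stays bounded under negative powers; l = A^(-1/4) is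
  the geometric mean of A^(-1/2) and 1. If w lies on the line, the map is an automorphism, both
  pieces decay like the n-th power of a number below 1, and l = 1 works. The free factor in the
  definition of universality is what allows T to be scaled until the series for V converges.

  All cases are anchored at a fixed point in the closed disk given by Brouwer's theorem; if it lies
  on the circle, the remaining fixed point is found in the coordinate u.\<close>

section \<open>Universality from a right inverse and a large kernel\<close>

instance complex_hilbert_space \<subseteq> banach ..

section \<open>Algebra and Cauchy-Schwarz in complex Hilbert spaces\<close>

lemma scaleC_zero_left [simp]: "0 *\<^sub>C x = (0 :: 'a :: complex_hilbert_space)"
  using scaleC_of_real[of 0 x] by simp

lemma scaleC_one [simp]: "1 *\<^sub>C x = (x :: 'a :: complex_hilbert_space)"
  using scaleC_of_real[of 1 x] by simp

lemma scaleC_zero_right [simp]: "c *\<^sub>C 0 = (0 :: 'a :: complex_hilbert_space)"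
  using scaleC_add_right[of c 0 "0::'a"] by simp

lemma scaleC_minus_right: "c *\<^sub>C (- x) = - (c *\<^sub>C x :: 'a :: complex_hilbert_space)"
  using scaleC_add_right[of c x "- x"] by (simp add: eq_neg_iff_add_eq_0 add.commute)

lemma scaleC_minus_left: "(- c) *\<^sub>C x = - (c *\<^sub>C x :: 'a :: complex_hilbert_space)"
  using scaleC_add_left[of "- c" c x] by (simp add: eq_neg_iff_add_eq_0)

lemma scaleC_diff_right: "c *\<^sub>C (x - y) = c *\<^sub>C x - (c *\<^sub>C y :: 'a :: complex_hilbert_space)"
  unfolding diff_conv_add_uminus scaleC_add_right scaleC_minus_right ..

lemma scaleC_diff_left: "(c - d) *\<^sub>C x = c *\<^sub>C x - (d *\<^sub>C x :: 'a :: complex_hilbert_space)"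
  unfolding diff_conv_add_uminus scaleC_add_left scaleC_minus_left ..

lemma scaleC_sum_right: "c *\<^sub>C sum f A = (\<Sum>i\<in>A. c *\<^sub>C f i :: 'a :: complex_hilbert_space)"
  by (induction A rule: infinite_finite_induct) (auto simp: scaleC_add_right)

lemma cinner_self: "cinner x x = of_real ((norm (x :: 'a :: complex_hilbert_space))\<^sup>2)"
proof -
  have "Im (cinner x x) = 0"
    using arg_cong[OF cinner_commute[of x x], of Im] by simp
  then show ?thesis
    using inner_eq_Re_cinner[of x x] by (simp add: complex_eq_iff power2_norm_eq_inner)
qed

lemma cinner_scaleC_right: "cinner x (c *\<^sub>C y) = cnj c * cinner x (y :: 'a :: complex_hilbert_space)"
  using cinner_commute[of x "c *\<^sub>C y"] cinner_commute[of x y] by (simp add: cinner_scaleC_left)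

lemma cinner_add_right: "cinner x (y + z) = cinner x y + cinner x (z :: 'a :: complex_hilbert_space)"
  using cinner_commute[of x "y + z"] cinner_commute[of x y] cinner_commute[of x z]
  by (simp add: cinner_add_left)

lemma cinner_zero [simp]: "cinner 0 x = 0" "cinner x 0 = 0" for x :: "'a :: complex_hilbert_space"
  using cinner_scaleC_left[of 0 x x] cinner_scaleC_right[of x 0 x] by auto

lemma cinner_sum_left: "cinner (sum f A) y = (\<Sum>i\<in>A. cinner (f i) (y :: 'a :: complex_hilbert_space))"
  by (induction A rule: infinite_finite_induct) (auto simp: cinner_add_left)

lemma cinner_sum_right: "cinner y (sum f A) = (\<Sum>i\<in>A. cinner y (f i :: 'a :: complex_hilbert_space))"
  by (induction A rule: infinite_finite_induct) (auto simp: cinner_add_right)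

lemma norm_scaleC: "norm (c *\<^sub>C x) = cmod c * norm (x :: 'a :: complex_hilbert_space)"
proof -
  have "of_real ((norm (c *\<^sub>C x))\<^sup>2) = c * cnj c * of_real ((norm x)\<^sup>2)"
    unfolding cinner_self[symmetric] cinner_scaleC_left cinner_scaleC_right by simp
  also have "\<dots> = of_real ((cmod c * norm x)\<^sup>2)"
    unfolding complex_norm_square[symmetric] by (simp add: power_mult_distrib)
  finally have "(norm (c *\<^sub>C x))\<^sup>2 = (cmod c * norm x)\<^sup>2"
    unfolding of_real_eq_iff .
  then show ?thesis by simp
qed

lemma cmod_cinner_le: "cmod (cinner x y) \<le> norm x * norm (y :: 'a :: complex_hilbert_space)"
proof (cases "cinner x y = 0")
  case False
  \<comment> \<open>A unimodular factor turning \<open>cinner x y\<close> into its modulus, so that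
    the real Cauchy-Schwarz inequality gives the complex one.\<close>
  define s where "s = cnj (sgn (cinner x y))"
  have s: "cmod s = 1" using False by (simp add: s_def norm_sgn)
  have "s * cinner x y = of_real (cmod (cinner x y))"
    using complex_norm_square[of "cinner x y"] False
    by (simp add: s_def sgn_eq field_simps power2_eq_square)
  then have "cmod (cinner x y) = inner (s *\<^sub>C x) y"
    unfolding inner_eq_Re_cinner cinner_scaleC_left by simp
  also have "\<dots> \<le> norm (s *\<^sub>C x) * norm y" by (rule norm_cauchy_schwarz)
  finally show ?thesis by (simp add: norm_scaleC s)
qed simp

section \<open>Bounded complex-linear operators and geometric series of operators\<close>

lemma bounded_clinearI:
  assumes "\<And>x y. T (x + y) = T x + T y" "\<And>c x. T (c *\<^sub>C x) = c *\<^sub>C T x"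
    "\<And>x. norm (T x) \<le> K * norm x"
  shows "bounded_clinear T"
  unfolding bounded_clinear_def
proof
  show "bounded_linear T"
  proof (rule bounded_linear_intro[where K = K])
    show "T (r *\<^sub>R x) = r *\<^sub>R T x" for r x
      using assms(2)[of "of_real r" x] by (simp add: scaleC_of_real)
  qed (use assms in \<open>auto simp: mult.commute\<close>)
qed (use assms in auto)

lemma
  assumes "bounded_clinear T"
  shows bounded_clinear_bounded_linear: "bounded_linear T"
    and bounded_clinear_add: "T (x + y) = T x + T y"
    and bounded_clinear_diff: "T (x - y) = T x - T y"
    and bounded_clinear_zero: "T 0 = 0"
    and bounded_clinear_scaleC: "T (c *\<^sub>C x) = c *\<^sub>C T x"
proof -
  show bl: "bounded_linear T" and "T (c *\<^sub>C x) = c *\<^sub>C T x"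
    using assms by (auto simp: bounded_clinear_def)
  show "T (x + y) = T x + T y" "T (x - y) = T x - T y" "T 0 = 0"
    using bl by (auto simp: linear_simps)
qed

lemma bounded_clinear_pos_bound:
  assumes "bounded_clinear T"
  obtains K where "K > 0" "\<And>x. norm (T x) \<le> K * norm x"
  using bounded_linear.pos_bounded[OF bounded_clinear_bounded_linear[OF assms]]
  by (metis mult.commute)

lemma bounded_clinear_compose:
  assumes "bounded_clinear S" "bounded_clinear T"
  shows "bounded_clinear (\<lambda>x. S (T x))"
  using assms bounded_linear_compose unfolding bounded_clinear_def by auto

lemma bounded_clinear_ident: "bounded_clinear (\<lambda>x. x)"
  by (simp add: bounded_clinear_def bounded_linear_ident)

lemma bounded_clinear_scaleC_right: "bounded_clinear (\<lambda>x. c *\<^sub>C x)"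
  by (rule bounded_clinearI[where K = "cmod c"])
     (auto simp: scaleC_add_right scaleC_scaleC norm_scaleC mult.commute)

lemma bounded_clinear_minus:
  assumes "bounded_clinear S" "bounded_clinear T"
  shows "bounded_clinear (\<lambda>x. S x - T x)"
  using assms bounded_linear_sub unfolding bounded_clinear_def by (auto simp: scaleC_diff_right)

lemma bounded_clinear_funpow:
  fixes T :: "'a :: complex_hilbert_space \<Rightarrow> 'a"
  assumes "bounded_clinear T"
  shows "bounded_clinear (T ^^ n)"
proof (induction n)
  case (Suc n)
  then show ?case using bounded_clinear_compose[OF assms Suc] by (simp add: o_def)
qed (use bounded_clinear_ident in \<open>simp add: id_def\<close>)

lemma norm_funpow_le:
  fixes T :: "'a :: real_normed_vector \<Rightarrow> 'a"
  assumes "\<And>x. norm (T x) \<le> K * norm x" "0 \<le> K"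
  shows "norm ((T ^^ n) x) \<le> K ^ n * norm x"
proof (induction n)
  case (Suc n)
  have "norm ((T ^^ Suc n) x) \<le> K * norm ((T ^^ n) x)" using assms by simp
  also have "\<dots> \<le> K * (K ^ n * norm x)" using Suc assms by (intro mult_left_mono)
  finally show ?case by (simp add: mult.assoc)
qed simp

lemma
  fixes T :: "nat \<Rightarrow> 'a :: complex_hilbert_space \<Rightarrow> 'b :: complex_hilbert_space"
  assumes T: "\<And>n. bounded_clinear (T n)"
    and bound: "\<And>n x. norm (T n x) \<le> K * r ^ n * norm x" and r: "0 \<le> r" "r < 1"
  shows operator_series_summable: "summable (\<lambda>n. T n x)"
    and bounded_clinear_operator_series: "bounded_clinear (\<lambda>x. \<Sum>n. T n x)"
proof -
  have geo: "summable (\<lambda>n. K * r ^ n * norm x)" for x :: 'a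
    using r by (intro summable_mult2 summable_mult summable_geometric) auto
  show sm: "summable (\<lambda>n. T n x)" for x
    by (rule summable_comparison_test[OF _ geo[of x]]) (use bound in auto)
  have smn: "summable (\<lambda>n. norm (T n x))" for x
    by (rule summable_comparison_test[OF _ geo[of x]]) (use bound in auto)
  show "bounded_clinear (\<lambda>x. \<Sum>n. T n x)"
  proof (rule bounded_clinearI[where K = "K / (1 - r)"])
    show "(\<Sum>n. T n (x + y)) = (\<Sum>n. T n x) + (\<Sum>n. T n y)" for x y
      by (simp add: bounded_clinear_add[OF T] suminf_add[OF sm sm])
    show "(\<Sum>n. T n (c *\<^sub>C x)) = c *\<^sub>C (\<Sum>n. T n x)" for c x
      using bounded_linear.suminf[OF bounded_clinear_bounded_linear[OF bounded_clinear_scaleC_right] sm]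
      by (simp add: bounded_clinear_scaleC[OF T])
    show "norm (\<Sum>n. T n x) \<le> K / (1 - r) * norm x" for x
    proof -
      have "norm (\<Sum>n. T n x) \<le> (\<Sum>n. norm (T n x))" by (rule summable_norm[OF smn])
      also have "\<dots> \<le> (\<Sum>n. K * r ^ n * norm x)" by (rule suminf_le[OF bound smn geo])
      also have "\<dots> = K / (1 - r) * norm x"
        using r suminf_geometric[of r]
        by (simp add: suminf_mult2[symmetric] suminf_mult summable_geometric summable_mult)
      finally show ?thesis .
    qed
  qed
qed

section \<open>Orthonormal sequences and the criterion for universality\<close>

lemma orthonormal_norm_sum:
  fixes e :: "nat \<Rightarrow> 'a :: complex_hilbert_space"
  assumes e: "\<And>m n. cinner (e m) (e n) = (if m = n then 1 else 0)" and "finite A"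
  shows "(norm (\<Sum>n\<in>A. c n *\<^sub>C e n))\<^sup>2 = (\<Sum>n\<in>A. (cmod (c n))\<^sup>2)"
proof -
  have "of_real ((norm (\<Sum>n\<in>A. c n *\<^sub>C e n))\<^sup>2) =
      (\<Sum>m\<in>A. cnj (c m) * (\<Sum>n\<in>A. c n * (if n = m then 1 else 0)))"
    by (simp only: cinner_self[symmetric] cinner_sum_left cinner_sum_right cinner_scaleC_left
        cinner_scaleC_right e)
  also have "\<dots> = (\<Sum>n\<in>A. c n * cnj (c n))"
    using \<open>finite A\<close> by (intro sum.cong refl) (simp add: if_distrib[of "(*) _"] cong: if_cong)
  also have "\<dots> = of_real (\<Sum>n\<in>A. (cmod (c n))\<^sup>2)"
    unfolding complex_norm_square[symmetric] by simp
  finally show ?thesis unfolding of_real_eq_iff .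
qed

text \<open>The tails of the series have the norms of the tails of \<open>c\<close>, so it is
  Cauchy, and Parseval's identity passes to the limit. With Taylor coefficients as \<open>c\<close>
  this is an isometric embedding of H^2.\<close>

lemma orthonormal_series:
  fixes e :: "nat \<Rightarrow> 'a :: complex_hilbert_space"
  assumes e: "\<And>m n. cinner (e m) (e n) = (if m = n then 1 else 0)"
    and c: "summable (\<lambda>n. (cmod (c n))\<^sup>2)"
  shows "summable (\<lambda>n. c n *\<^sub>C e n)" "(norm (\<Sum>n. c n *\<^sub>C e n))\<^sup>2 = (\<Sum>n. (cmod (c n))\<^sup>2)"
proof -
  show sm: "summable (\<lambda>n. c n *\<^sub>C e n)"
    unfolding summable_Cauchy
  proof (intro allI impI)
    fix \<epsilon> :: real assume "\<epsilon> > 0"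
    then obtain N where N: "\<And>m n. m \<ge> N \<Longrightarrow> norm (\<Sum>k=m..<n. (cmod (c k))\<^sup>2) < \<epsilon>\<^sup>2"
      using c unfolding summable_Cauchy by (meson zero_less_power)
    have "norm (\<Sum>k=m..<n. c k *\<^sub>C e k) < \<epsilon>" if "m \<ge> N" for m n
    proof (rule power2_less_imp_less)
      show "(norm (\<Sum>k=m..<n. c k *\<^sub>C e k))\<^sup>2 < \<epsilon>\<^sup>2"
        using N[OF that, of n] orthonormal_norm_sum[OF e, of "{m..<n}" c] by simp
    qed (use \<open>\<epsilon> > 0\<close> in simp)
    then show "\<exists>N. \<forall>m\<ge>N. \<forall>n. norm (\<Sum>k=m..<n. c k *\<^sub>C e k) < \<epsilon>" by blast
  qed
  have "(\<lambda>n. (norm (\<Sum>k<n. c k *\<^sub>C e k))\<^sup>2) \<longlonglongrightarrow> (norm (\<Sum>n. c n *\<^sub>C e n))\<^sup>2"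
    by (intro tendsto_intros summable_LIMSEQ sm)
  moreover have "(\<lambda>n. (norm (\<Sum>k<n. c k *\<^sub>C e k))\<^sup>2) \<longlonglongrightarrow> (\<Sum>n. (cmod (c n))\<^sup>2)"
    unfolding orthonormal_norm_sum[OF e finite_lessThan] by (rule summable_LIMSEQ[OF c])
  ultimately show "(norm (\<Sum>n. c n *\<^sub>C e n))\<^sup>2 = (\<Sum>n. (cmod (c n))\<^sup>2)"
    by (rule LIMSEQ_unique)
qed

lemma universal_operatorI:
  fixes U R :: "hardy2 \<Rightarrow> hardy2" and e :: "nat \<Rightarrow> hardy2"
  assumes U: "bounded_clinear U" and R: "bounded_clinear R" and UR: "\<And>x. U (R x) = x"
    and e: "\<And>m n. cinner (e m) (e n) = (if m = n then 1 else 0)" and Ue: "\<And>n. U (e n) = 0"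
  shows "universal_operator U"
  unfolding universal_operator_def
proof (intro conjI allI impI U)
  fix T :: "hardy2 \<Rightarrow> hardy2" assume T: "bounded_clinear T"
  define J where "J x = (\<Sum>n. taylor_coeff x n *\<^sub>C e n)" for x
  note J_series = orthonormal_series[OF e taylor_coeff_summable]
  have norm_J: "norm (J x) = norm x" for x
    using J_series(2)[of x] unfolding J_def norm_hardy2_power2[symmetric] by simp
  have J: "bounded_clinear J"
  proof (rule bounded_clinearI[where K = 1])
    show "J (x + y) = J x + J y" for x y
      unfolding J_def suminf_add[OF J_series(1) J_series(1)]
      by (simp add: taylor_coeff_add scaleC_add_left)
    show "J (c *\<^sub>C x) = c *\<^sub>C J x" for c x
      unfolding J_def
        bounded_linear.suminf[OF bounded_clinear_bounded_linear[OF bounded_clinear_scaleC_right] J_series(1)]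
      by (simp add: taylor_coeff_scaleC scaleC_scaleC)
  qed (simp add: norm_J)
  have UJ: "U (J x) = 0" for x
    unfolding J_def bounded_linear.suminf[OF bounded_clinear_bounded_linear[OF U] J_series(1)]
    by (simp add: bounded_clinear_scaleC[OF U] Ue)
  obtain KR where KR: "KR > 0" "\<And>x. norm (R x) \<le> KR * norm x"
    by (rule bounded_clinear_pos_bound[OF R]) blast
  obtain KT where KT: "KT > 0" "\<And>x. norm (T x) \<le> KT * norm x"
    by (rule bounded_clinear_pos_bound[OF T]) blast
  obtain KU where KU: "KU > 0" "\<And>x. norm (U x) \<le> KU * norm x"
    by (rule bounded_clinear_pos_bound[OF U]) blast
  \<comment> \<open>Scaling T to norm at most 1 / (2 KR) outweighs the growth of the powers of
    \<open>R\<close>: the n-th term of the series for \<open>V\<close> is at most 2^(-n) in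
    norm.\<close>
  define \<delta> where "\<delta> = 1 / (2 * KR)"
  define \<alpha> :: complex where "\<alpha> = of_real (\<delta> / KT)"
  define A where "A x = \<alpha> *\<^sub>C T x" for x
  have \<delta>: "\<delta> > 0" "KR * \<delta> = 1 / 2" using KR by (auto simp: \<delta>_def)
  have A: "bounded_clinear A"
    unfolding A_def by (rule bounded_clinear_compose[OF bounded_clinear_scaleC_right T])
  have norm_A: "norm (A x) \<le> \<delta> * norm x" for x
  proof -
    have "norm (A x) = \<delta> / KT * norm (T x)"
      using \<delta> KT by (simp add: A_def norm_scaleC \<alpha>_def norm_divide)
    also have "\<dots> \<le> \<delta> / KT * (KT * norm x)"
      using \<delta> KT by (intro mult_left_mono) auto
    finally show ?thesis using KT by simp
  qed
  define S where "S n x = (R ^^ n) (J ((A ^^ n) x))" for n x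
  have S: "bounded_clinear (S n)" for n
    unfolding S_def by (intro bounded_clinear_compose[OF bounded_clinear_funpow[OF R]]
        bounded_clinear_compose[OF J bounded_clinear_funpow[OF A]])
  have norm_S: "norm (S n x) \<le> 1 * (1 / 2) ^ n * norm x" for n x
  proof -
    have "norm (S n x) \<le> KR ^ n * norm ((A ^^ n) x)"
      using norm_funpow_le[of R KR n "J ((A ^^ n) x)"] KR by (simp add: S_def norm_J)
    also have "\<dots> \<le> KR ^ n * (\<delta> ^ n * norm x)"
      using KR \<delta> by (intro mult_left_mono norm_funpow_le norm_A) auto
    also have "\<dots> = (KR * \<delta>) ^ n * norm x" by (simp add: power_mult_distrib)
    finally show ?thesis unfolding \<delta> by simp
  qed
  define V where "V x = (\<Sum>n. S n x)" for x
  have sm: "summable (\<lambda>n. S n x)" for x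
    by (rule operator_series_summable[OF S norm_S]) auto
  have V: "bounded_clinear V"
    unfolding V_def by (rule bounded_clinear_operator_series[OF S norm_S]) auto
  have S_Suc: "S (Suc n) x = R (S n (A x))" for n x
    by (simp add: S_def funpow_swap1)
  have V_eq: "V x = J x + R (V (A x))" for x
  proof -
    have "V x = S 0 x + (\<Sum>n. S (Suc n) x)"
      unfolding V_def using suminf_split_head[OF sm[of x]] by simp
    also have "(\<Sum>n. S (Suc n) x) = R (V (A x))"
      unfolding V_def S_Suc using bounded_linear.suminf[OF bounded_clinear_bounded_linear[OF R] sm] by simp
    finally show ?thesis by (simp add: S_def)
  qed
  have UV: "U (V x) = V (A x)" for x
    unfolding V_eq[of x] bounded_clinear_add[OF U] UJ UR by simp
  define k where "k = 1 + KR * KU"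
  have k: "k > 0" using KR KU by (simp add: k_def add_pos_pos)
  \<comment> \<open>From \<open>U V = V A\<close> the recursion for \<open>V\<close> becomes
    \<open>J x = V x - R (U (V x))\<close>, and \<open>J\<close> preserves norms. So
    \<open>V\<close> is bounded below, which gives injectivity, a continuous inverse and a closed
    range at once.\<close>
  have lower: "norm x \<le> k * norm (V x)" for x
  proof -
    have "norm x = norm (V x - R (U (V x)))"
      unfolding UV using V_eq[of x] norm_J[of x] by (metis add_diff_cancel_right')
    also have "\<dots> \<le> norm (V x) + norm (R (U (V x)))" by (rule norm_triangle_ineq4)
    also have "norm (R (U (V x))) \<le> KR * (KU * norm (V x))"
      by (rule order_trans[OF KR(2)]) (use KR KU in \<open>auto intro!: mult_left_mono\<close>)
    finally show ?thesis by (simp add: k_def algebra_simps)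
  qed
  define W where "W = inv V"
  have "inj V"
  proof (rule injI)
    fix x y assume "V x = V y"
    then show "x = y" using lower[of "x - y"] by (simp add: bounded_clinear_diff[OF V])
  qed
  then have WV: "W (V x) = x" for x by (simp add: W_def)
  have W: "continuous_on (range V) W"
    unfolding continuous_on_iff
  proof (intro ballI allI impI)
    fix y and \<epsilon> :: real assume "y \<in> range V" "\<epsilon> > 0"
    have "dist (W z) (W y) < \<epsilon>" if zV: "z \<in> range V" and "dist z y < \<epsilon> / k" for z
    proof -
      obtain x x' where xx: "y = V x" "z = V x'" using zV \<open>y \<in> range V\<close> by blast
      have "dist x' x \<le> k * dist z y"
        using lower[of "x' - x"] by (simp add: dist_norm xx bounded_clinear_diff[OF V])
      also have "\<dots> < \<epsilon>" using that k by (simp add: field_simps)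
      finally show ?thesis by (simp add: xx WV)
    qed
    then show "\<exists>d>0. \<forall>z\<in>range V. dist z y < d \<longrightarrow> dist (W z) (W y) < \<epsilon>"
      using k \<open>\<epsilon> > 0\<close> by (intro exI[of _ "\<epsilon> / k"]) auto
  qed
  have "homeomorphism UNIV (range V) V W"
    unfolding homeomorphism_def using W WV
    by (auto simp: linear_continuous_on[OF bounded_clinear_bounded_linear[OF V]] image_def)
  then have sim: "restriction_similar U (range V) A"
    unfolding restriction_similar_def using V
    by (intro exI[of _ V] exI[of _ W]) (simp add: UV WV)
  have "complete (range V)"
  proof (rule complete_isometric_image[where e = "1 / k"])
    show "\<forall>x\<in>UNIV. norm (V x) \<ge> 1 / k * norm x"
      using lower k by (simp add: field_simps)
  qed (use k bounded_clinear_bounded_linear[OF V] in \<open>auto simp: complete_UNIV\<close>)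
  then have "closed (range V)" by (rule complete_imp_closed)
  moreover have "csubspace (range V)"
    unfolding csubspace_def
  proof (intro conjI ballI allI)
    show "0 \<in> range V" using rangeI[of V 0] by (simp add: bounded_clinear_zero[OF V])
    show "x + y \<in> range V" if "x \<in> range V" "y \<in> range V" for x y
      using that by (auto simp flip: bounded_clinear_add[OF V])
    show "c *\<^sub>C x \<in> range V" if "x \<in> range V" for c x
      using that by (auto simp flip: bounded_clinear_scaleC[OF V])
  qed
  moreover have "U ` range V \<subseteq> range V" by (auto simp: UV)
  moreover have "\<alpha> \<noteq> 0" using \<delta> KT by (simp add: \<alpha>_def)
  ultimately show "\<exists>\<alpha> M. \<alpha> \<noteq> 0 \<and> closed M \<and> csubspace M \<and> U ` M \<subseteq> M \<and>
      restriction_similar U M (\<lambda>x. \<alpha> *\<^sub>C T x)"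
    using sim unfolding A_def by (intro exI[of _ \<alpha>] exI[of _ "range V"]) auto
qed

text \<open>An injective intertwiner is all that the negative results need: it carries kernels and
  Jordan chains of T over to \<open>U\<close>.\<close>

lemma universal_operatorE:
  fixes U T :: "'a :: complex_hilbert_space \<Rightarrow> 'a"
  assumes "universal_operator U" "bounded_clinear T"
  obtains \<alpha> V where "\<alpha> \<noteq> 0" "bounded_clinear V" "inj V" "\<And>x. U (V x) = V (\<alpha> *\<^sub>C T x)"
proof -
  have "\<exists>\<alpha> M. \<alpha> \<noteq> 0 \<and> closed M \<and> csubspace M \<and> U ` M \<subseteq> M \<and>
      restriction_similar U M (\<lambda>x. \<alpha> *\<^sub>C T x)"
    using assms unfolding universal_operator_def by simp
  then obtain \<alpha> M where 1: "\<alpha> \<noteq> 0" "U ` M \<subseteq> M" "restriction_similar U M (\<lambda>x. \<alpha> *\<^sub>C T x)"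
    by (elim exE conjE)
  obtain V W where 2: "bounded_clinear V" "homeomorphism UNIV M V W" "\<And>x. W (U (V x)) = \<alpha> *\<^sub>C T x"
    using 1(3) unfolding restriction_similar_def by (elim exE conjE) simp
  have WV: "\<And>x. W (V x) = x" and VW: "\<And>y. y \<in> M \<Longrightarrow> V (W y) = y" and VM: "\<And>x. V x \<in> M"
    using 2(2) unfolding homeomorphism_def by auto
  have "U (V x) = V (\<alpha> *\<^sub>C T x)" for x
  proof -
    have "U (V x) \<in> M" using VM[of x] 1(2) by blast
    then show ?thesis using VW[of "U (V x)"] 2(3)[of x] by simp
  qed
  moreover have "inj V" by (metis WV injI)
  ultimately show ?thesis using that 1(1) 2(1) by simp
qed

section \<open>Composition operators via Poisson majorants\<close>

lemma hardy2_apply_eqI: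
  assumes "\<And>z. cmod z < 1 \<Longrightarrow> hardy2_apply f z = hardy2_apply g z"
  shows "f = g"
proof -
  have "hardy2_apply f z = hardy2_apply g z" for z
    using assms[of z] by (cases "cmod z < 1") (auto simp: hardy2_outside)
  then show ?thesis by (metis ext hardy2_apply_inject)
qed

lemma hardy2_apply_add: "hardy2_apply (f + g) z = hardy2_apply f z + hardy2_apply g z"
  using hardy2_add(1)[OF hardy2_apply hardy2_apply, of f g]
  by (simp add: plus_hardy2_def Abs_hardy2_inverse)

lemma hardy2_apply_scaleC: "hardy2_apply (c *\<^sub>C f) z = c * hardy2_apply f z"
  using hardy2_scale(1)[OF hardy2_apply, of c f]
  by (simp add: scaleC_hardy2_def Abs_hardy2_inverse)

lemma hardy2_apply_zero: "hardy2_apply 0 z = 0"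
  using hardy2_apply_scaleC[of 0 0 z] by simp

lemma hardy2_apply_diff: "hardy2_apply (f - g) z = hardy2_apply f z - hardy2_apply g z"
  using hardy2_apply_add[of "f - g" g z] by simp

lemma hardy2_apply_sum: "hardy2_apply (sum f A) z = (\<Sum>i\<in>A. hardy2_apply (f i) z)"
  by (induction A rule: infinite_finite_induct) (auto simp: hardy2_apply_zero hardy2_apply_add)

text \<open>Evaluation at \<open>z\<close> is the inner product with the Szego kernel, which has
  coefficients \<open>cnj z ^ n\<close> and squared norm 1 / (1 - |z|^2).\<close>

lemma cmod_hardy2_apply_le:
  assumes z: "cmod z < 1"
  shows "(cmod (hardy2_apply f z))\<^sup>2 * (1 - (cmod z)\<^sup>2) \<le> (norm f)\<^sup>2"
proof -
  define q where "q = (cmod z)\<^sup>2"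
  have q: "0 \<le> q" "q < 1" using z by (auto simp: q_def abs_square_less_1)
  have eq: "(cmod (cnj z ^ n))\<^sup>2 = q ^ n" for n
    by (simp add: q_def norm_power power_mult[symmetric] mult.commute)
  obtain k where k: "taylor_coeff k = (\<lambda>n. cnj z ^ n)"
    using hardy2_of_coeffs[of "\<lambda>n. cnj z ^ n"] q unfolding eq by (auto simp: summable_geometric)
  have "hardy2_apply f z = cinner f k"
    using taylor_coeff_sums[OF z, of f] by (simp add: sums_iff cinner_hardy2_def k)
  then have "cmod (hardy2_apply f z) \<le> norm f * norm k"
    using cmod_cinner_le by simp
  then have "(cmod (hardy2_apply f z))\<^sup>2 \<le> (norm f)\<^sup>2 * (norm k)\<^sup>2"
    by (metis norm_ge_zero power_mono power_mult_distrib)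
  moreover have "(norm k)\<^sup>2 = 1 / (1 - q)"
    unfolding norm_hardy2_power2 k eq using suminf_geometric[of q] q by simp
  ultimately show ?thesis using q by (simp add: q_def field_simps)
qed

section \<open>Shifts and the resolvent of the backward shift\<close>

definition backward_shift :: "hardy2 \<Rightarrow> hardy2" where
  "backward_shift f = (SOME g. taylor_coeff g = (\<lambda>n. taylor_coeff f (Suc n)))"

definition forward_shift :: "hardy2 \<Rightarrow> hardy2" where
  "forward_shift f = (SOME g. taylor_coeff g = (\<lambda>n. case n of 0 \<Rightarrow> 0 | Suc m \<Rightarrow> taylor_coeff f m))"

lemma taylor_coeff_backward_shift: "taylor_coeff (backward_shift f) n = taylor_coeff f (Suc n)"
proof -
  have "summable (\<lambda>n. (cmod (taylor_coeff f (Suc n)))\<^sup>2)"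
    using taylor_coeff_summable[of f] by (subst summable_Suc_iff)
  from hardy2_of_coeffs[OF this]
  have "taylor_coeff (backward_shift f) = (\<lambda>n. taylor_coeff f (Suc n))"
    unfolding backward_shift_def by (metis (mono_tags, lifting) someI_ex)
  then show ?thesis by simp
qed

lemma taylor_coeff_forward_shift:
  "taylor_coeff (forward_shift f) n = (case n of 0 \<Rightarrow> 0 | Suc m \<Rightarrow> taylor_coeff f m)"
proof -
  have "summable (\<lambda>n. (cmod (case n of 0 \<Rightarrow> 0 | Suc m \<Rightarrow> taylor_coeff f m))\<^sup>2)"
    by (subst summable_Suc_iff[symmetric]) (simp add: taylor_coeff_summable)
  from hardy2_of_coeffs[OF this]
  have "taylor_coeff (forward_shift f) = (\<lambda>n. case n of 0 \<Rightarrow> 0 | Suc m \<Rightarrow> taylor_coeff f m)"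
    unfolding forward_shift_def by (metis (mono_tags, lifting) someI_ex)
  then show ?thesis by simp
qed

lemma norm_backward_shift: "(norm f)\<^sup>2 = (cmod (taylor_coeff f 0))\<^sup>2 + (norm (backward_shift f))\<^sup>2"
  unfolding norm_hardy2_power2 taylor_coeff_backward_shift
  using suminf_split_head[OF taylor_coeff_summable[of f]] by simp

lemma norm_forward_shift: "norm (forward_shift f) = norm f"
proof -
  have "(norm (forward_shift f))\<^sup>2 = (norm f)\<^sup>2"
    unfolding norm_hardy2_power2[of "forward_shift f"]
    using suminf_split_head[OF taylor_coeff_summable[of "forward_shift f"]]
    by (simp add: taylor_coeff_forward_shift norm_hardy2_power2)
  then show ?thesis by simp
qed

lemma norm_backward_shift_le: "norm (backward_shift f) \<le> norm f"
  by (rule power2_le_imp_le) (use norm_backward_shift[of f] in auto)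

lemma bounded_clinear_backward_shift: "bounded_clinear backward_shift"
  by (rule bounded_clinearI[where K = 1])
     (auto intro!: hardy2_eqI simp: taylor_coeff_backward_shift taylor_coeff_add
       taylor_coeff_scaleC norm_backward_shift_le)

lemma bounded_clinear_forward_shift: "bounded_clinear forward_shift"
  by (rule bounded_clinearI[where K = 1])
     (auto intro!: hardy2_eqI simp: taylor_coeff_forward_shift taylor_coeff_add
       taylor_coeff_scaleC norm_forward_shift split: nat.split)

lemma hardy2_apply_forward_shift:
  assumes "cmod z < 1"
  shows "hardy2_apply (forward_shift f) z = z * hardy2_apply f z"
proof -
  have "(\<lambda>n. z * (taylor_coeff f n * z ^ n)) sums (z * hardy2_apply f z)"
    by (intro sums_mult taylor_coeff_sums assms)
  then have "(\<lambda>n. taylor_coeff (forward_shift f) (Suc n) * z ^ Suc n) sums (z * hardy2_apply f z)"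
    by (simp add: taylor_coeff_forward_shift mult_ac)
  then have "(\<lambda>n. taylor_coeff (forward_shift f) n * z ^ n) sums (z * hardy2_apply f z)"
    by (subst (asm) sums_Suc_iff) (simp add: taylor_coeff_forward_shift)
  then show ?thesis using taylor_coeff_sums[OF assms, of "forward_shift f"] sums_unique2 by blast
qed

lemma hardy2_apply_backward_shift:
  assumes "cmod z < 1"
  shows "hardy2_apply f z = taylor_coeff f 0 + z * hardy2_apply (backward_shift f) z"
proof -
  have "f = taylor_coeff f 0 *\<^sub>C f' + forward_shift (backward_shift f)"
    if "taylor_coeff f' = (\<lambda>n. if n = 0 then 1 else 0)" for f'
    by (rule hardy2_eqI)
       (auto simp: that taylor_coeff_add taylor_coeff_scaleC taylor_coeff_forward_shift
         taylor_coeff_backward_shift split: nat.split)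
  moreover obtain f' where f': "taylor_coeff f' = (\<lambda>n. if n = 0 then 1 else 0)"
  proof (rule hardy2_of_coeffs)
    show "summable (\<lambda>n. (cmod (if n = 0 then 1 else 0))\<^sup>2)"
      by (rule summable_finite[of "{0}"]) auto
  qed
  moreover have "hardy2_apply f' z = 1"
  proof -
    have "(\<lambda>n. taylor_coeff f' n * z ^ n) sums (\<Sum>n\<in>{0}. taylor_coeff f' n * z ^ n)"
      by (rule sums_finite) (auto simp: f')
    then show ?thesis
      using taylor_coeff_sums[OF assms, of f'] sums_unique2 by (force simp: f')
  qed
  ultimately show ?thesis
    using assms by (metis hardy2_apply_add hardy2_apply_scaleC hardy2_apply_forward_shift mult.right_neutral)
qed

text \<open>For B the backward shift this is the Neumann series of (1 - x B)^(-1) applied to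
  \<open>f\<close>. As a function of z it is (z f(z) - x f(x)) / (z - x), so its constant
  coefficient is f(x).\<close>

definition shift_resolvent :: "complex \<Rightarrow> hardy2 \<Rightarrow> hardy2" where
  "shift_resolvent x f = (\<Sum>k. x ^ k *\<^sub>C (backward_shift ^^ k) f)"

context
  fixes x :: complex
  assumes x: "cmod x < 1"
begin

lemma norm_shift_resolvent_term:
  "norm (x ^ k *\<^sub>C (backward_shift ^^ k) f) \<le> 1 * cmod x ^ k * norm f"
  using norm_funpow_le[of backward_shift 1 k f] norm_backward_shift_le
  by (auto simp: norm_scaleC norm_power intro!: mult_left_mono)

lemma shift_resolvent_summable: "summable (\<lambda>k. x ^ k *\<^sub>C (backward_shift ^^ k) f)"
  by (rule operator_series_summable[OF _ norm_shift_resolvent_term])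
     (use x in \<open>auto intro: bounded_clinear_compose[OF bounded_clinear_scaleC_right]
       bounded_clinear_funpow bounded_clinear_backward_shift\<close>)

lemma norm_shift_resolvent: "norm (shift_resolvent x f) \<le> norm f / (1 - cmod x)"
proof -
  have s: "summable (\<lambda>k. cmod x ^ k * norm f)"
    using x by (intro summable_mult2 summable_geometric) auto
  have "norm (shift_resolvent x f) \<le> (\<Sum>k. cmod x ^ k * norm f)"
    unfolding shift_resolvent_def using norm_shift_resolvent_term[of _ f] 
    by (intro norm_suminf_le[OF _ s]) auto
  also have "\<dots> = norm f / (1 - cmod x)"
    using x suminf_geometric[of "cmod x"] by (simp add: suminf_mult2[symmetric] summable_geometric)
  finally show ?thesis .
qed

lemma shift_resolvent_eq:
  "shift_resolvent x f = f + x *\<^sub>C shift_resolvent x (backward_shift f)"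
  "backward_shift (shift_resolvent x f) = shift_resolvent x (backward_shift f)"
proof -
  have "shift_resolvent x f = f + (\<Sum>k. x ^ Suc k *\<^sub>C (backward_shift ^^ Suc k) f)"
    unfolding shift_resolvent_def using suminf_split_head[OF shift_resolvent_summable[of f]] by simp
  also have "(\<lambda>k. x ^ Suc k *\<^sub>C (backward_shift ^^ Suc k) f) =
      (\<lambda>k. x *\<^sub>C x ^ k *\<^sub>C (backward_shift ^^ k) (backward_shift f))"
    by (simp add: scaleC_scaleC funpow_swap1)
  also have "suminf \<dots> = x *\<^sub>C shift_resolvent x (backward_shift f)"
    unfolding shift_resolvent_def
    by (rule bounded_linear.suminf[OF bounded_clinear_bounded_linear[OF bounded_clinear_scaleC_right]
          shift_resolvent_summable, symmetric])
  finally show "shift_resolvent x f = f + x *\<^sub>C shift_resolvent x (backward_shift f)" .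
  show "backward_shift (shift_resolvent x f) = shift_resolvent x (backward_shift f)"
    unfolding shift_resolvent_def
      bounded_linear.suminf[OF bounded_clinear_bounded_linear[OF bounded_clinear_backward_shift]
          shift_resolvent_summable]
    by (simp add: bounded_clinear_scaleC[OF bounded_clinear_backward_shift] funpow_swap1)
qed

lemma taylor_coeff_funpow_backward_shift:
  "taylor_coeff ((backward_shift ^^ k) f) n = taylor_coeff f (n + k)"
  by (induction k arbitrary: n) (auto simp: taylor_coeff_backward_shift)

lemma taylor_coeff_shift_resolvent: "taylor_coeff (shift_resolvent x f) 0 = hardy2_apply f x"
proof -
  have bl: "bounded_linear (\<lambda>f. taylor_coeff f 0)"
    by (rule bounded_linear_intro[where K = 1])
       (auto simp: taylor_coeff_add taylor_coeff_scaleR taylor_coeff_norm_le scaleR_conv_of_real)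
  have "taylor_coeff (shift_resolvent x f) 0 = (\<Sum>k. taylor_coeff f k * x ^ k)"
    unfolding shift_resolvent_def bounded_linear.suminf[OF bl shift_resolvent_summable]
    by (simp add: taylor_coeff_scaleC taylor_coeff_funpow_backward_shift mult.commute)
  then show ?thesis using taylor_coeff_sums[OF x, of f] by (simp add: sums_iff)
qed

end

text \<open>The real part of \<open>poisson_lift f\<close> is the Poisson integral of the boundary function \<open>\<bar>f\<bar>\<^sup>2\<close>,
  expressed here through the resolvent of the backward shift.\<close>

definition poisson_lift :: "hardy2 \<Rightarrow> complex \<Rightarrow> complex" where
  "poisson_lift f x = cinner (2 *\<^sub>C shift_resolvent x f - f) f"

lemma bounded_linear_cinner_left: "bounded_linear (\<lambda>x. cinner x (y :: 'a :: complex_hilbert_space))"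
  by (rule bounded_linear_intro[where K = "norm y"])
     (auto simp: cinner_add_left cmod_cinner_le scaleR_conv_of_real
       simp flip: scaleC_of_real simp: cinner_scaleC_left)

lemma poisson_lift_holomorphic: "poisson_lift f holomorphic_on ball 0 1"
proof (rule power_series_holomorphic)
  define a where "a k = 2 * cinner ((backward_shift ^^ k) f) f" for k
  fix x :: complex assume "x \<in> ball 0 1"
  then have x: "cmod x < 1" by simp
  have "(\<lambda>k. 2 * cinner (x ^ k *\<^sub>C (backward_shift ^^ k) f) f) sums (2 * cinner (shift_resolvent x f) f)"
    unfolding shift_resolvent_def
    by (intro sums_mult bounded_linear.sums[OF bounded_linear_cinner_left] summable_sums
        shift_resolvent_summable x)
  then have "(\<lambda>k. a k * x ^ k) sums (2 * cinner (shift_resolvent x f) f)"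
    by (simp add: a_def cinner_scaleC_left mult_ac)
  moreover have "(\<lambda>k. (if k = 0 then - cinner f f else 0)) sums (- cinner f f)"
    by (rule sums_single)
  ultimately have "(\<lambda>k. a k * x ^ k + (if k = 0 then - cinner f f else 0)) sums
      (2 * cinner (shift_resolvent x f) f + - cinner f f)"
    by (rule sums_add)
  moreover have "poisson_lift f x = 2 * cinner (shift_resolvent x f) f + - cinner f f"
    using cinner_add_left[of "2 *\<^sub>C shift_resolvent x f - f" f f]
    by (simp add: poisson_lift_def cinner_scaleC_left)
  moreover have "a k * x ^ k + (if k = 0 then - cinner f f else 0) =
      (a k + (if k = 0 then - cinner f f else 0)) * (x - 0) ^ k" for k
    by simp
  ultimately show "(\<lambda>k. (a k + (if k = 0 then - cinner f f else 0)) * (x - 0) ^ k) sums poisson_lift f x"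
    by simp
qed

text \<open>With \<open>h\<close> the resolvent and \<open>y = x B h\<close>, one has
  \<open>f = h - y\<close> and \<open>2 h - f = h + y\<close>, so the real part is the difference of
  the squared norms of \<open>h\<close> and \<open>y\<close>. Passing from \<open>h\<close> to
  \<open>B h\<close> loses exactly the constant coefficient f(x).\<close>

lemma Re_poisson_lift:
  assumes x: "cmod x < 1"
  shows "Re (poisson_lift f x) = (1 - (cmod x)\<^sup>2) * (norm (shift_resolvent x f))\<^sup>2
    + (cmod x)\<^sup>2 * (cmod (hardy2_apply f x))\<^sup>2"
proof -
  define h where "h = shift_resolvent x f"
  define y where "y = x *\<^sub>C backward_shift h"
  have f: "f = h - y"
    using shift_resolvent_eq[OF x, of f] by (simp add: h_def y_def)
  have "2 *\<^sub>C h = h + h" using scaleC_add_left[of 1 1 h] by simp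
  then have eq: "2 *\<^sub>C h - f = h + y" unfolding f by simp
  have "Re (poisson_lift f x) = inner (h + y) (h - y)"
    unfolding poisson_lift_def h_def[symmetric] eq inner_eq_Re_cinner using f by simp
  also have "\<dots> = (norm h)\<^sup>2 - (norm y)\<^sup>2"
    using inner_commute[of h y] by (simp add: power2_norm_eq_inner inner_add_left inner_diff_right)
  also have "(norm y)\<^sup>2 = (cmod x)\<^sup>2 * ((norm h)\<^sup>2 - (cmod (hardy2_apply f x))\<^sup>2)"
    using norm_backward_shift[of h] taylor_coeff_shift_resolvent[OF x, of f]
    by (simp add: y_def norm_scaleC power_mult_distrib h_def)
  finally show ?thesis by (simp add: h_def algebra_simps)
qed

text \<open>\<open>Re_poisson_lift\<close> is a convex combination with weights 1 - |x|^2 and |x|^2,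
  and both averaged quantities are at least |f(x)|^2, the first because f(x) is a coefficient of the
  resolvent.\<close>

lemma power2_cmod_hardy2_apply_le:
  assumes x: "cmod x < 1"
  shows "(cmod (hardy2_apply f x))\<^sup>2 \<le> Re (poisson_lift f x)"
proof -
  have "cmod (hardy2_apply f x) \<le> norm (shift_resolvent x f)"
    using taylor_coeff_norm_le[of "shift_resolvent x f" 0] taylor_coeff_shift_resolvent[OF x, of f] by simp
  then have "(1 - (cmod x)\<^sup>2) * (cmod (hardy2_apply f x))\<^sup>2 \<le> (1 - (cmod x)\<^sup>2) * (norm (shift_resolvent x f))\<^sup>2"
    using x by (intro mult_left_mono power_mono) (auto simp: abs_square_le_1)
  then show ?thesis unfolding Re_poisson_lift[OF x] by (simp add: algebra_simps)
qed

lemma Re_poisson_lift_le: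
  assumes x: "cmod x < 1"
  shows "Re (poisson_lift f x) \<le> 3 / (1 - cmod x) * (norm f)\<^sup>2"
proof -
  have "Re (poisson_lift f x) \<le> norm (2 *\<^sub>C shift_resolvent x f - f) * norm f"
    unfolding poisson_lift_def inner_eq_Re_cinner[symmetric] by (rule norm_cauchy_schwarz)
  also have "norm (2 *\<^sub>C shift_resolvent x f - f) \<le> 2 * norm (shift_resolvent x f) + norm f"
    using norm_triangle_ineq4[of "2 *\<^sub>C shift_resolvent x f" f] by (simp add: norm_scaleC)
  also have "\<dots> \<le> 2 * (norm f / (1 - cmod x)) + norm f"
    using norm_shift_resolvent[OF x, of f] by simp
  also have "\<dots> \<le> 2 * (norm f / (1 - cmod x)) + norm f / (1 - cmod x)"
    using x by (intro add_left_mono) (simp add: field_simps mult_left_le)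
  finally have "Re (poisson_lift f x) \<le> (3 / (1 - cmod x) * norm f) * norm f"
    by (simp add: mult_right_mono)
  then show ?thesis by (simp add: power2_eq_square mult.assoc)
qed

section \<open>Harmonic majorants and composition operators\<close>

lemma holomorphic_circle_mean:
  assumes F: "F holomorphic_on ball 0 1" and r: "0 < r" "r < 1"
  shows "((\<lambda>t. F (of_real r * cis t)) has_integral 2 * of_real pi * F 0) {0..2 * pi}"
proof -
  have "((\<lambda>u. F u / (u - 0)) has_contour_integral (2 * of_real pi * \<i> * F 0)) (circlepath 0 r)"
    by (rule Cauchy_integral_circlepath_simple)
       (use r in \<open>auto intro!: holomorphic_on_subset[OF F]\<close>)
  then have "((\<lambda>x. F (circlepath 0 r x) / circlepath 0 r x * vector_derivative (circlepath 0 r) (at x))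
      has_integral (2 * of_real pi * \<i> * F 0)) {0..1}"
    by (simp add: has_contour_integral)
  moreover have "F (circlepath 0 r x) / circlepath 0 r x * vector_derivative (circlepath 0 r) (at x) =
      2 * of_real pi * \<i> * F (of_real r * cis (2 * pi * x))" for x
    unfolding vector_derivative_circlepath using r by (simp add: circlepath cis_conv_exp mult_ac)
  ultimately have "((\<lambda>x. 2 * of_real pi * \<i> * F (of_real r * cis (2 * pi * x)))
      has_integral (2 * of_real pi * \<i> * F 0)) {0..1}"
    by simp
  from has_integral_mult_right[OF this, of "1 / (2 * of_real pi * \<i>)"]
  have "((\<lambda>x. F (of_real r * cis (2 * pi * x))) has_integral F 0) {0..1}"
    by simp
  moreover have "(\<lambda>x. x / (1 / (2 * pi))) ` {0..1} = {0..2 * pi}"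
    by (subst image_divide_atLeastAtMost) auto
  ultimately have "((\<lambda>x. F (of_real r * cis (2 * pi * (1 / (2 * pi) * x)))) has_integral
      (1 / \<bar>1 / (2 * pi)\<bar>) *\<^sub>R F 0) {0..2 * pi}"
    using has_integral_stretch_real[of "\<lambda>x. F (of_real r * cis (2 * pi * x))" "F 0" 0 1 "1 / (2 * pi)"]
    by simp
  then show ?thesis by (simp add: scaleR_conv_of_real)
qed

text \<open>The integral means of |g|^2 are bounded by those of the harmonic function
  \<open>Re F\<close>, which all equal its value at 0. Membership in H^2 and the norm bound come out
  together.\<close>

lemma hardy2_majorant:
  assumes g: "g holomorphic_on ball 0 1" and F: "F holomorphic_on ball 0 1"
    and le: "\<And>z. cmod z < 1 \<Longrightarrow> (cmod (g z))\<^sup>2 \<le> Re (F z)"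
  obtains f where "\<And>z. cmod z < 1 \<Longrightarrow> hardy2_apply f z = g z" "(norm f)\<^sup>2 \<le> Re (F 0)"
proof -
  define f where "f z = (if z \<in> ball 0 1 then g z else 0)" for z
  have f: "f holomorphic_on ball 0 1"
    by (rule holomorphic_transform[OF g]) (simp add: f_def)
  have mean: "integral_mean f r \<le> Re (F 0)" if r: "r \<in> {0..<1}" for r
  proof (cases "r = 0")
    case True
    then show ?thesis using le[of 0] by (simp add: integral_mean_def f_def)
  next
    case False
    with r have r: "0 < r" "r < 1" by auto
    have "((\<lambda>t. Re (F (of_real r * cis t))) has_integral Re (2 * of_real pi * F 0)) {0..2 * pi}"
      using has_integral_linear[OF holomorphic_circle_mean[OF F r] bounded_linear_Re] by (simp add: o_def)
    moreover have "(\<lambda>t. (cmod (f (of_real r * cis t)))\<^sup>2) integrable_on {0..2 * pi}"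
    proof (rule integrable_continuous_real)
      have "continuous_on {0..2 * pi} (f \<circ> (\<lambda>t. of_real r * cis t))"
        by (intro continuous_on_compose continuous_intros
              continuous_on_subset[OF holomorphic_on_imp_continuous_on[OF f]])
           (use r in \<open>auto simp: norm_mult\<close>)
      then show "continuous_on {0..2 * pi} (\<lambda>t. (cmod (f (of_real r * cis t)))\<^sup>2)"
        by (intro continuous_intros) (simp add: o_def)
    qed
    moreover have "(cmod (f (of_real r * cis t)))\<^sup>2 \<le> Re (F (of_real r * cis t))" for t
      using r le[of "of_real r * cis t"] by (simp add: f_def norm_mult)
    ultimately have "integral {0..2 * pi} (\<lambda>t. (cmod (f (of_real r * cis t)))\<^sup>2) \<le> Re (2 * of_real pi * F 0)"
      by (intro has_integral_le[OF integrable_integral]) auto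
    then show ?thesis by (simp add: integral_mean_def field_simps)
  qed
  have "f \<in> hardy2_set"
    unfolding hardy2_set_iff_integral_means
    using f mean by (auto simp: f_def intro!: bdd_aboveI2[where M = "Re (F 0)"])
  then have app: "hardy2_apply (Abs_hardy2 f) = f" by (rule Abs_hardy2_inverse)
  have "(norm (Abs_hardy2 f))\<^sup>2 \<le> Re (F 0)"
    unfolding norm_hardy2_integral_means app by (rule cSUP_least) (use mean in auto)
  then show ?thesis using that[of "Abs_hardy2 f"] by (simp add: app f_def)
qed

definition self_map :: "(complex \<Rightarrow> complex) \<Rightarrow> bool" where
  "self_map \<psi> \<longleftrightarrow> \<psi> holomorphic_on ball 0 1 \<and> (\<forall>z. cmod z < 1 \<longrightarrow> cmod (\<psi> z) < 1)"

lemma self_map_compose: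
  assumes "self_map \<psi>" "F holomorphic_on ball 0 1"
  shows "(\<lambda>z. F (\<psi> z)) holomorphic_on ball 0 1"
  using holomorphic_on_compose_gen[of \<psi> "ball 0 1" F "ball 0 1"] assms
  by (auto simp: self_map_def o_def image_subset_iff)

text \<open>Composing the Poisson majorant of \<open>f\<close> with \<open>\<psi>\<close> majorises
  f composed with \<open>\<psi>\<close>, and its value at 0 is the Poisson majorant at
  \<open>\<psi> 0\<close>. This is Littlewood's subordination theorem in quantitative form.\<close>

lemma
  assumes \<psi>: "self_map \<psi>"
  shows hardy2_apply_composition_operator:
      "cmod z < 1 \<Longrightarrow> hardy2_apply (composition_operator \<psi> f) z = hardy2_apply f (\<psi> z)"
    and norm_composition_operator:
      "(norm (composition_operator \<psi> f))\<^sup>2 \<le> Re (poisson_lift f (\<psi> 0))"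
proof -
  obtain g where g: "\<And>z. cmod z < 1 \<Longrightarrow> hardy2_apply g z = hardy2_apply f (\<psi> z)"
      "(norm g)\<^sup>2 \<le> Re (poisson_lift f (\<psi> 0))"
    using hardy2_majorant[OF self_map_compose[OF \<psi> hardy2_holomorphic]
        self_map_compose[OF \<psi> poisson_lift_holomorphic], of f f] power2_cmod_hardy2_apply_le \<psi>
    unfolding self_map_def by blast
  have "(\<lambda>z. if z \<in> ball 0 1 then hardy2_apply f (\<psi> z) else 0) = hardy2_apply g"
    by (auto simp: g hardy2_outside)
  then have "composition_operator \<psi> f = g"
    by (simp add: composition_operator_def hardy2_apply_inverse)
  then show "cmod z < 1 \<Longrightarrow> hardy2_apply (composition_operator \<psi> f) z = hardy2_apply f (\<psi> z)"
    and "(norm (composition_operator \<psi> f))\<^sup>2 \<le> Re (poisson_lift f (\<psi> 0))"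
    using g by auto
qed

lemma norm_composition_operator_le:
  assumes "self_map \<psi>"
  shows "(norm (composition_operator \<psi> f))\<^sup>2 \<le> 3 / (1 - cmod (\<psi> 0)) * (norm f)\<^sup>2"
  using norm_composition_operator[OF assms, of f] Re_poisson_lift_le[of "\<psi> 0" f] assms
  by (fastforce simp: self_map_def)

lemma bounded_clinear_composition_operator:
  assumes \<psi>: "self_map \<psi>"
  shows "bounded_clinear (composition_operator \<psi>)"
proof (rule bounded_clinearI[where K = "sqrt (3 / (1 - cmod (\<psi> 0)))"])
  have *: "cmod (\<psi> z) < 1" if "cmod z < 1" for z using \<psi> that by (auto simp: self_map_def)
  note app = hardy2_apply_composition_operator[OF \<psi>]
  show "composition_operator \<psi> (f + g) = composition_operator \<psi> f + composition_operator \<psi> g" for f g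
    by (rule hardy2_apply_eqI) (simp add: app hardy2_apply_add)
  show "composition_operator \<psi> (c *\<^sub>C f) = c *\<^sub>C composition_operator \<psi> f" for c f
    by (rule hardy2_apply_eqI) (simp add: app hardy2_apply_scaleC)
  show "norm (composition_operator \<psi> f) \<le> sqrt (3 / (1 - cmod (\<psi> 0))) * norm f" for f
    by (rule power2_le_imp_le)
       (use norm_composition_operator_le[OF \<psi>, of f] *[of 0] in \<open>auto simp: power_mult_distrib\<close>)
qed

section \<open>Right inverses and kernels\<close>

text \<open>Induction on the number of functionals: two linearly independent common zeros of the
  first n have a nontrivial combination killed by the next one.\<close>

lemma linear_functionals_common_zero:
  fixes \<phi> :: "nat \<Rightarrow> complex poly \<Rightarrow> complex"
  assumes add: "\<And>i p q. \<phi> i (p + q) = \<phi> i p + \<phi> i q"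
    and smult: "\<And>i c p. \<phi> i (smult c p) = c * \<phi> i p"
  shows "\<exists>p. p \<noteq> 0 \<and> (\<forall>i<n. \<phi> i p = 0)"
  using assms
proof (induction n arbitrary: \<phi>)
  case 0
  show ?case by (intro exI[of _ 1]) auto
next
  case (Suc n)
  note add = Suc.prems(1) and smult = Suc.prems(2)
  obtain p where p: "p \<noteq> 0" "\<forall>i<n. \<phi> i p = 0" using Suc.IH[of \<phi>] add smult by blast
  \<comment> \<open>Looking for the second solution among multiples of this monomial forces its
    degree above that of \<open>p\<close>, which makes the two independent.\<close>
  define m where "m = monom (1::complex) (Suc (degree p))"
  have "\<exists>p. p \<noteq> 0 \<and> (\<forall>i<n. \<phi> i (m * p) = 0)"
    using Suc.IH[of "\<lambda>i p. \<phi> i (m * p)"] by (simp add: add smult distrib_left)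
  then obtain q' where q': "q' \<noteq> 0" "\<forall>i<n. \<phi> i (m * q') = 0" by blast
  define q where "q = m * q'"
  have "m \<noteq> 0" by (simp add: m_def)
  then have deg: "degree q > degree p"
    using q'(1) by (simp add: q_def degree_mult_eq m_def degree_monom_eq)
  show ?case
  proof (cases "\<phi> n p = 0")
    case True
    then show ?thesis using p by (auto simp: less_Suc_eq)
  next
    case False
    have "degree (smult (\<phi> n p) q + smult (- \<phi> n q) p) = degree q"
      using False deg by (subst degree_add_eq_left) auto
    then have "smult (\<phi> n p) q + smult (- \<phi> n q) p \<noteq> 0" using deg by auto
    moreover have "\<phi> i (smult (\<phi> n p) q + smult (- \<phi> n q) p) = 0" if "i < Suc n" for i
      unfolding add smult using that p(2) q'(2) by (auto simp: less_Suc_eq q_def)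
    ultimately show ?thesis by blast
  qed
qed

text \<open>Gram--Schmidt is avoided: a polynomial combination of the \<open>h k\<close> is chosen in the kernel of finitely many
  linear functionals.\<close>

lemma orthonormal_in_kernel:
  fixes U :: "'a :: complex_hilbert_space \<Rightarrow> 'a" and h :: "nat \<Rightarrow> 'a"
  assumes U: "bounded_clinear U" and Uh: "\<And>k. U (h k) = 0"
    and indep: "\<And>p :: complex poly. p \<noteq> 0 \<Longrightarrow> (\<Sum>k\<le>degree p. coeff p k *\<^sub>C h k) \<noteq> 0"
  obtains e :: "nat \<Rightarrow> 'a" where "\<And>m n. cinner (e m) (e n) = (if m = n then 1 else 0)" "\<And>n. U (e n) = 0"
proof -
  define L where "L p = (\<Sum>k\<le>degree p. coeff p k *\<^sub>C h k)" for p
  have L_eq: "L p = (\<Sum>k\<le>N. coeff p k *\<^sub>C h k)" if "degree p \<le> N" for p N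
    unfolding L_def by (rule sum.mono_neutral_left) (use that in \<open>auto simp: coeff_eq_0\<close>)
  have L_add: "L (p + q) = L p + L q" for p q
  proof -
    have "degree (p + q) \<le> max (degree p) (degree q)" by (rule degree_add_le_max)
    then show ?thesis
      by (simp add: L_eq[of _ "max (degree p) (degree q)"] scaleC_add_left sum.distrib)
  qed
  have L_smult: "L (smult c p) = c *\<^sub>C L p" for c p
    using L_eq[of "smult c p" "degree p"] degree_smult_le[of c p]
    by (simp add: L_def scaleC_sum_right scaleC_scaleC)
  have UL: "U (L p) = 0" for p
    unfolding L_def linear_sum[OF bounded_linear.linear[OF bounded_clinear_bounded_linear[OF U]]]
    by (simp add: bounded_clinear_scaleC[OF U] Uh)
  define P where "P e n x \<longleftrightarrow> U x = 0 \<and> norm x = 1 \<and> (\<forall>i<n. cinner x (e i) = 0)"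
    for e :: "nat \<Rightarrow> 'a" and n :: nat and x
  have "\<exists>e. \<forall>n. P e n (e n)"
  proof (rule dependent_wellorder_choice)
    show "P f n x = P g n x" if "\<And>y. y < n \<Longrightarrow> f y = g y" for x f g n
      using that by (simp add: P_def)
    show "\<exists>x. P f n x" for n f
    proof -
      obtain p where p: "p \<noteq> 0" "\<forall>i<n. cinner (L p) (f i) = 0"
        using linear_functionals_common_zero[of "\<lambda>i p. cinner (L p) (f i)" n]
        by (auto simp: L_add L_smult cinner_add_left cinner_scaleC_left)
      define x where "x = of_real (inverse (norm (L p))) *\<^sub>C L p"
      have "L p \<noteq> 0" using indep[OF p(1)] by (simp add: L_def)
      then have "norm x = 1" by (simp add: x_def norm_scaleC norm_inverse)
      then have "P f n x"
        using p(2) by (simp add: P_def x_def bounded_clinear_scaleC[OF U] UL cinner_scaleC_left)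
      then show ?thesis by blast
    qed
  qed
  then obtain e where e: "\<And>n. P e n (e n)" by blast
  have less: "cinner (e m) (e n) = 0" if "n < m" for m n using e[of m] that by (simp add: P_def)
  show ?thesis
  proof (rule that[of e])
    show "cinner (e m) (e n) = (if m = n then 1 else 0)" for m n
    proof (cases m n rule: linorder_cases)
      case less
      then show ?thesis using \<open>\<And>m n. n < m \<Longrightarrow> cinner (e m) (e n) = 0\<close>[of m n] cinner_commute[of "e m" "e n"] by simp
    next
      case equal
      then show ?thesis using e[of m] by (simp add: P_def cinner_self)
    next
      case greater
      then show ?thesis using less by simp
    qed
    show "U (e n) = 0" for n using e[of n] by (simp add: P_def)
  qed
qed

text \<open>With a resolution of the identity into a part on which the powers of \<open>C\<close> are controlled and a part on
  which its negative powers are, \<open>C - l\<close> is inverted on the right by two Neumann series.\<close>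

lemma right_inverse_of_splitting:
  fixes C :: "'a :: complex_hilbert_space \<Rightarrow> 'a" and X Y :: "nat \<Rightarrow> 'a \<Rightarrow> 'a"
  assumes C: "bounded_clinear C" and X: "\<And>n. bounded_clinear (X n)" and Y: "\<And>n. bounded_clinear (Y n)"
    and CX: "\<And>n g. C (X n g) = X (Suc n) g" and CY: "\<And>n g. C (Y (Suc n) g) = Y n g"
    and split: "\<And>g. X 0 g + Y 0 g = g"
    and norm_X: "\<And>n g. norm (X n g) \<le> K * r ^ n * norm g"
    and norm_Y: "\<And>n g. norm (Y n g) \<le> K' * s ^ n * norm g"
    and r: "0 \<le> r" "r < cmod l" and s: "0 \<le> s" "s * cmod l < 1"
  obtains R where "bounded_clinear R" "\<And>g. C (R g) - l *\<^sub>C R g = g"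
proof -
  have l: "l \<noteq> 0" "cmod l > 0" using r by auto
  define X' where "X' n g = (1 / l) ^ Suc n *\<^sub>C X n g" for n g
  define Y' where "Y' n g = l ^ n *\<^sub>C Y (Suc n) g" for n g
  have X': "bounded_clinear (X' n)" and Y': "bounded_clinear (Y' n)" for n
    unfolding X'_def Y'_def by (intro bounded_clinear_compose[OF bounded_clinear_scaleC_right] X Y)+
  have nX': "norm (X' n g) \<le> K / cmod l * (r / cmod l) ^ n * norm g" for n g
  proof -
    have "norm (X' n g) = (1 / cmod l) ^ Suc n * norm (X n g)"
      by (simp only: X'_def norm_scaleC norm_power norm_divide norm_one)
    also have "\<dots> \<le> (1 / cmod l) ^ Suc n * (K * r ^ n * norm g)"
      by (rule mult_left_mono[OF norm_X]) simp
    finally show ?thesis by (simp add: power_divide mult_ac)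
  qed
  have nY': "norm (Y' n g) \<le> K' * s * (s * cmod l) ^ n * norm g" for n g
    using mult_left_mono[OF norm_Y[of "Suc n" g], of "cmod l ^ n"]
    by (simp add: Y'_def norm_scaleC norm_power power_mult_distrib mult_ac)
  have rl: "0 \<le> r / cmod l" "r / cmod l < 1" "0 \<le> s * cmod l" using r s l by auto
  have smX: "summable (\<lambda>n. X' n g)" for g
    by (rule operator_series_summable[OF X' nX' rl(1,2)])
  have smY: "summable (\<lambda>n. Y' n g)" for g
    by (rule operator_series_summable[OF Y' nY' rl(3) s(2)])
  define R where "R g = (\<Sum>n. Y' n g) - (\<Sum>n. X' n g)" for g
  have "bounded_clinear R"
    unfolding R_def
    by (intro bounded_clinear_minus bounded_clinear_operator_series[OF X' nX' rl(1,2)]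
        bounded_clinear_operator_series[OF Y' nY' rl(3) s(2)])
  moreover have "C (R g) - l *\<^sub>C R g = g" for g
  proof -
    note C_suminf = bounded_linear.suminf[OF bounded_clinear_bounded_linear[OF C]]
    note l_suminf = bounded_linear.suminf[OF bounded_clinear_bounded_linear[OF bounded_clinear_scaleC_right[of l]]]
    have lX0: "l *\<^sub>C X' 0 g = X 0 g" using l by (simp add: X'_def scaleC_scaleC)
    have lX: "l *\<^sub>C X' (Suc n) g = C (X' n g)" for n
      using l by (simp add: X'_def scaleC_scaleC bounded_clinear_scaleC[OF C] CX)
    have CY0: "C (Y' 0 g) = Y 0 g" by (simp add: Y'_def CY)
    have CY': "C (Y' (Suc n) g) = l *\<^sub>C Y' n g" for n
      by (simp add: Y'_def scaleC_scaleC bounded_clinear_scaleC[OF C] CY)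
    have smlX: "summable (\<lambda>n. l *\<^sub>C X' n g)"
      by (rule bounded_linear.summable[OF bounded_clinear_bounded_linear[OF bounded_clinear_scaleC_right] smX])
    have smCY: "summable (\<lambda>n. C (Y' n g))"
      by (rule bounded_linear.summable[OF bounded_clinear_bounded_linear[OF C] smY])
    have "l *\<^sub>C (\<Sum>n. X' n g) = X 0 g + C (\<Sum>n. X' n g)"
      unfolding l_suminf[OF smX] C_suminf[OF smX]
      using suminf_split_head[OF smlX] by (simp add: lX0 lX)
    moreover have "C (\<Sum>n. Y' n g) = Y 0 g + l *\<^sub>C (\<Sum>n. Y' n g)"
      unfolding l_suminf[OF smY] C_suminf[OF smY]
      using suminf_split_head[OF smCY] by (simp add: CY0 CY')
    ultimately show ?thesis
      using split[of g] by (simp add: R_def bounded_clinear_diff[OF C] scaleC_diff_right algebra_simps)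
  qed
  ultimately show ?thesis using that by blast
qed

section \<open>Disk automorphisms and estimates for differences and zeros\<close>

lemma disc_automorphism_identity:
  assumes "1 + cnj a * z \<noteq> 0"
  shows "1 - (cmod ((a + z) / (1 + cnj a * z)))\<^sup>2 =
    (1 - (cmod a)\<^sup>2) * (1 - (cmod z)\<^sup>2) / (cmod (1 + cnj a * z))\<^sup>2"
proof -
  have "(cmod (1 + cnj a * z))\<^sup>2 - (cmod (a + z))\<^sup>2 = (1 - (cmod a)\<^sup>2) * (1 - (cmod z)\<^sup>2)"
    unfolding cmod_power2 by (simp add: algebra_simps power2_eq_square)
  then show ?thesis using assms by (simp add: norm_divide power_divide field_simps)
qed

lemma one_plus_neq_0:
  assumes "cmod a < 1" "cmod z < 1"
  shows "1 + cnj a * z \<noteq> 0"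
proof
  assume "1 + cnj a * z = 0"
  then have "cmod a * cmod z = 1"
    by (metis add_eq_0_iff complex_mod_cnj norm_minus_cancel norm_mult norm_one)
  moreover have "cmod a * cmod z < 1 * 1" using assms by (intro mult_strict_mono) auto
  ultimately show False by simp
qed

lemma self_map_disc_automorphism:
  assumes a: "cmod a < 1"
  shows "self_map (\<lambda>z. (a + z) / (1 + cnj a * z))"
  unfolding self_map_def
proof (intro conjI allI impI)
  show "(\<lambda>z. (a + z) / (1 + cnj a * z)) holomorphic_on ball 0 1"
    using one_plus_neq_0[OF a] by (intro holomorphic_intros) auto
  fix z :: complex assume z: "cmod z < 1"
  have "(1 - (cmod a)\<^sup>2) * (1 - (cmod z)\<^sup>2) / (cmod (1 + cnj a * z))\<^sup>2 > 0"
    using a z one_plus_neq_0[OF a z] by (intro divide_pos_pos mult_pos_pos) (auto simp: abs_square_less_1)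
  then have "(cmod ((a + z) / (1 + cnj a * z)))\<^sup>2 < 1"
    unfolding disc_automorphism_identity[OF one_plus_neq_0[OF a z], symmetric] by simp
  then show "cmod ((a + z) / (1 + cnj a * z)) < 1" by (simp add: abs_square_less_1)
qed

text \<open>A disk automorphism moves \<open>z\<close> to 0 and \<open>w\<close> to
  \<open>\<zeta>\<close>, whose modulus is the pseudo-hyperbolic distance. There the difference is
  \<open>\<zeta>\<close> times the value at \<open>\<zeta>\<close> of a backward shift, to which the
  Szego kernel bound applies.\<close>

lemma hardy2_apply_diff_le:
  assumes z: "cmod z < 1" and w: "cmod w < 1"
    and \<rho>: "cmod (w - z) \<le> \<rho> * cmod (1 - cnj z * w)" "0 \<le> \<rho>" "\<rho> < 1"
  shows "(cmod (hardy2_apply g z - hardy2_apply g w))\<^sup>2 \<le> \<rho>\<^sup>2 / (1 - \<rho>\<^sup>2) * Re (poisson_lift g z)"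
proof -
  define \<tau> where "\<tau> \<zeta> = (z + \<zeta>) / (1 + cnj z * \<zeta>)" for \<zeta>
  define \<zeta> where "\<zeta> = (w - z) / (1 - cnj z * w)"
  have \<tau>: "self_map \<tau>" unfolding \<tau>_def by (rule self_map_disc_automorphism[OF z])
  have nz: "1 - cnj z * w \<noteq> 0" using one_plus_neq_0[of "- z" w] z w by simp
  have zeta_le: "cmod \<zeta> \<le> \<rho>" using \<rho>(1) nz by (simp add: \<zeta>_def norm_divide field_simps)
  then have zeta: "cmod \<zeta> < 1" using \<rho> by simp
  have z2: "1 - cnj z * z \<noteq> 0" using one_plus_neq_0[of "- z" z] z by simp
  have "1 + cnj z * \<zeta> = (1 - cnj z * z) / (1 - cnj z * w)"
    using nz by (simp add: \<zeta>_def field_simps)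
  moreover have "z + \<zeta> = w * (1 - cnj z * z) / (1 - cnj z * w)"
    using nz by (simp add: \<zeta>_def field_simps)
  ultimately have \<tau>w: "\<tau> \<zeta> = w" using nz z2 by (simp add: \<tau>_def)
  define G where "G = composition_operator \<tau> g"
  have app: "hardy2_apply G \<xi> = hardy2_apply g (\<tau> \<xi>)" if "cmod \<xi> < 1" for \<xi>
    unfolding G_def by (rule hardy2_apply_composition_operator[OF \<tau> that])
  have nG: "(norm G)\<^sup>2 \<le> Re (poisson_lift g z)"
    using norm_composition_operator[OF \<tau>, of g] by (simp add: G_def \<tau>_def)
  define H where "H = backward_shift G"
  have "hardy2_apply g w = hardy2_apply g z + \<zeta> * hardy2_apply H \<zeta>"
    using hardy2_apply_backward_shift[OF zeta, of G] hardy2_apply_backward_shift[of 0 G]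
      app[OF zeta] app[of 0] by (simp add: \<tau>w H_def) (simp add: \<tau>_def)
  then have "(cmod (hardy2_apply g z - hardy2_apply g w))\<^sup>2 = (cmod \<zeta>)\<^sup>2 * (cmod (hardy2_apply H \<zeta>))\<^sup>2"
    by (simp add: norm_mult power_mult_distrib)
  moreover have "(cmod (hardy2_apply H \<zeta>))\<^sup>2 * (1 - (cmod \<zeta>)\<^sup>2) \<le> Re (poisson_lift g z)"
    using cmod_hardy2_apply_le[OF zeta, of H] norm_backward_shift[of G] nG
    by (simp add: H_def) (smt (verit) zero_le_power2)
  moreover have zl: "(cmod \<zeta>)\<^sup>2 \<le> \<rho>\<^sup>2" using zeta_le by (simp add: power_mono)
  moreover have \<rho>1: "\<rho>\<^sup>2 < 1" using \<rho> by (simp add: abs_square_less_1)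
  ultimately have "(cmod (hardy2_apply H \<zeta>))\<^sup>2 * (1 - \<rho>\<^sup>2) \<le> Re (poisson_lift g z)"
    using mult_left_mono[of "1 - \<rho>\<^sup>2" "1 - (cmod \<zeta>)\<^sup>2" "(cmod (hardy2_apply H \<zeta>))\<^sup>2"] by simp
  then have "(cmod (hardy2_apply H \<zeta>))\<^sup>2 \<le> Re (poisson_lift g z) / (1 - \<rho>\<^sup>2)"
    using \<rho>1 by (simp add: field_simps)
  then have "(cmod \<zeta>)\<^sup>2 * (cmod (hardy2_apply H \<zeta>))\<^sup>2 \<le> \<rho>\<^sup>2 * (Re (poisson_lift g z) / (1 - \<rho>\<^sup>2))"
    using zl by (intro mult_mono) auto
  with \<open>(cmod (hardy2_apply g z - hardy2_apply g w))\<^sup>2 = _\<close> show ?thesis by simp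
qed

definition mult_root :: "complex \<Rightarrow> hardy2 \<Rightarrow> hardy2" where
  "mult_root q g = forward_shift g - q *\<^sub>C g"

lemma hardy2_apply_mult_root: "cmod z < 1 \<Longrightarrow> hardy2_apply (mult_root q g) z = (z - q) * hardy2_apply g z"
  by (simp add: mult_root_def hardy2_apply_diff hardy2_apply_forward_shift hardy2_apply_scaleC left_diff_distrib)

lemma bounded_clinear_mult_root: "bounded_clinear (mult_root q)"
  unfolding mult_root_def[abs_def]
  by (intro bounded_clinear_minus bounded_clinear_forward_shift bounded_clinear_scaleC_right)

text \<open>The hypothesis says that \<open>\<psi> 0\<close> is nontangentially close to
  \<open>q\<close>. A factor vanishing at \<open>q\<close> then turns the usual loss 1 / (1 - |x|),
  x = \<open>\<psi> 0\<close>, into a gain 1 - |x|^2: the resolvent of (z - q) g is z g + (x - q) h,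
  where the loss in h is cancelled by |x - q|, and the Poisson weight 1 - |x|^2 remains.\<close>

lemma norm_composition_operator_mult_root:
  assumes \<psi>: "self_map \<psi>" and K: "cmod (\<psi> 0 - q) \<le> K * (1 - (cmod (\<psi> 0))\<^sup>2)"
  shows "(norm (composition_operator \<psi> (mult_root q g)))\<^sup>2
    \<le> ((1 + 2 * K)\<^sup>2 + K\<^sup>2) * (1 - (cmod (\<psi> 0))\<^sup>2) * (norm g)\<^sup>2"
proof -
  define x where "x = \<psi> 0"
  define m where "m = 1 - (cmod x)\<^sup>2"
  have x: "cmod x < 1" using \<psi> by (auto simp: x_def self_map_def)
  have m: "m > 0" using x by (simp add: m_def abs_square_less_1)
  have m2: "m \<le> 2 * (1 - cmod x)"
    using x mult_right_mono[of "1 + cmod x" 2 "1 - cmod x"]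
    by (simp add: m_def power2_eq_square algebra_simps)
  have Kx: "cmod (x - q) \<le> K * m" using K by (simp add: x_def m_def)
  define h where "h = shift_resolvent x g"
  have h: "shift_resolvent x (mult_root q g) = forward_shift g + (x - q) *\<^sub>C h"
  proof -
    \<comment> \<open>The equation f = g' + x B f determines f because x B is a strict contraction;
      this lets the resolvent be guessed and then verified.\<close>
    have uniq: "f = shift_resolvent x g'" if "f = g' + x *\<^sub>C backward_shift f" for f g'
    proof -
      have "f - shift_resolvent x g' = x *\<^sub>C backward_shift (f - shift_resolvent x g')"
        using that shift_resolvent_eq[OF x, of g']
        by (simp add: bounded_clinear_diff[OF bounded_clinear_backward_shift] scaleC_diff_right algebra_simps)
      then have "norm (f - shift_resolvent x g') \<le> cmod x * norm (f - shift_resolvent x g')"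
        by (metis mult_left_mono norm_backward_shift_le norm_ge_zero norm_scaleC)
      then have "(1 - cmod x) * norm (f - shift_resolvent x g') \<le> 0" by (simp add: algebra_simps)
      then show ?thesis using x by (simp add: mult_le_0_iff)
    qed
    have bf: "backward_shift (forward_shift g) = g"
      by (rule hardy2_eqI) (simp add: taylor_coeff_backward_shift taylor_coeff_forward_shift)
    have hg: "x *\<^sub>C backward_shift h = h - g"
      using shift_resolvent_eq[OF x, of g] by (simp add: h_def algebra_simps)
    have "x *\<^sub>C backward_shift (forward_shift g + (x - q) *\<^sub>C h) = x *\<^sub>C g + (x - q) *\<^sub>C (x *\<^sub>C backward_shift h)"
      by (simp add: bounded_clinear_add[OF bounded_clinear_backward_shift]
          bounded_clinear_scaleC[OF bounded_clinear_backward_shift] bf scaleC_add_right scaleC_scaleC mult.commute)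
    also have "\<dots> = q *\<^sub>C g + (x - q) *\<^sub>C h"
      unfolding hg by (simp add: scaleC_diff_right scaleC_diff_left)
    finally show ?thesis by (intro uniq[symmetric]) (simp add: mult_root_def)
  qed
  have "norm (shift_resolvent x (mult_root q g)) \<le> norm g + cmod (x - q) * norm h"
    unfolding h using norm_triangle_ineq[of "forward_shift g" "(x - q) *\<^sub>C h"]
    by (simp add: norm_forward_shift norm_scaleC)
  also have "cmod (x - q) * norm h \<le> (K * m) * (norm g / (1 - cmod x))"
    unfolding h_def using x by (intro mult_mono Kx norm_shift_resolvent) (use Kx order_trans[OF norm_ge_zero Kx] in auto)
  also have "\<dots> = K * norm g * (m / (1 - cmod x))" by simp
  also have "\<dots> \<le> K * norm g * 2"
  proof (rule mult_left_mono)
    show "m / (1 - cmod x) \<le> 2" using m2 x by (simp add: field_simps)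
    show "0 \<le> K * norm g" using order_trans[OF norm_ge_zero Kx] m by (simp add: zero_le_mult_iff)
  qed
  finally have 1: "norm (shift_resolvent x (mult_root q g)) \<le> (1 + 2 * K) * norm g"
    by (simp add: algebra_simps)
  have "(cmod x)\<^sup>2 * (cmod (hardy2_apply (mult_root q g) x))\<^sup>2 \<le> 1 * (cmod (hardy2_apply (mult_root q g) x))\<^sup>2"
    using x by (intro mult_right_mono) (auto simp: abs_square_le_1)
  also have "\<dots> \<le> (K * m)\<^sup>2 * (cmod (hardy2_apply g x))\<^sup>2"
    using Kx by (simp add: hardy2_apply_mult_root[OF x] norm_mult power_mult_distrib[symmetric])
      (intro power_mono mult_right_mono, auto)
  also have "\<dots> = K\<^sup>2 * m * ((cmod (hardy2_apply g x))\<^sup>2 * m)" by (simp add: power2_eq_square)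
  also have "\<dots> \<le> K\<^sup>2 * m * (norm g)\<^sup>2"
    using m cmod_hardy2_apply_le[OF x, of g] by (intro mult_left_mono) (auto simp: m_def)
  finally have 2: "(cmod x)\<^sup>2 * (cmod (hardy2_apply (mult_root q g) x))\<^sup>2 \<le> K\<^sup>2 * m * (norm g)\<^sup>2" .
  have "(norm (composition_operator \<psi> (mult_root q g)))\<^sup>2 \<le> Re (poisson_lift (mult_root q g) x)"
    unfolding x_def by (rule norm_composition_operator[OF \<psi>])
  also have "\<dots> = m * (norm (shift_resolvent x (mult_root q g)))\<^sup>2 +
      (cmod x)\<^sup>2 * (cmod (hardy2_apply (mult_root q g) x))\<^sup>2"
    unfolding Re_poisson_lift[OF x] m_def ..
  also have "\<dots> \<le> m * ((1 + 2 * K) * norm g)\<^sup>2 + K\<^sup>2 * m * (norm g)\<^sup>2"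
    using m by (intro add_mono mult_left_mono power_mono 1 2) auto
  finally show ?thesis unfolding power_mult_distrib by (simp add: x_def m_def algebra_simps)
qed

lemma bounded_holomorphic_hardy2:
  assumes "g holomorphic_on ball 0 1" "\<And>z. cmod z < 1 \<Longrightarrow> cmod (g z) \<le> B"
  obtains f where "\<And>z. cmod z < 1 \<Longrightarrow> hardy2_apply f z = g z"
proof (rule hardy2_majorant[OF assms(1), of "\<lambda>_. of_real (B\<^sup>2)"])
  show "(cmod (g z))\<^sup>2 \<le> Re (complex_of_real (B\<^sup>2))" if "cmod z < 1" for z
    using assms(2)[OF that] by (simp add: power_mono)
qed (use that in \<open>auto intro: holomorphic_intros\<close>)

section \<open>Hyperbolic maps in the half-plane\<close>

lemma cayley_disc:
  assumes p: "cmod p = 1" and z: "cmod z < 1"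
  shows "Re (p / (p - z)) > 1 / 2" "p * (1 - 1 / (p / (p - z))) = z"
proof -
  have nz: "p \<noteq> z" "p \<noteq> 0" using p z by auto
  then show "p * (1 - 1 / (p / (p - z))) = z" by (simp add: field_simps)
  have d: "(cmod (p - z))\<^sup>2 > 0" using nz by simp
  have "2 * Re (p * cnj (p - z)) - (cmod (p - z))\<^sup>2 = (cmod p)\<^sup>2 - (cmod z)\<^sup>2"
    unfolding cmod_power2 by (simp add: power2_eq_square algebra_simps)
  also have "\<dots> > 0" using p z by (simp add: abs_square_less_1)
  finally have "Re (p * cnj (p - z)) > (cmod (p - z))\<^sup>2 / 2" by simp
  then show "Re (p / (p - z)) > 1 / 2"
    using d unfolding complex_div_cnj[of p] by (simp add: field_simps del: complex_cnj_diff)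
qed

lemma cayley_half_plane:
  assumes p: "cmod p = 1" and u: "u \<noteq> 0"
  shows "1 - (cmod (p * (1 - 1 / u)))\<^sup>2 = (2 * Re u - 1) / (cmod u)\<^sup>2"
    "p / (p - p * (1 - 1 / u)) = u"
proof -
  have "p \<noteq> 0" using p by auto
  then show "p / (p - p * (1 - 1 / u)) = u" using u by (simp add: field_simps)
  have "(cmod (p * (1 - 1 / u)))\<^sup>2 = (cmod ((u - 1) / u))\<^sup>2"
    using u p by (simp add: norm_mult diff_divide_distrib)
  also have "\<dots> = (cmod (u - 1))\<^sup>2 / (cmod u)\<^sup>2" by (simp add: norm_divide power_divide)
  also have "(cmod (u - 1))\<^sup>2 = (cmod u)\<^sup>2 - (2 * Re u - 1)"
    unfolding cmod_power2 by (simp add: power2_eq_square algebra_simps)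
  finally show "1 - (cmod (p * (1 - 1 / u)))\<^sup>2 = (2 * Re u - 1) / (cmod u)\<^sup>2"
    using u by (simp add: field_simps)
qed

lemma cayley_half_plane_in_disc:
  assumes "cmod p = 1" "Re u > 1 / 2"
  shows "cmod (p * (1 - 1 / u)) < 1"
proof -
  have "u \<noteq> 0" using assms by auto
  then have "1 - (cmod (p * (1 - 1 / u)))\<^sup>2 > 0"
    unfolding cayley_half_plane(1)[OF assms(1) \<open>u \<noteq> 0\<close>] using assms by simp
  then show ?thesis by (simp add: abs_square_less_1)
qed

lemma nonzero_of_Re: "Re u > 1 / 2 \<Longrightarrow> u \<noteq> 0"
  by auto

text \<open>The common denominator cancels in the quotient, so the pseudo-hyperbolic distance in the
  half-plane is |u' - u| / |u' + cnj u - 1|, the form in which \<open>hardy2_apply_diff_le\<close>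
  is applied.\<close>

lemma cayley_pseudo_hyperbolic:
  assumes p: "cmod p = 1" and u: "u \<noteq> 0" "u' \<noteq> 0"
  shows "cmod (p * (1 - 1 / u') - p * (1 - 1 / u)) = cmod (u' - u) / (cmod u * cmod u')"
    "cmod (1 - cnj (p * (1 - 1 / u)) * (p * (1 - 1 / u'))) = cmod (u' + cnj u - 1) / (cmod u * cmod u')"
proof -
  have "p * (1 - 1 / u') - p * (1 - 1 / u) = p * ((u' - u) / (u * u'))"
    using u by (simp add: field_simps)
  then show "cmod (p * (1 - 1 / u') - p * (1 - 1 / u)) = cmod (u' - u) / (cmod u * cmod u')"
    using p by (simp add: norm_mult norm_divide)
  have "cnj p * p = 1" using p complex_norm_square[of p] by (simp add: mult.commute)
  then have "cnj (p * (1 - 1 / u)) * (p * (1 - 1 / u')) = (1 - 1 / cnj u) * (1 - 1 / u')"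
    by (simp add: mult.assoc mult.left_commute[of p] flip: mult.assoc[of "cnj p" p])
  then have "1 - cnj (p * (1 - 1 / u)) * (p * (1 - 1 / u')) = (u' + cnj u - 1) / (cnj u * u')"
    using u by (simp add: field_simps)
  then show "cmod (1 - cnj (p * (1 - 1 / u)) * (p * (1 - 1 / u'))) = cmod (u' + cnj u - 1) / (cmod u * cmod u')"
    by (simp add: norm_mult norm_divide)
qed

text \<open>In the coordinate \<open>u = p / (p - z)\<close>, which maps the disk onto the half-plane \<open>Re u > 1/2\<close> and \<open>p\<close> to
  infinity, this is \<open>u \<mapsto> w + t (u - w) + s\<close>.\<close>

definition half_plane_map :: "complex \<Rightarrow> complex \<Rightarrow> real \<Rightarrow> real \<Rightarrow> complex \<Rightarrow> complex" where
  "half_plane_map p w t s z = p * (1 - 1 / (w + of_real t * (p / (p - z) - w) + of_real s))"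

lemma composition_operator_compose:
  assumes "self_map \<psi>" "self_map \<eta>" "self_map \<theta>"
    and "\<And>z. cmod z < 1 \<Longrightarrow> \<eta> (\<psi> z) = \<theta> z"
  shows "composition_operator \<psi> (composition_operator \<eta> f) = composition_operator \<theta> f"
proof (rule hardy2_apply_eqI)
  fix z :: complex assume z: "cmod z < 1"
  then have "cmod (\<psi> z) < 1" using assms(1) by (simp add: self_map_def)
  then show "hardy2_apply (composition_operator \<psi> (composition_operator \<eta> f)) z =
      hardy2_apply (composition_operator \<theta> f) z"
    using z assms by (simp add: hardy2_apply_composition_operator)
qed

lemma composition_operator_cong:
  assumes "\<And>z. cmod z < 1 \<Longrightarrow> \<psi> z = \<eta> z"
  shows "composition_operator \<psi> = composition_operator \<eta>"
  unfolding composition_operator_def[abs_def] using assms by (auto intro!: ext arg_cong[where f = Abs_hardy2])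

lemma norm_le_of_power2_le:
  fixes x y c :: real
  assumes "x\<^sup>2 \<le> c * y\<^sup>2" "0 \<le> y" "0 \<le> c"
  shows "x \<le> sqrt c * y"
  by (rule power2_le_imp_le) (use assms in \<open>auto simp: power_mult_distrib\<close>)

section \<open>Half-plane maps with centre \<open>w\<close>: right inverses, eigenfunctions,
  universality\<close>

context
  fixes p w :: complex
  assumes p: "cmod p = 1" and w: "Re w \<le> 1 / 2"
begin

text \<open>For positive t the inequality says that the line Re u = 1/2 is mapped into Re u >= 1/2,
  hence that the half-plane is mapped into itself.\<close>

definition admissible :: "real \<Rightarrow> real \<Rightarrow> bool" where
  "admissible t s \<longleftrightarrow> t > 0 \<and> s \<ge> (1 / 2 - Re w) * (1 - t)"

lemma Re_half_plane_map:
  assumes ts: "admissible t s" and u: "Re u > 1 / 2"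
  shows "Re (w + of_real t * (u - w) + of_real s) > 1 / 2"
proof -
  have "t * (Re u - Re w) > t * (1 / 2 - Re w)" using ts u by (simp add: admissible_def)
  moreover have "d * (1 - t) = d - t * d" for d :: real by (simp add: algebra_simps)
  note this[of "1 / 2 - Re w"]
  moreover have "Re (w + of_real t * (u - w) + of_real s) = Re w + t * (Re u - Re w) + s" by simp
  ultimately show ?thesis using ts unfolding admissible_def by linarith
qed

lemma self_map_half_plane_map:
  assumes ts: "admissible t s"
  shows "self_map (half_plane_map p w t s)"
  unfolding self_map_def
proof (intro conjI allI impI)
  have nz: "w + of_real t * (p / (p - z) - w) + of_real s \<noteq> 0" if "cmod z < 1" for z
    by (rule nonzero_of_Re[OF Re_half_plane_map[OF ts cayley_disc(1)[OF p that]]])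
  show "half_plane_map p w t s holomorphic_on ball 0 1"
    unfolding half_plane_map_def[abs_def] using nz p by (intro holomorphic_intros) auto
  show "cmod (half_plane_map p w t s z) < 1" if "cmod z < 1" for z
    unfolding half_plane_map_def
    by (intro cayley_half_plane_in_disc p Re_half_plane_map[OF ts] cayley_disc that)
qed

lemma half_plane_map_compose:
  assumes ts: "admissible t s" and z: "cmod z < 1"
  shows "half_plane_map p w t' s' (half_plane_map p w t s z) = half_plane_map p w (t' * t) (t' * s + s') z"
proof -
  define u where "u = w + of_real t * (p / (p - z) - w) + of_real s"
  have "u \<noteq> 0"
    unfolding u_def by (rule nonzero_of_Re[OF Re_half_plane_map[OF ts cayley_disc(1)[OF p z]]])
  from cayley_half_plane(2)[OF p this]
  have "p / (p - half_plane_map p w t s z) = u" by (simp add: half_plane_map_def u_def)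
  moreover have "w + of_real t' * (u - w) + of_real s' =
      w + of_real (t' * t) * (p / (p - z) - w) + of_real (t' * s + s')"
    unfolding u_def by (simp only: of_real_add of_real_mult) (simp only: algebra_simps)
  ultimately show ?thesis
    unfolding half_plane_map_def[of p w t' s'] half_plane_map_def[of p w "t' * t"] by simp
qed

abbreviation comp_op :: "real \<Rightarrow> real \<Rightarrow> hardy2 \<Rightarrow> hardy2" where
  "comp_op t s \<equiv> composition_operator (half_plane_map p w t s)"

text \<open>Composition reverses the order of the maps. The product stays admissible because the two
  defining inequalities add up, the first weighted by t'.\<close>

lemma comp_op_compose:
  assumes ts: "admissible t s" and ts': "admissible t' s'"
  shows "comp_op t s (comp_op t' s' f) = comp_op (t' * t) (t' * s + s') f"
proof -
  have "(1 / 2 - Re w) * (1 - t' * t) = (1 / 2 - Re w) * (1 - t') + t' * ((1 / 2 - Re w) * (1 - t))"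
    unfolding right_diff_distrib[of "1 / 2 - Re w"] by (simp add: right_diff_distrib mult_ac)
  also have "\<dots> \<le> s' + t' * s"
    using ts ts' by (intro add_mono mult_left_mono) (auto simp: admissible_def)
  finally have "admissible (t' * t) (t' * s + s')"
    using ts ts' by (simp add: admissible_def add.commute)
  then show ?thesis
    by (intro composition_operator_compose self_map_half_plane_map ts ts' half_plane_map_compose)
qed

lemma comp_op_1_0: "comp_op 1 0 f = f"
proof (rule hardy2_apply_eqI)
  fix z :: complex assume z: "cmod z < 1"
  have "half_plane_map p w 1 0 z = z" using cayley_disc(2)[OF p z] by (simp add: half_plane_map_def)
  moreover have "self_map (half_plane_map p w 1 0)" by (rule self_map_half_plane_map) (simp add: admissible_def)
  ultimately show "hardy2_apply (comp_op 1 0 f) z = hardy2_apply f z"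
    using z by (simp add: hardy2_apply_composition_operator)
qed

text \<open>The disk centre is u = 1, so the quantity bounded by \<open>K\<close> and
  \<open>m\<close> is its image in the coordinate u. With x the image in the disk, m / K^2 <= 1 -
  |x|^2 <= 2 (1 - |x|).\<close>

lemma norm_comp_op_bound:
  assumes ts: "admissible t s" and K: "cmod (w + of_real t * (1 - w) + of_real s) \<le> K"
    and m: "0 < m" "m \<le> 2 * Re (w + of_real t * (1 - w) + of_real s) - 1"
  shows "3 / (1 - cmod (half_plane_map p w t s 0)) \<le> 6 * K\<^sup>2 / m"
proof -
  define u where "u = w + of_real t * (1 - w) + of_real s"
  define x where "x = half_plane_map p w t s 0"
  have u2: "Re u > 1 / 2" using m unfolding u_def[symmetric] by linarith
  note u = nonzero_of_Re[OF u2] u2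
  have "p / (p - 0) = 1" using p by auto
  then have x: "x = p * (1 - 1 / u)" by (simp add: x_def u_def half_plane_map_def)
  have x1: "cmod x < 1" unfolding x by (rule cayley_half_plane_in_disc[OF p u(2)])
  have "m / K\<^sup>2 \<le> (2 * Re u - 1) / (cmod u)\<^sup>2"
    using m K u(1) by (intro frac_le power_mono) (auto simp: u_def)
  also have "\<dots> = 1 - (cmod x)\<^sup>2" unfolding x cayley_half_plane(1)[OF p u(1)] ..
  also have "\<dots> \<le> 2 * (1 - cmod x)"
    using zero_le_power2[of "1 - cmod x"] by (simp add: power2_eq_square algebra_simps)
  finally have le: "m / K\<^sup>2 \<le> 2 * (1 - cmod x)" .
  have "0 < cmod u" using u by simp
  also have "cmod u \<le> K" using K by (simp add: u_def)
  finally have "K > 0" .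
  then show ?thesis using le m x1 by (simp add: x_def[symmetric] field_simps)
qed

text \<open>If \<open>w\<close> is to the left of the boundary, the powers of the operator decay on the range of
  \<open>g \<mapsto> g - g(u + s)\<close>, while \<open>g(u + s)\<close> stays bounded under the negative powers.\<close>

lemma right_inverse_interior:
  assumes w': "Re w < 1 / 2" and A: "A > 1" and l: "0 < l" "l ^ 4 = 1 / A"
  obtains R where "bounded_clinear R" "\<And>g. comp_op A 0 (R g) - of_real l *\<^sub>C R g = g"
proof -
  define \<delta> where "\<delta> = 1 / 2 - Re w"
  \<comment> \<open>Twice the distance from \<open>w\<close> to the boundary line: the shifted maps
    are then admissible for every t > 0, and as t tends to 0 the image of the centre keeps distance
    at least \<delta> from the line.\<close>
  define s where "s = 2 * \<delta>"
  have \<delta>: "\<delta> > 0" and s: "s > 0" using w' by (auto simp: \<delta>_def s_def)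
  have l1: "l < 1"
  proof (rule ccontr)
    assume "\<not> l < 1"
    then have "1 \<le> l ^ 4" by simp
    then show False using l A by simp
  qed
  have adm: "admissible (A ^ n) 0" for n
    using A \<delta> by (auto simp: admissible_def \<delta>_def[symmetric] mult_le_0_iff)
  have adms: "admissible t s" if "t > 0" for t
  proof -
    have "\<delta> * (1 - t) \<le> \<delta> * 2" using \<delta> that by (intro mult_left_mono) auto
    then show ?thesis using that by (simp add: admissible_def \<delta>_def[symmetric] s_def)
  qed
  have adm1: "admissible A 0" using adm[of 1] by simp
  have A0: "A > 0" using A by simp
  \<comment> \<open>\<open>X n g\<close> is the n-th power of the operator applied to g - g(u + s).
    \<open>Y n g\<close> contracts towards w + s, which is interior, so it is defined although the
    operator itself need not be invertible.\<close>
  define X where "X n g = comp_op (A ^ n) 0 g - comp_op (A ^ n) s g" for n g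
  define Y where "Y n g = comp_op ((1 / A) ^ n) s g" for n g
  have clin: "bounded_clinear (comp_op t s')" if "admissible t s'" for t s'
    by (intro bounded_clinear_composition_operator self_map_half_plane_map that)
  have X: "bounded_clinear (X n)" for n
    unfolding X_def[abs_def] by (intro bounded_clinear_minus clin adm adms) (use A in simp)
  have Y: "bounded_clinear (Y n)" for n
    unfolding Y_def[abs_def] by (intro clin adms) (use A in simp)
  have CX: "comp_op A 0 (X n g) = X (Suc n) g" for n g
    unfolding X_def bounded_clinear_diff[OF clin[OF adm1]]
    using A by (simp add: comp_op_compose[OF adm1] adm adms mult.commute)
  have CY: "comp_op A 0 (Y (Suc n) g) = Y n g" for n g
    unfolding Y_def using A by (simp add: comp_op_compose[OF adm1] adms)
  have split: "X 0 g + Y 0 g = g" for g by (simp add: X_def Y_def comp_op_1_0)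
  define KY where "KY = sqrt (6 * (cmod w + cmod (1 - w) + s)\<^sup>2 / (2 * \<delta>))"
  have norm_Y: "norm (Y n g) \<le> KY * 1 ^ n * norm g" for n g
  proof -
    define t where "t = (1 / A) ^ n"
    have t: "0 < t" "t \<le> 1" using A by (auto simp: t_def power_le_one)
    have "3 / (1 - cmod (half_plane_map p w t s 0)) \<le> 6 * (cmod w + cmod (1 - w) + s)\<^sup>2 / (2 * \<delta>)"
    proof (rule norm_comp_op_bound[OF adms[OF t(1)]])
      have "cmod (w + of_real t * (1 - w) + of_real s) \<le> cmod w + cmod (of_real t * (1 - w)) + cmod (of_real s)"
        by (meson add_mono norm_triangle_ineq order_refl order_trans)
      also have "\<dots> \<le> cmod w + cmod (1 - w) + s"
        using t s by (simp add: norm_mult mult_left_le_one_le)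
      finally show "cmod (w + of_real t * (1 - w) + of_real s) \<le> cmod w + cmod (1 - w) + s" .
      have "t * (1 - Re w) \<ge> 0" using t w' by simp
      then show "2 * \<delta> \<le> 2 * Re (w + of_real t * (1 - w) + of_real s) - 1"
        by (simp add: s_def \<delta>_def)
    qed (use \<delta> in simp)
    then have "(norm (Y n g))\<^sup>2 \<le> 6 * (cmod w + cmod (1 - w) + s)\<^sup>2 / (2 * \<delta>) * (norm g)\<^sup>2"
      unfolding Y_def t_def[symmetric]
      by (rule order_trans[OF norm_composition_operator_le[OF self_map_half_plane_map[OF adms[OF t(1)]]]
            mult_right_mono]) simp
    then show ?thesis unfolding KY_def power_one mult_1_right by (rule norm_le_of_power2_le) (use \<delta> in auto)
  qed
  define c where "c = 1 / (1 - 1 / A\<^sup>2)"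
  have A2: "1 / A\<^sup>2 < 1" using A by (simp add: one_less_power)
  have c: "c > 0" using A2 by (simp add: c_def)
  define D where "D = c * (6 * (cmod w + cmod (1 - w))\<^sup>2)"
  have D: "D \<ge> 0" using c by (simp add: D_def)
  have lA: "1 / A ^ n = (l ^ 2 ^ 2) ^ n" for n
    using l by (simp add: power_divide[symmetric]) (metis power_one power_divide)
  have norm_X1: "norm (X n g) \<le> sqrt D * (l\<^sup>2) ^ n * norm g" if n: "n \<ge> 1" for n g
  proof -
    define t where "t = A ^ n"
    have t: "t \<ge> A" "t > 1" using A n self_le_power[of A n] by (auto simp: t_def)
    have admt: "admissible t 0" unfolding t_def by (rule adm)
    have admts: "admissible t s" by (rule adms) (use t in simp)
    define \<psi> where "\<psi> = half_plane_map p w t 0"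
    define \<eta> where "\<eta> = half_plane_map p w t s"
    have \<psi>: "self_map \<psi>" and \<eta>: "self_map \<eta>"
      unfolding \<psi>_def \<eta>_def by (intro self_map_half_plane_map admt admts)+
    \<comment> \<open>A bound for the pseudo-hyperbolic distance between the points u and u + s,
      since |2 Re u + s - 1| is at least t s. Its square gains t^(-2), while the Poisson majorant at
      the image of 0 costs a factor t; the squared norm is thus of order 1 / t.\<close>
    define \<rho> where "\<rho> = 1 / t"
    have \<rho>: "0 < \<rho>" "\<rho> < 1" using t by (auto simp: \<rho>_def)
    have "1 / t \<le> 1 / A" using t A by (intro divide_left_mono) auto
    then have "\<rho>\<^sup>2 \<le> (1 / A)\<^sup>2" unfolding \<rho>_def using t by (intro power_mono) auto
    then have \<rho>c: "\<rho>\<^sup>2 / (1 - \<rho>\<^sup>2) \<le> \<rho>\<^sup>2 * c"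
      unfolding c_def using A2 by (simp add: power_divide) (intro divide_left_mono mult_pos_pos, auto)
    have le: "(cmod (hardy2_apply (X n g) z))\<^sup>2 \<le> Re (of_real (\<rho>\<^sup>2 * c) * poisson_lift g (\<psi> z))"
      if z: "cmod z < 1" for z
    proof -
      define u where "u = w + of_real t * (p / (p - z) - w)"
      define u' where "u' = u + of_real s"
      have Ru0: "Re (p / (p - z)) > 1 / 2" by (rule cayley_disc[OF p z])
      have \<psi>z: "\<psi> z = p * (1 - 1 / u)" and \<eta>z: "\<eta> z = p * (1 - 1 / u')"
        by (simp_all add: \<psi>_def \<eta>_def half_plane_map_def u_def u'_def)
      have "Re u > 1 / 2" using Re_half_plane_map[OF admt Ru0] by (simp add: u_def)
      then have nz: "u \<noteq> 0" "u' \<noteq> 0" using s by (auto simp: u'_def complex_eq_iff)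
      have "t * s \<le> t * (2 * (Re (p / (p - z)) - Re w))"
        using t Ru0 by (intro mult_left_mono) (auto simp: s_def \<delta>_def)
      also have "\<dots> = Re (u' + cnj u - 1)"
      proof -
        have "Re (u' + cnj u - 1) = 2 * Re u + s - 1" by (simp add: u'_def)
        also have "Re u = Re w + t * (Re (p / (p - z)) - Re w)" by (simp add: u_def)
        finally show ?thesis by (simp add: s_def \<delta>_def algebra_simps)
      qed
      also have "\<dots> \<le> cmod (u' + cnj u - 1)" by (rule complex_Re_le_cmod)
      finally have "s \<le> \<rho> * cmod (u' + cnj u - 1)" using t by (simp add: \<rho>_def field_simps)
      then have "cmod (\<eta> z - \<psi> z) \<le> \<rho> * cmod (1 - cnj (\<psi> z) * \<eta> z)"
        unfolding \<psi>z \<eta>z cayley_pseudo_hyperbolic[OF p nz] using s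
        by (simp add: u'_def divide_right_mono)
      then have "(cmod (hardy2_apply g (\<psi> z) - hardy2_apply g (\<eta> z)))\<^sup>2
          \<le> \<rho>\<^sup>2 / (1 - \<rho>\<^sup>2) * Re (poisson_lift g (\<psi> z))"
        using \<psi> \<eta> z \<rho> by (intro hardy2_apply_diff_le) (auto simp: self_map_def)
      also have "\<dots> \<le> \<rho>\<^sup>2 * c * Re (poisson_lift g (\<psi> z))"
      proof (rule mult_right_mono[OF \<rho>c])
        show "0 \<le> Re (poisson_lift g (\<psi> z))"
          by (rule order_trans[OF zero_le_power2 power2_cmod_hardy2_apply_le])
             (use \<psi> z in \<open>auto simp: self_map_def\<close>)
      qed
      finally show ?thesis
        using hardy2_apply_composition_operator[OF \<psi> z, of g] hardy2_apply_composition_operator[OF \<eta> z, of g]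
        by (simp add: X_def hardy2_apply_diff \<psi>_def \<eta>_def t_def)
    qed
    obtain f where f: "\<And>z. cmod z < 1 \<Longrightarrow> hardy2_apply f z = hardy2_apply (X n g) z"
      "(norm f)\<^sup>2 \<le> Re (of_real (\<rho>\<^sup>2 * c) * poisson_lift g (\<psi> 0))"
      using hardy2_majorant[OF hardy2_holomorphic _ le]
        holomorphic_on_mult[OF holomorphic_on_const self_map_compose[OF \<psi> poisson_lift_holomorphic]] by metis
    have "f = X n g" by (rule hardy2_apply_eqI) (rule f)
    with f have "(norm (X n g))\<^sup>2 \<le> \<rho>\<^sup>2 * c * Re (poisson_lift g (\<psi> 0))" by simp
    also have "\<dots> \<le> \<rho>\<^sup>2 * c * (3 / (1 - cmod (\<psi> 0)) * (norm g)\<^sup>2)"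
      using \<rho> c \<psi> by (intro mult_left_mono Re_poisson_lift_le) (auto simp: self_map_def)
    also have "\<dots> \<le> \<rho>\<^sup>2 * c * (6 * (t * (cmod w + cmod (1 - w)))\<^sup>2 / t * (norm g)\<^sup>2)"
    proof (intro mult_left_mono mult_right_mono)
      show "3 / (1 - cmod (\<psi> 0)) \<le> 6 * (t * (cmod w + cmod (1 - w)))\<^sup>2 / t"
        unfolding \<psi>_def
      proof (rule norm_comp_op_bound[OF admt])
        have "cmod (w + of_real t * (1 - w)) \<le> cmod w + t * cmod (1 - w)"
          using norm_triangle_ineq[of w "of_real t * (1 - w)"] t by (simp add: norm_mult)
        also have "\<dots> \<le> t * (cmod w + cmod (1 - w))"
          using t by (simp add: distrib_left mult_le_cancel_right1)
        finally show "cmod (w + of_real t * (1 - w) + of_real 0) \<le> t * (cmod w + cmod (1 - w))" by simp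
        have "(t - 1) * (1 - 2 * Re w) \<ge> 0" using t w' by simp
        then show "t \<le> 2 * Re (w + of_real t * (1 - w) + of_real 0) - 1" by (simp add: algebra_simps)
      qed (use t in simp)
    qed (use \<rho> c in auto)
    also have "\<dots> = D * (1 / t) * (norm g)\<^sup>2"
      using t by (simp add: \<rho>_def D_def power2_eq_square field_simps)
    also have "1 / t = ((l\<^sup>2) ^ n)\<^sup>2"
      unfolding t_def lA by (simp add: power_mult[symmetric] mult_ac)
    finally have "(norm (X n g))\<^sup>2 \<le> D * (((l\<^sup>2) ^ n) * norm g)\<^sup>2" by (simp add: power_mult_distrib)
    then have "norm (X n g) \<le> sqrt D * (((l\<^sup>2) ^ n) * norm g)"
      by (rule norm_le_of_power2_le) (use D in auto)
    then show ?thesis by simp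
  qed
  \<comment> \<open>At n = 0 the radius 1 / t equals 1 and the difference estimate is void, so the
    operator norm of \<open>X 0\<close> is used.\<close>
  obtain K0 where K0: "K0 > 0" "\<And>g. norm (X 0 g) \<le> K0 * norm g"
    by (rule bounded_clinear_pos_bound[OF X[of 0]]) blast
  have norm_X: "norm (X n g) \<le> max K0 (sqrt D) * (l\<^sup>2) ^ n * norm g" for n g
  proof (cases "n = 0")
    case True
    then show ?thesis using K0(2)[of g] mult_right_mono[of K0 "max K0 (sqrt D)" "norm g"] by simp
  next
    case False
    then have "norm (X n g) \<le> sqrt D * (l\<^sup>2) ^ n * norm g" by (intro norm_X1) simp
    also have "\<dots> \<le> max K0 (sqrt D) * (l\<^sup>2) ^ n * norm g" by (intro mult_right_mono) auto
    finally show ?thesis .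
  qed
  show ?thesis
    \<comment> \<open>The rates are l^2 for \<open>X\<close> and 1 for \<open>Y\<close>, and l^2 < l
      < 1.\<close>
    by (rule right_inverse_of_splitting[OF clin[OF adm1] X Y CX CY split norm_X norm_Y,
          where l = "of_real l"])
       (use l l1 that in \<open>auto simp: power2_eq_square\<close>)
qed

text \<open>Now \<open>w\<close> is a second boundary fixed point \<open>q\<close> of the disk. The
  identity 1 = (w / p) ((z - q) - (z - p)) splits g: forward iterates of 0 tend nontangentially to
  \<open>p\<close>, backward ones to \<open>q\<close>, and in each direction the matching zero gives
  decay of order A^(-n/2).\<close>

lemma right_inverse_boundary:
  assumes w': "Re w = 1 / 2" and A: "A > 1"
  obtains R where "bounded_clinear R" "\<And>g. comp_op A 0 (R g) - 1 *\<^sub>C R g = g"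
proof -
  have adm: "admissible t 0" if "t > 0" for t using that unfolding admissible_def w' by simp
  have A0: "A > 0" using A by simp
  have clin: "bounded_clinear (comp_op t 0)" if "t > 0" for t
    by (intro bounded_clinear_composition_operator self_map_half_plane_map adm that)
  have nz: "w \<noteq> 0" "p \<noteq> 0" using w' p by auto
  define q where "q = p * (1 - 1 / w)"
  define X where "X n g = comp_op (A ^ n) 0 ((- (w / p)) *\<^sub>C mult_root p g)" for n g
  define Y where "Y n g = comp_op ((1 / A) ^ n) 0 ((w / p) *\<^sub>C mult_root q g)" for n g
  have X: "bounded_clinear (X n)" for n
    unfolding X_def[abs_def]
    by (intro bounded_clinear_compose[OF clin] bounded_clinear_compose[OF bounded_clinear_scaleC_right]
        bounded_clinear_mult_root) (use A in simp)
  have Y: "bounded_clinear (Y n)" for n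
    unfolding Y_def[abs_def]
    by (intro bounded_clinear_compose[OF clin] bounded_clinear_compose[OF bounded_clinear_scaleC_right]
        bounded_clinear_mult_root) (use A in simp)
  have CX: "comp_op A 0 (X n g) = X (Suc n) g" for n g
    unfolding X_def using A by (simp add: comp_op_compose[OF adm adm] mult.commute)
  have CY: "comp_op A 0 (Y (Suc n) g) = Y n g" for n g
    unfolding Y_def using A by (simp add: comp_op_compose[OF adm adm])
  have split: "X 0 g + Y 0 g = g" for g
  proof -
    have "X 0 g + Y 0 g = ((w / p) * (p - q)) *\<^sub>C g"
      by (simp add: X_def Y_def comp_op_1_0 mult_root_def scaleC_diff_right scaleC_minus_left
          scaleC_scaleC scaleC_diff_left right_diff_distrib)
    also have "(w / p) * (p - q) = 1" using nz by (simp add: q_def field_simps)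
    finally show ?thesis by simp
  qed
  \<comment> \<open>With u = w + t (1 - w) the image of the centre, |u| <= k t for t >= 1 and |u| <=
    k for t <= 1.\<close>
  define k where "k = cmod w + cmod (1 - w)"
  define b where "b = sqrt (1 / A)"
  have b: "0 \<le> b" "b < 1" "b\<^sup>2 = 1 / A" using A by (auto simp: b_def)
  have base: "half_plane_map p w t 0 0 = p * (1 - 1 / (w + of_real t * (1 - w)))" for t
    using nz by (simp add: half_plane_map_def)
  have Re_u: "Re (w + of_real t * (1 - w)) = (1 + t) / 2" for t by (simp add: w' field_simps)
  have modulus: "1 - (cmod (half_plane_map p w t 0 0))\<^sup>2 = t / (cmod (w + of_real t * (1 - w)))\<^sup>2"
    and u_nz: "w + of_real t * (1 - w) \<noteq> 0" and u_ge: "(1 + t) / 2 \<le> cmod (w + of_real t * (1 - w))"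
    if t: "t > 0" for t
  proof -
    show u: "w + of_real t * (1 - w) \<noteq> 0"
      using Re_u[of t] t by (metis divide_eq_0_iff not_less_iff_gr_or_eq zero_complex.sel(1) add_pos_pos zero_less_one zero_neq_numeral)
    show "1 - (cmod (half_plane_map p w t 0 0))\<^sup>2 = t / (cmod (w + of_real t * (1 - w)))\<^sup>2"
      unfolding base cayley_half_plane(1)[OF p u] Re_u by (simp add: field_simps)
    show "(1 + t) / 2 \<le> cmod (w + of_real t * (1 - w))"
      unfolding Re_u[symmetric] by (rule complex_Re_le_cmod)
  qed
  define DX where "DX = (cmod (w / p))\<^sup>2 * ((1 + 2 * k)\<^sup>2 + k\<^sup>2) * 4"
  define KY where "KY = cmod (1 - w) * k / cmod w"
  define DY where "DY = (cmod (w / p))\<^sup>2 * ((1 + 2 * KY)\<^sup>2 + KY\<^sup>2) * 4"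
  have norm_X: "norm (X n g) \<le> sqrt DX * b ^ n * norm g" for n g
  proof -
    define t where "t = A ^ n"
    define u where "u = w + of_real t * (1 - w)"
    have t: "t \<ge> 1" using A by (simp add: t_def one_le_power)
    then have t0: "t > 0" by simp
    note u = u_nz[OF t0, folded u_def] and modulus = modulus[OF t0, folded u_def]
      and u_ge = u_ge[OF t0, folded u_def] and base = base[of t, folded u_def]
    have "cmod u \<le> cmod w + t * cmod (1 - w)"
      using norm_triangle_ineq[of w "of_real t * (1 - w)"] t by (simp add: norm_mult u_def)
    also have "\<dots> \<le> t * k" using t by (simp add: k_def distrib_left mult_le_cancel_right1)
    finally have "1 / cmod u \<le> k * (t / (cmod u)\<^sup>2)"
      using u t by (simp add: power2_eq_square field_simps)
    moreover have "half_plane_map p w t 0 0 - p = - (p / u)" unfolding base by (simp add: algebra_simps)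
    ultimately have "cmod (half_plane_map p w t 0 0 - p) \<le> k * (1 - (cmod (half_plane_map p w t 0 0))\<^sup>2)"
      unfolding modulus using p by (simp add: norm_divide)
    from norm_composition_operator_mult_root[OF self_map_half_plane_map[OF adm[OF t0]] this, of g]
    have "(norm (comp_op t 0 (mult_root p g)))\<^sup>2 \<le> ((1 + 2 * k)\<^sup>2 + k\<^sup>2) * (t / (cmod u)\<^sup>2) * (norm g)\<^sup>2"
      unfolding modulus .
    also have "\<dots> \<le> ((1 + 2 * k)\<^sup>2 + k\<^sup>2) * (4 * (1 / t)) * (norm g)\<^sup>2"
    proof (intro mult_right_mono mult_left_mono)
      have "t / 2 \<le> cmod u" using u_ge by simp
      then have "(t / 2)\<^sup>2 \<le> (cmod u)\<^sup>2" using t by (intro power_mono) auto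
      then show "t / (cmod u)\<^sup>2 \<le> 4 * (1 / t)" using t u by (simp add: power2_eq_square field_simps)
    qed auto
    finally have "(norm (X n g))\<^sup>2 \<le> (cmod (w / p))\<^sup>2 * (((1 + 2 * k)\<^sup>2 + k\<^sup>2) * (4 * (1 / t)) * (norm g)\<^sup>2)"
      unfolding X_def t_def[symmetric] bounded_clinear_scaleC[OF clin[OF t0]] norm_scaleC power_mult_distrib norm_minus_cancel
      by (rule mult_left_mono) simp
    also have "\<dots> = DX * (1 / t) * (norm g)\<^sup>2" by (simp add: DX_def)
    also have "1 / t = (b ^ n)\<^sup>2"
      unfolding t_def by (simp add: power_mult[symmetric] mult.commute[of n 2] power_mult b power_divide)
    finally have "(norm (X n g))\<^sup>2 \<le> DX * (b ^ n * norm g)\<^sup>2" by (simp add: power_mult_distrib)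
    then have "norm (X n g) \<le> sqrt DX * (b ^ n * norm g)"
      by (rule norm_le_of_power2_le) (use b in \<open>auto simp: DX_def\<close>)
    then show ?thesis by simp
  qed
  have norm_Y: "norm (Y n g) \<le> sqrt DY * b ^ n * norm g" for n g
  proof -
    define t where "t = (1 / A) ^ n"
    define u where "u = w + of_real t * (1 - w)"
    have t: "t \<le> 1" "t > 0" using A by (auto simp: t_def power_le_one)
    note t0 = t(2)
    note u = u_nz[OF t0, folded u_def] and modulus = modulus[OF t0, folded u_def]
      and u_ge = u_ge[OF t0, folded u_def] and base = base[of t, folded u_def]
    have "cmod u \<le> cmod w + t * cmod (1 - w)"
      using norm_triangle_ineq[of w "of_real t * (1 - w)"] t by (simp add: norm_mult u_def)
    also have "\<dots> \<le> k" using t by (simp add: k_def mult_left_le_one_le)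
    finally have uk: "cmod u \<le> k" .
    have "half_plane_map p w t 0 0 - q = p * ((u - w) / (u * w))"
      unfolding base q_def using u nz by (simp add: field_simps)
    then have "cmod (half_plane_map p w t 0 0 - q) = t * cmod (1 - w) / (cmod u * cmod w)"
      using p t by (simp add: norm_mult norm_divide u_def)
    also have "\<dots> = cmod (1 - w) * cmod u / cmod w * (t / (cmod u)\<^sup>2)"
      using u nz by (simp add: power2_eq_square mult_ac)
    also have "\<dots> \<le> KY * (t / (cmod u)\<^sup>2)"
      unfolding KY_def using uk t by (intro mult_right_mono divide_right_mono mult_left_mono) auto
    finally have "cmod (half_plane_map p w t 0 0 - q) \<le> KY * (1 - (cmod (half_plane_map p w t 0 0))\<^sup>2)"
      unfolding modulus .
    from norm_composition_operator_mult_root[OF self_map_half_plane_map[OF adm[OF t0]] this, of g]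
    have "(norm (comp_op t 0 (mult_root q g)))\<^sup>2 \<le> ((1 + 2 * KY)\<^sup>2 + KY\<^sup>2) * (t / (cmod u)\<^sup>2) * (norm g)\<^sup>2"
      unfolding modulus .
    also have "\<dots> \<le> ((1 + 2 * KY)\<^sup>2 + KY\<^sup>2) * (4 * t) * (norm g)\<^sup>2"
    proof (intro mult_right_mono mult_left_mono)
      have "1 / 2 \<le> cmod u" using u_ge t by simp
      then have "(1 / 2)\<^sup>2 \<le> (cmod u)\<^sup>2" by (intro power_mono) auto
      then have "t * 1 \<le> t * (4 * (cmod u)\<^sup>2)" using t by (intro mult_left_mono) (auto simp: power2_eq_square)
      then show "t / (cmod u)\<^sup>2 \<le> 4 * t" using u by (simp add: field_simps)
    qed auto
    finally have "(norm (Y n g))\<^sup>2 \<le> (cmod (w / p))\<^sup>2 * (((1 + 2 * KY)\<^sup>2 + KY\<^sup>2) * (4 * t) * (norm g)\<^sup>2)"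
      unfolding Y_def t_def[symmetric] bounded_clinear_scaleC[OF clin[OF t0]] norm_scaleC power_mult_distrib
      by (rule mult_left_mono) simp
    also have "\<dots> = DY * t * (norm g)\<^sup>2" by (simp add: DY_def)
    also have "t = (b ^ n)\<^sup>2"
      unfolding t_def by (simp add: power_mult[symmetric] mult.commute[of n 2] power_mult b)
    finally have "(norm (Y n g))\<^sup>2 \<le> DY * (b ^ n * norm g)\<^sup>2" by (simp add: power_mult_distrib)
    then have "norm (Y n g) \<le> sqrt DY * (b ^ n * norm g)"
      by (rule norm_le_of_power2_le) (use b in \<open>auto simp: DY_def\<close>)
    then show ?thesis by simp
  qed
  show ?thesis
    by (rule right_inverse_of_splitting[OF clin[OF A0] X Y CX CY split norm_X norm_Y, where l = 1])
       (use b that in auto)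
qed

text \<open>The eigenfunctions \<open>v powr (- \<nu> + 2 \<pi> i k / ln A)\<close>, \<open>v = u - w\<close>, share one eigenvalue and are bounded.\<close>

lemma eigenfunctions:
  assumes A: "A > 0" "A \<noteq> 1" and ts: "admissible A 0" and \<nu>: "\<nu> = 0 \<or> \<nu> > 0 \<and> Re w < 1 / 2"
  obtains h where "\<And>k. comp_op A 0 (h k) = of_real (exp (- \<nu> * ln A)) *\<^sub>C h k"
    "\<And>P. P \<noteq> 0 \<Longrightarrow> (\<Sum>k\<le>degree P. coeff P k *\<^sub>C h k) \<noteq> 0"
proof -
  define v where "v z = p / (p - z) - w" for z
  define h0 where "h0 x = exp (- of_real \<nu> * Ln x)" for x
  \<comment> \<open>Multiplying x by A adds ln A to \<open>Ln x\<close> and leaves \<open>q\<close>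
    unchanged. On the right half-plane \<open>Im (Ln x)\<close> is bounded, hence so is
    \<open>q\<close>.\<close>
  define q where "q x = exp (2 * of_real pi * \<i> / of_real (ln A) * Ln x)" for x
  define \<delta> where "\<delta> = 1 / 2 - Re w"
  have lnA: "ln A \<noteq> 0" using A by simp
  have v: "Re (v z) > \<delta>" if "cmod z < 1" for z
    using cayley_disc(1)[OF p that] by (simp add: v_def \<delta>_def)
  have \<delta>: "\<delta> \<ge> 0" using w by (simp add: \<delta>_def)
  have v_nonpos: "v z \<notin> \<real>\<^sub>\<le>\<^sub>0" if "cmod z < 1" for z
    using v[OF that] \<delta> by (auto simp: complex_nonpos_Reals_iff)
  have v_nz: "v z \<noteq> 0" if "cmod z < 1" for z using v[OF that] \<delta> by auto
  have v_hol: "v holomorphic_on ball 0 1"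
    unfolding v_def using p by (intro holomorphic_intros) auto
  have bound0: "cmod (h0 (v z)) \<le> exp (- \<nu> * ln \<delta>)" if "cmod z < 1" for z
  proof (cases "\<nu> = 0")
    case False
    then have "\<nu> > 0" "\<delta> > 0" using \<nu> by (auto simp: \<delta>_def)
    moreover have "\<delta> \<le> cmod (v z)" using v[OF that] complex_Re_le_cmod[of "v z"] by simp
    ultimately have "\<nu> * ln \<delta> \<le> \<nu> * ln (cmod (v z))"
      using v_nz[OF that] by (intro mult_left_mono) auto
    then show ?thesis using v_nz[OF that] by (simp add: h0_def Re_Ln)
  qed (simp add: h0_def)
  have boundq: "cmod (q (v z)) \<le> exp (2 * pi * pi / \<bar>ln A\<bar>)" if "cmod z < 1" for z
  proof -
    have "Re (2 * of_real pi * \<i> / of_real (ln A) * Ln (v z)) = - (2 * pi * Im (Ln (v z)) / ln A)"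
      by (simp add: Re_divide Im_divide power2_eq_square)
    also have "\<dots> \<le> \<bar>2 * pi * Im (Ln (v z)) / ln A\<bar>" by linarith
    also have "\<dots> = 2 * pi * \<bar>Im (Ln (v z))\<bar> / \<bar>ln A\<bar>" by (simp add: abs_mult)
    also have "\<dots> \<le> 2 * pi * pi / \<bar>ln A\<bar>"
      using Im_Ln_le_pi[OF v_nz[OF that]] mpi_less_Im_Ln[OF v_nz[OF that]]
      by (intro divide_right_mono mult_left_mono) auto
    finally show ?thesis unfolding q_def norm_exp_eq_Re by simp
  qed
  have "\<exists>f. \<forall>z. cmod z < 1 \<longrightarrow> hardy2_apply f z = h0 (v z) * q (v z) ^ k" for k
  proof -
    have hol: "(\<lambda>z. h0 (v z) * q (v z) ^ k) holomorphic_on ball 0 1"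
      unfolding h0_def q_def using v_nonpos lnA by (intro holomorphic_intros v_hol) auto
    have bound: "cmod (h0 (v z) * q (v z) ^ k) \<le> exp (- \<nu> * ln \<delta>) * exp (2 * pi * pi / \<bar>ln A\<bar>) ^ k"
      if "cmod z < 1" for z
      unfolding norm_mult norm_power using bound0[OF that] boundq[OF that]
      by (intro mult_mono power_mono) auto
    show ?thesis
    proof (rule bounded_holomorphic_hardy2[OF hol bound])
      fix f assume "\<And>z. cmod z < 1 \<Longrightarrow> hardy2_apply f z = h0 (v z) * q (v z) ^ k"
      then show ?thesis by (intro exI[of _ f]) simp
    qed
  qed
  then obtain h where h: "\<And>k z. cmod z < 1 \<Longrightarrow> hardy2_apply (h k) z = h0 (v z) * q (v z) ^ k"
    by metis
  have sm: "self_map (half_plane_map p w A 0)" by (rule self_map_half_plane_map[OF ts])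
  have "comp_op A 0 (h k) = of_real (exp (- \<nu> * ln A)) *\<^sub>C h k" for k
  proof (rule hardy2_apply_eqI)
    fix z :: complex assume z: "cmod z < 1"
    then have z': "cmod (half_plane_map p w A 0 z) < 1" using sm by (simp add: self_map_def)
    have "w + of_real A * (p / (p - z) - w) + of_real 0 \<noteq> 0"
      by (rule nonzero_of_Re[OF Re_half_plane_map[OF ts cayley_disc(1)[OF p z]]])
    from cayley_half_plane(2)[OF p this]
    have vA: "v (half_plane_map p w A 0 z) = of_real A * v z"
      by (simp add: v_def half_plane_map_def)
    have Ln: "Ln (of_real A * v z) = of_real (ln A) + Ln (v z)"
      using A v_nz[OF z] by (subst Ln_times_of_real) (auto simp: Ln_of_real)
    have "h0 (of_real A * v z) = of_real (exp (- \<nu> * ln A)) * h0 (v z)"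
      unfolding h0_def Ln by (simp add: distrib_left exp_add exp_diff exp_of_real[symmetric] exp_minus field_simps)
    moreover have "q (of_real A * v z) = q (v z)"
      unfolding q_def Ln distrib_left exp_add using lnA by simp
    ultimately show "hardy2_apply (comp_op A 0 (h k)) z =
        hardy2_apply (of_real (exp (- \<nu> * ln A)) *\<^sub>C h k) z"
      by (simp add: hardy2_apply_composition_operator[OF sm z] h z z' vA hardy2_apply_scaleC)
  qed
  moreover have "(\<Sum>k\<le>degree P. coeff P k *\<^sub>C h k) \<noteq> 0" if P: "P \<noteq> 0" for P
  proof
    assume zero: "(\<Sum>k\<le>degree P. coeff P k *\<^sub>C h k) = 0"
    have root: "poly P (q (v z)) = 0" if z: "cmod z < 1" for z
    proof -
      have "0 = hardy2_apply (\<Sum>k\<le>degree P. coeff P k *\<^sub>C h k) z"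
        by (simp add: zero hardy2_apply_zero)
      also have "\<dots> = h0 (v z) * poly P (q (v z))"
        by (simp add: hardy2_apply_sum hardy2_apply_scaleC h[OF z] poly_altdef sum_distrib_left mult_ac)
      finally show ?thesis by (simp add: h0_def)
    qed
    \<comment> \<open>For independence \<open>q\<close> must take infinitely many values. The
      positive points v = exp (x m) have ln v = |ln A| (N + 1 / (2 pi (m + 1))); N is large enough
      for v to lie in the half-plane, its integer part disappears in \<open>q\<close>, and the angle
      left is 1 / (m + 1) up to sign.\<close>
    define N where "N = nat \<lceil>\<bar>ln (\<delta> + 1)\<bar> / \<bar>ln A\<bar>\<rceil>"
    define x where "x m = sgn (ln A) * real N * ln A + ln A * sgn (ln A) / (2 * pi * (real m + 1))" for m
    have x: "exp (x m) > \<delta>" for m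
    proof -
      have "\<bar>ln (\<delta> + 1)\<bar> \<le> real N * \<bar>ln A\<bar>"
      proof -
        have "\<bar>ln (\<delta> + 1)\<bar> / \<bar>ln A\<bar> \<le> real N" unfolding N_def by (rule of_nat_ceiling)
        then show ?thesis using lnA by (subst (asm) pos_divide_le_eq) auto
      qed
      also have "\<dots> \<le> x m"
      proof -
        have "x m = real N * \<bar>ln A\<bar> + \<bar>ln A\<bar> / (2 * pi * (real m + 1))"
          using lnA by (simp add: x_def sgn_if abs_if)
        then show ?thesis by simp
      qed
      finally have "ln (\<delta> + 1) \<le> x m" by linarith
      then have "\<delta> + 1 \<le> exp (x m)" using \<delta> exp_le_cancel_iff[of "ln (\<delta> + 1)" "x m"] by (simp del: exp_le_cancel_iff)
      then show ?thesis by simp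
    qed
    have "poly P (exp (\<i> * of_real (sgn (ln A) / (real m + 1)))) = 0" for m
    proof -
      define u where "u = w + of_real (exp (x m))"
      have "Re u > 1 / 2" using x[of m] by (simp add: u_def \<delta>_def)
      then have z: "cmod (p * (1 - 1 / u)) < 1" and "u \<noteq> 0"
        by (auto intro: cayley_half_plane_in_disc[OF p])
      then have "v (p * (1 - 1 / u)) = of_real (exp (x m))"
        using cayley_half_plane(2)[OF p] by (simp add: v_def u_def)
      then have "q (v (p * (1 - 1 / u))) = exp (2 * of_real pi * \<i> / of_real (ln A) * of_real (x m))"
        by (simp add: q_def Ln_of_real)
      also have "2 * of_real pi * \<i> / of_real (ln A) * of_real (x m) =
          \<i> * of_real (2 * pi / ln A * x m)" by simp
      also have "2 * pi / ln A * x m = 2 * pi * of_int (sgn (if ln A > 0 then 1 else -1) * int N) + sgn (ln A) / (real m + 1)"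
      proof -
        have "2 * pi / L * (S * M * L + L * S / (2 * pi * D)) = 2 * pi * (S * M) + S / D"
          if "L \<noteq> 0" "D \<noteq> 0" for L S M D :: real
          using that by (simp add: field_simps)
        from this[OF lnA, of "real m + 1" "sgn (ln A)" "real N"] show ?thesis
          using lnA by (simp add: x_def sgn_if add_eq_0_iff)
      qed
      also have "exp (\<i> * of_real \<dots>) = exp (\<i> * of_real (sgn (ln A) / (real m + 1)))"
        by (subst exp_eq) (auto intro!: exI[of _ "sgn (if ln A > 0 then 1 else -1) * int N"] simp: algebra_simps)
      finally show ?thesis using root[OF z] by simp
    qed
    then have "range (\<lambda>m. exp (\<i> * complex_of_real (sgn (ln A) / (real m + 1)))) \<subseteq> {y. poly P y = 0}"
      by auto
    then have fin: "finite (range (\<lambda>m. exp (\<i> * complex_of_real (sgn (ln A) / (real m + 1)))))"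
      using poly_roots_finite[OF P] finite_subset by blast
    have "inj (\<lambda>m. exp (\<i> * complex_of_real (sgn (ln A) / (real m + 1))))"
    proof (rule injI)
      fix m n assume eq: "exp (\<i> * complex_of_real (sgn (ln A) / (real m + 1))) =
        exp (\<i> * complex_of_real (sgn (ln A) / (real n + 1)))"
      \<comment> \<open>All angles lie in [-1, 1], so two of them differ by less than 2 pi and equal
        exponentials force equal angles.\<close>
      have b: "\<bar>sgn (ln A) / (real j + 1)\<bar> \<le> 1" for j using lnA by (simp add: abs_sgn_eq)
      have "\<i> * complex_of_real (sgn (ln A) / (real m + 1)) = \<i> * complex_of_real (sgn (ln A) / (real n + 1))"
      proof (rule exp_complex_eqI[OF _ eq])
        show "\<bar>Im (\<i> * complex_of_real (sgn (ln A) / (real m + 1))) -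
            Im (\<i> * complex_of_real (sgn (ln A) / (real n + 1)))\<bar> < 2 * pi"
        proof -
          have im: "Im (\<i> * complex_of_real r) = r" for r by simp
          show ?thesis unfolding im using b[of m] b[of n] pi_gt3 by linarith
        qed
      qed
      then show "m = n" using lnA by (simp add: sgn_if field_simps split: if_splits)
    qed
    then show False using fin finite_imageD infinite_UNIV_nat by blast
  qed
  ultimately show ?thesis using that by blast
qed

lemma universal_half_plane_map:
  assumes "A > 1 \<or> Re w = 1 / 2" "A > 0" "A \<noteq> 1"
  shows "\<exists>l. universal_operator (\<lambda>f. comp_op A 0 f - l *\<^sub>C f)"
proof -
  have ts: "admissible A 0"
  proof (cases "Re w = 1 / 2")
    case True
    show ?thesis unfolding admissible_def True using assms by simp
  next
    case False
    then have "(1 / 2 - Re w) * (1 - A) \<le> 0" using assms w by (intro mult_nonneg_nonpos) auto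
    then show ?thesis using assms by (simp add: admissible_def)
  qed
  have clin: "bounded_clinear (comp_op A 0)"
    by (intro bounded_clinear_composition_operator self_map_half_plane_map ts)
  have clinl: "bounded_clinear (\<lambda>f. comp_op A 0 f - l *\<^sub>C f)" for l
    by (intro bounded_clinear_minus clin bounded_clinear_scaleC_right)
  \<comment> \<open>The eigenvalue is A^(-\<nu>): \<nu> = 1/4 matches the condition l^4 = 1 / A of
    the interior case, and \<nu> = 0 is l = 1 for automorphisms.\<close>
  have "\<exists>\<nu> R. (\<nu> = 0 \<or> \<nu> > 0 \<and> Re w < 1 / 2) \<and> bounded_clinear R \<and>
     (\<forall>g. comp_op A 0 (R g) - of_real (exp (- \<nu> * ln A)) *\<^sub>C R g = g)"
  proof (cases "Re w = 1 / 2")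
    case False
    then have w': "Re w < 1 / 2" and A: "A > 1" using w assms by auto
    have "exp (- (1 / 4) * ln A) ^ 4 = 1 / A"
      using A exp_of_nat_mult[of 4 "- (1 / 4) * ln A"] by (simp add: exp_minus field_simps)
    from right_inverse_interior[OF w' A _ this] obtain R where
      "bounded_clinear R" "\<And>g. comp_op A 0 (R g) - of_real (exp (- (1 / 4) * ln A)) *\<^sub>C R g = g" by auto
    then show ?thesis using w' by (intro exI[of _ "1 / 4"] exI[of _ R]) auto
  next
    case True
    have "\<exists>R. bounded_clinear R \<and> (\<forall>g. comp_op A 0 (R g) - 1 *\<^sub>C R g = g)"
    proof (cases "A > 1")
      case A: True
      then show ?thesis using right_inverse_boundary[OF True A] by metis
    next
      case False
      then have A: "A < 1" using assms by simp
      have "1 / A > 1" using A assms by simp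
      from right_inverse_boundary[OF True this] obtain R where
        R: "bounded_clinear R" "\<And>g. comp_op (1 / A) 0 (R g) - 1 *\<^sub>C R g = g" by metis
      have ts': "admissible (1 / A) 0" using assms unfolding admissible_def True by simp
      have inv: "comp_op A 0 (comp_op (1 / A) 0 f) = f" for f
        using comp_op_compose[OF ts ts', of f] assms by (simp add: comp_op_1_0)
      have clin': "bounded_clinear (comp_op (1 / A) 0)"
        by (intro bounded_clinear_composition_operator self_map_half_plane_map ts')
      \<comment> \<open>With C the operator for A, C - 1 = - C (C^(-1) - 1); if R is a right inverse
        of C^(-1) - 1, then - R C^(-1) is one of C - 1.\<close>
      define R' where "R' g = 0 - R (comp_op (1 / A) 0 g)" for g
      have "bounded_clinear R'"
        unfolding R'_def[abs_def]
        by (intro bounded_clinear_minus bounded_clinear_compose[OF R(1) clin']) 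
          (rule bounded_clinearI[where K = 0], auto)
      moreover have "comp_op A 0 (R' g) - 1 *\<^sub>C R' g = g" for g
      proof -
        define y where "y = R (comp_op (1 / A) 0 g)"
        have "comp_op (1 / A) 0 g = comp_op (1 / A) 0 y - y"
          using R(2)[of "comp_op (1 / A) 0 g"] by (simp add: y_def)
        from arg_cong[OF this, of "comp_op A 0"] have "g = y - comp_op A 0 y"
          unfolding bounded_clinear_diff[OF clin] inv .
        moreover have "R' g = - y" by (simp add: R'_def y_def)
        moreover have "comp_op A 0 (- y) = - comp_op A 0 y"
          using bounded_clinear_diff[OF clin, of 0 y] by (simp add: bounded_clinear_zero[OF clin])
        ultimately show ?thesis by simp
      qed
      ultimately show ?thesis by blast
    qed
    then show ?thesis by (intro exI[of _ 0]) auto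
  qed
  then obtain \<nu> R where \<nu>: "\<nu> = 0 \<or> \<nu> > 0 \<and> Re w < 1 / 2" and R: "bounded_clinear R"
    "\<And>g. comp_op A 0 (R g) - of_real (exp (- \<nu> * ln A)) *\<^sub>C R g = g" by blast
  obtain h where h: "\<And>k. comp_op A 0 (h k) = of_real (exp (- \<nu> * ln A)) *\<^sub>C h k"
    "\<And>P. P \<noteq> 0 \<Longrightarrow> (\<Sum>k\<le>degree P. coeff P k *\<^sub>C h k) \<noteq> 0"
    by (rule eigenfunctions[OF assms(2,3) ts \<nu>]) blast
  let ?l = "complex_of_real (exp (- \<nu> * ln A))"
  show ?thesis
  proof (rule orthonormal_in_kernel[OF clinl[of ?l], where h = h])
    show "comp_op A 0 (h k) - ?l *\<^sub>C h k = 0" for k using h(1)[of k] by simp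
    show "(\<Sum>k\<le>degree P. coeff P k *\<^sub>C h k) \<noteq> 0" if "P \<noteq> 0" for P by (rule h(2)[OF that])
    fix e :: "nat \<Rightarrow> hardy2"
    assume "\<And>m n. cinner (e m) (e n) = (if m = n then 1 else 0)"
      "\<And>n. comp_op A 0 (e n) - ?l *\<^sub>C e n = 0"
    then have "universal_operator (\<lambda>f. comp_op A 0 f - ?l *\<^sub>C f)"
      by (intro universal_operatorI[OF clinl R])
    then show ?thesis ..
  qed
qed

end

section \<open>Obstructions to universality\<close>

definition hardy2_basis :: "nat \<Rightarrow> hardy2" where
  "hardy2_basis n = (SOME f. taylor_coeff f = (\<lambda>k. if k = n then 1 else 0))"

lemma taylor_coeff_hardy2_basis: "taylor_coeff (hardy2_basis n) k = (if k = n then 1 else 0)"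
proof -
  have "summable (\<lambda>k. (cmod (if k = n then 1 else 0))\<^sup>2)"
    by (rule summable_finite[of "{n}"]) auto
  from hardy2_of_coeffs[OF this]
  have "taylor_coeff (hardy2_basis n) = (\<lambda>k. if k = n then 1 else 0)"
    unfolding hardy2_basis_def by (metis (mono_tags, lifting) someI_ex)
  then show ?thesis by simp
qed

text \<open>Universality is tested on the nilpotent operator sending 1 to z, z to z^2 and the other
  monomials to 0; the factor \<alpha> merely rescales the chain. Interior fixed points need its
  first two vectors, parabolic automorphisms all three.\<close>

lemma universal_jordan_chain:
  fixes U :: "hardy2 \<Rightarrow> hardy2"
  assumes U: "universal_operator U"
  obtains h0 h1 h2 where "h0 \<noteq> 0" "U h0 = 0" "U h1 = h0" "U h2 = h1"
proof -
  define T where "T f = taylor_coeff f 0 *\<^sub>C hardy2_basis 1 + taylor_coeff f 1 *\<^sub>C hardy2_basis 2" for f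
  have "bounded_clinear T"
  proof (rule bounded_clinearI)
    fix f g :: hardy2 and c :: complex
    show "T (f + g) = T f + T g" by (simp add: T_def taylor_coeff_add scaleC_add_left)
    show "T (c *\<^sub>C f) = c *\<^sub>C T f" by (simp add: T_def taylor_coeff_scaleC scaleC_add_right scaleC_scaleC)
    have "norm (T f) \<le> cmod (taylor_coeff f 0) * norm (hardy2_basis 1) + cmod (taylor_coeff f 1) * norm (hardy2_basis 2)"
      unfolding T_def by (rule norm_triangle_le) (simp add: norm_scaleC)
    also have "\<dots> \<le> norm f * norm (hardy2_basis 1) + norm f * norm (hardy2_basis 2)"
      by (intro add_mono mult_right_mono taylor_coeff_norm_le) auto
    finally show "norm (T f) \<le> (norm (hardy2_basis 1) + norm (hardy2_basis 2)) * norm f"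
      by (simp add: algebra_simps)
  qed
  from universal_operatorE[OF U this] obtain \<alpha> V where \<alpha>: "\<alpha> \<noteq> 0" and V: "bounded_clinear V" "inj V"
    and UV: "\<And>x. U (V x) = V (\<alpha> *\<^sub>C T x)" by blast
  have T: "T (hardy2_basis 0) = hardy2_basis 1" "T (c *\<^sub>C hardy2_basis 1) = c *\<^sub>C hardy2_basis 2"
    "T (c *\<^sub>C hardy2_basis 2) = 0" for c
    by (auto simp: T_def taylor_coeff_hardy2_basis taylor_coeff_scaleC)
  show ?thesis
  proof (rule that[of "V (\<alpha> *\<^sub>C \<alpha> *\<^sub>C hardy2_basis 2)" "V (\<alpha> *\<^sub>C hardy2_basis 1)" "V (hardy2_basis 0)"])
    show "U (V (hardy2_basis 0)) = V (\<alpha> *\<^sub>C hardy2_basis 1)" by (simp only: UV T)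
    show "U (V (\<alpha> *\<^sub>C hardy2_basis 1)) = V (\<alpha> *\<^sub>C \<alpha> *\<^sub>C hardy2_basis 2)" by (simp only: UV T)
    show "U (V (\<alpha> *\<^sub>C \<alpha> *\<^sub>C hardy2_basis 2)) = 0"
      by (simp add: UV T scaleC_scaleC bounded_clinear_zero[OF V(1)])
    show "V (\<alpha> *\<^sub>C \<alpha> *\<^sub>C hardy2_basis 2) \<noteq> 0"
    proof
      assume "V (\<alpha> *\<^sub>C \<alpha> *\<^sub>C hardy2_basis 2) = 0"
      then have "\<alpha> *\<^sub>C \<alpha> *\<^sub>C hardy2_basis 2 = 0"
        using V(2) bounded_clinear_zero[OF V(1)] by (metis injD)
      from arg_cong[OF this, of "\<lambda>f. taylor_coeff f 2"] show False
        using \<alpha> by (simp add: taylor_coeff_scaleC taylor_coeff_hardy2_basis taylor_coeff_zero)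
    qed
  qed
qed

text \<open>Universality is tested on T = 0: a copy of the whole space then lies in the
  kernel.\<close>

lemma universal_kernel_not_one_dimensional:
  fixes U :: "hardy2 \<Rightarrow> hardy2"
  assumes U: "universal_operator U"
  obtains f g where "U f = 0" "U g = 0" "\<And>a b. a *\<^sub>C f + b *\<^sub>C g = 0 \<Longrightarrow> a = 0 \<and> b = 0"
proof -
  have "bounded_clinear (\<lambda>f :: hardy2. 0 :: hardy2)" by (rule bounded_clinearI[where K = 0]) auto
  from universal_operatorE[OF U this] obtain \<alpha> and V :: "hardy2 \<Rightarrow> hardy2" where V: "bounded_clinear V" "inj V"
    and UV: "\<And>x. U (V x) = V (\<alpha> *\<^sub>C 0)" by blast
  show ?thesis
  proof (rule that[of "V (hardy2_basis 0)" "V (hardy2_basis 1)"])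
    show UV0: "U (V x) = 0" for x using UV[of x] by (simp add: bounded_clinear_zero[OF V(1)])
    show "U (V (hardy2_basis 1)) = 0" by (rule UV0)
    fix a b assume "a *\<^sub>C V (hardy2_basis 0) + b *\<^sub>C V (hardy2_basis 1) = 0"
    then have "V (a *\<^sub>C hardy2_basis 0 + b *\<^sub>C hardy2_basis 1) = V 0"
      by (simp add: bounded_clinear_add[OF V(1)] bounded_clinear_scaleC[OF V(1)] bounded_clinear_zero[OF V(1)])
    then have 0: "a *\<^sub>C hardy2_basis 0 + b *\<^sub>C hardy2_basis 1 = 0" using V(2) by (metis injD)
    show "a = 0 \<and> b = 0"
      using arg_cong[OF 0, of "\<lambda>f. taylor_coeff f 0"] arg_cong[OF 0, of "\<lambda>f. taylor_coeff f 1"]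
      by (simp add: taylor_coeff_scaleC taylor_coeff_hardy2_basis taylor_coeff_add taylor_coeff_zero)
  qed
qed

text \<open>At an interior fixed point with multiplier \<open>\<kappa>\<close>, \<open>C\<^sub>\<phi>\<close> is diagonalised by the powers of a linear fractional
  Koenigs function, so it has no Jordan blocks.\<close>

lemma no_jordan_block_at_interior_fixed_point:
  assumes \<phi>: "self_map \<phi>" and \<alpha>: "cmod \<alpha> < 1" "\<phi> \<alpha> = \<alpha>"
    and aff: "\<And>z. cmod z < 1 \<Longrightarrow> z \<noteq> \<alpha> \<Longrightarrow> \<phi> z \<noteq> \<alpha> \<and> 1 / (\<phi> z - \<alpha>) = M / (z - \<alpha>) + N"
    and M: "M \<noteq> 0" "M \<noteq> 1"
    and h: "composition_operator \<phi> h0 - l *\<^sub>C h0 = 0" "composition_operator \<phi> h1 - l *\<^sub>C h1 = h0"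
  shows "h0 = 0"
proof -
  \<comment> \<open>The fixed point of the affine map M y + N. Centring 1 / (z - \<alpha>) at it
    gives the Koenigs coordinate \<omega> = (z - \<alpha>) / (1 - x (z - \<alpha>)), in which the
    map is division by M; \<open>s\<close> is the inverse coordinate change.\<close>
  define x where "x = N / (1 - M)"
  have x: "M * x + N = x" using M by (simp add: x_def field_simps)
  define s where "s \<omega> = \<alpha> + \<omega> / (1 + x * \<omega>)" for \<omega>
  have "((\<lambda>\<omega>. 1 + x * \<omega>) \<longlongrightarrow> 1) (nhds 0)" by (auto intro!: tendsto_eq_intros filterlim_ident)
  then have ev_nz: "eventually (\<lambda>\<omega>. 1 + x * \<omega> \<noteq> 0) (nhds 0)"
    by (rule tendsto_imp_eventually_ne) simp
  have "((\<lambda>\<omega>. cmod (s \<omega>)) \<longlongrightarrow> cmod \<alpha>) (nhds 0)"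
    unfolding s_def by (auto intro!: tendsto_eq_intros filterlim_ident)
  then have ev_s: "eventually (\<lambda>\<omega>. cmod (s \<omega>) < 1) (nhds 0)"
    by (rule order_tendstoD) (rule \<alpha>)
  have tk: "filterlim (\<lambda>\<omega>. \<omega> / M) (nhds 0) (nhds 0)"
    using M by (auto intro!: tendsto_eq_intros filterlim_ident)
  have comm: "eventually (\<lambda>\<omega>. \<phi> (s \<omega>) = s (\<omega> / M)) (nhds 0)"
    using ev_nz ev_s eventually_compose_filterlim[OF ev_nz tk]
  proof eventually_elim
    case (elim \<omega>)
    show ?case
    proof (cases "\<omega> = 0")
      case True
      then show ?thesis using \<alpha> by (simp add: s_def)
    next
      case False
      then have "s \<omega> \<noteq> \<alpha>" using elim by (simp add: s_def)
      from aff[OF elim(2) this] have *: "\<phi> (s \<omega>) - \<alpha> \<noteq> 0"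
        "1 / (\<phi> (s \<omega>) - \<alpha>) = M / (s \<omega> - \<alpha>) + N" by auto
      have "M / (s \<omega> - \<alpha>) + N = M / \<omega> + (M * x + N)"
        using False elim by (simp add: s_def field_simps)
      then have "1 / (\<phi> (s \<omega>) - \<alpha>) = M / \<omega> + x" using * x by simp
      also have "\<dots> = (1 + x * (\<omega> / M)) / (\<omega> / M)" using False M by (simp add: field_simps)
      finally have "1 / (1 / (\<phi> (s \<omega>) - \<alpha>)) = 1 / ((1 + x * (\<omega> / M)) / (\<omega> / M))" by (rule arg_cong)
      then have "\<phi> (s \<omega>) - \<alpha> = (\<omega> / M) / (1 + x * (\<omega> / M))" by simp
      then show ?thesis unfolding s_def[of "\<omega> / M"] by (metis add.commute diff_add_cancel)
    qed
  qed
  define F where "F h \<omega> = hardy2_apply h (s \<omega>)" for h \<omega>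
  obtain r where r: "r > 0" "\<And>\<omega>. \<omega> \<in> ball 0 r \<Longrightarrow> cmod (s \<omega>) < 1 \<and> 1 + x * \<omega> \<noteq> 0"
    using eventually_conj[OF ev_s ev_nz] unfolding eventually_nhds_metric by (auto simp: dist_norm)
  have "F h holomorphic_on ball 0 r" for h
  proof -
    have "s holomorphic_on ball 0 r" unfolding s_def using r by (intro holomorphic_intros) auto
    from holomorphic_on_compose_gen[OF this hardy2_holomorphic[of h]] show ?thesis
      unfolding F_def o_def using r by (auto simp: image_subset_iff)
  qed
  then have exp: "F h has_fps_expansion fps_expansion (F h) 0" for h
    using r by (intro has_fps_expansion_fps_expansion[of "ball 0 r"]) auto
  define \<kappa> where "\<kappa> = 1 / M"
  have expk: "(\<lambda>\<omega>. F h (\<omega> / M)) has_fps_expansion Abs_fps (\<lambda>n. \<kappa> ^ n * fps_nth (fps_expansion (F h) 0) n)" for h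
  proof -
    have "(\<lambda>\<omega>. \<kappa> * \<omega>) has_fps_expansion fps_const \<kappa> * fps_X" by (intro fps_expansion_intros)
    from has_fps_expansion_compose[OF exp[of h] this]
    show ?thesis by (simp add: o_def \<kappa>_def fps_compose_linear)
  qed
  have eq: "\<kappa> ^ n * fps_nth (fps_expansion (F h) 0) n - l * fps_nth (fps_expansion (F h) 0) n =
      fps_nth (fps_expansion (F g) 0) n" if hg: "composition_operator \<phi> h - l *\<^sub>C h = g" for h g n
  proof -
    have "eventually (\<lambda>\<omega>. F h (\<omega> / M) - l * F h \<omega> = F g \<omega>) (nhds 0)"
      using comm ev_s
    proof eventually_elim
      case (elim \<omega>)
      have "hardy2_apply g (s \<omega>) = hardy2_apply h (\<phi> (s \<omega>)) - l * hardy2_apply h (s \<omega>)"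
        unfolding hg[symmetric] hardy2_apply_diff hardy2_apply_scaleC
        by (simp add: hardy2_apply_composition_operator[OF \<phi>] elim)
      then show ?case by (simp add: F_def elim)
    qed
    moreover have "(\<lambda>\<omega>. F h (\<omega> / M) - l * F h \<omega>) has_fps_expansion
        Abs_fps (\<lambda>n. \<kappa> ^ n * fps_nth (fps_expansion (F h) 0) n) - fps_const l * fps_expansion (F h) 0"
      by (intro has_fps_expansion_diff has_fps_expansion_cmult_left expk exp)
    ultimately have "F g has_fps_expansion
        Abs_fps (\<lambda>n. \<kappa> ^ n * fps_nth (fps_expansion (F h) 0) n) - fps_const l * fps_expansion (F h) 0"
      by (subst (asm) has_fps_expansion_cong[OF _ refl])
    from fps_expansion_unique_complex[OF exp this] show ?thesis by simp
  qed
  have zero: "F 0 = (\<lambda>_. 0)" by (simp add: F_def hardy2_apply_zero fun_eq_iff)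
  \<comment> \<open>With a_n and b_n the coefficients of h0 and h1, (\<kappa>^n - l) a_n = 0 and
    (\<kappa>^n - l) b_n = a_n. If \<kappa>^n differs from l the first equation gives a_n = 0,
    otherwise the second does.\<close>
  have z0: "fps_nth (fps_expansion (F h0) 0) n = 0" for n
    using eq[OF h(1), of n] eq[OF h(2), of n] unfolding zero
    by (cases "\<kappa> ^ n = l") (auto simp: hardy2_zero left_diff_distrib[symmetric])
  then have "fps_expansion (F h0) 0 = 0" by (simp add: fps_eq_iff)
  with exp[of h0] have "F h0 has_fps_expansion 0" by simp
  then have F0: "eventually (\<lambda>\<omega>. F h0 \<omega> = 0) (nhds 0)"
    by (auto simp: has_fps_expansion_def elim: eventually_mono)
  have "((\<lambda>z. (z - \<alpha>) / (1 - x * (z - \<alpha>))) \<longlongrightarrow> 0) (nhds \<alpha>)"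
    by (auto intro!: tendsto_eq_intros filterlim_ident)
  from eventually_compose_filterlim[OF F0 this]
  have ev0: "eventually (\<lambda>z. F h0 ((z - \<alpha>) / (1 - x * (z - \<alpha>))) = 0) (nhds \<alpha>)" .
  have "((\<lambda>z. 1 - x * (z - \<alpha>)) \<longlongrightarrow> 1) (nhds \<alpha>)" by (auto intro!: tendsto_eq_intros filterlim_ident)
  then have "eventually (\<lambda>z. 1 - x * (z - \<alpha>) \<noteq> 0) (nhds \<alpha>)"
    by (rule tendsto_imp_eventually_ne) simp
  with ev0 have "eventually (\<lambda>z. hardy2_apply h0 z = 0) (nhds \<alpha>)"
  proof eventually_elim
    case (elim z)
    define y where "y = z - \<alpha>"
    have y: "1 - x * y \<noteq> 0" using elim by (simp add: y_def)
    then have "1 + x * (y / (1 - x * y)) = 1 / (1 - x * y)" by (simp add: field_simps)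
    then have "s (y / (1 - x * y)) = z" using y by (simp add: s_def y_def)
    then show ?case using elim by (simp add: F_def y_def)
  qed
  then obtain S where S: "open S" "\<alpha> \<in> S" "\<And>z. z \<in> S \<Longrightarrow> hardy2_apply h0 z = 0"
    unfolding eventually_nhds by blast
  have "hardy2_apply h0 z = 0" if "cmod z < 1" for z
  proof (rule analytic_continuation_open[of "S \<inter> ball 0 1" "ball 0 1" "hardy2_apply h0" "\<lambda>_. 0"])
    show "S \<inter> ball 0 1 \<noteq> {}" using S \<alpha> by auto
  qed (use S that hardy2_holomorphic in auto)
  then show ?thesis by (intro hardy2_apply_eqI) (simp add: hardy2_apply_zero)
qed

text \<open>Along an orbit an eigenfunction scales by powers of l, while functions in H^2 grow at
  most linearly; this turns the comparison into a bound on |l|.\<close>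

lemma exp_growth_bound:
  fixes x c K :: real
  assumes c: "c > 0" and le: "\<And>n. c * x ^ n \<le> K * (1 + real n)"
  shows "x \<le> 1"
proof (rule ccontr)
  assume "\<not> x \<le> 1"
  then have x: "x > 1" by simp
  have nx: "norm (inverse x) < 1" using x by (simp add: inverse_eq_divide)
  have "(\<lambda>n. K * ((inverse x) ^ n + real n * (inverse x) ^ n)) \<longlonglongrightarrow> K * (0 + 0)"
    by (intro tendsto_mult tendsto_add tendsto_const LIMSEQ_power_zero[OF nx] powser_times_n_limit_0[OF nx])
  moreover have "c \<le> K * ((inverse x) ^ n + real n * (inverse x) ^ n)" for n
    using le[of n] x by (simp add: field_simps)
  ultimately have "c \<le> K * (0 + 0)" by (intro LIMSEQ_le_const) auto
  then show False using c by simp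
qed

section \<open>Parabolic maps: translations of the half-plane\<close>

context
  fixes p :: complex and \<phi> :: "complex \<Rightarrow> complex" and \<tau> :: complex
  assumes p: "cmod p = 1" and \<phi>: "self_map \<phi>"
    and aff: "\<And>z. cmod z < 1 \<Longrightarrow> \<phi> z = p * (1 - 1 / (p / (p - z) + \<tau>))"
    and \<tau>: "\<tau> \<noteq> 0" "Re \<tau> \<ge> 0"
begin

definition hlift :: "hardy2 \<Rightarrow> complex \<Rightarrow> complex" where
  "hlift h u = hardy2_apply h (p * (1 - 1 / u))"

lemma hlift_composition_operator:
  assumes u: "Re u > 1 / 2"
  shows "hlift (composition_operator \<phi> h) u = hlift h (u + \<tau>)"
proof -
  have z: "cmod (p * (1 - 1 / u)) < 1" by (rule cayley_half_plane_in_disc[OF p u])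
  have "u \<noteq> 0" by (rule nonzero_of_Re[OF u])
  then have "\<phi> (p * (1 - 1 / u)) = p * (1 - 1 / (u + \<tau>))"
    using aff[OF z] cayley_half_plane(2)[OF p] by simp
  then show ?thesis unfolding hlift_def hardy2_apply_composition_operator[OF \<phi> z] by simp
qed

lemma hlift_eq_0_iff: "(\<And>u. Re u > 1 / 2 \<Longrightarrow> hlift h u = 0) \<Longrightarrow> h = 0"
proof (rule hardy2_apply_eqI)
  fix z :: complex assume z: "cmod z < 1" and "\<And>u. Re u > 1 / 2 \<Longrightarrow> hlift h u = 0"
  then have "hlift h (p / (p - z)) = 0" using cayley_disc(1)[OF p z] by blast
  then show "hardy2_apply h z = hardy2_apply 0 z"
    unfolding hlift_def cayley_disc(2)[OF p z] by (simp add: hardy2_apply_zero)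
qed

lemma hlift_diff_scaleC: "hlift (f - c *\<^sub>C g) u = hlift f u - c * hlift g u"
  by (simp add: hlift_def hardy2_apply_diff hardy2_apply_scaleC)

lemma hlift_scaleC: "hlift (c *\<^sub>C g) u = c * hlift g u"
  by (simp add: hlift_def hardy2_apply_scaleC)

lemma hlift_holomorphic: "hlift h holomorphic_on {u. Re u > 1 / 2}"
proof -
  have "(\<lambda>u. p * (1 - 1 / u)) holomorphic_on {u. Re u > 1 / 2}"
    by (intro holomorphic_intros) (auto dest: nonzero_of_Re)
  from holomorphic_on_compose_gen[OF this hardy2_holomorphic[of h]] show ?thesis
    unfolding hlift_def[abs_def] o_def
    using cayley_half_plane_in_disc[OF p] by (auto simp: image_subset_iff)
qed

text \<open>The Szego kernel bound with 1 - |z|^2 = (2 Re u - 1) / |u|^2. At a fixed distance from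
  the boundary line the growth is at most linear in |u|.\<close>

lemma hlift_growth:
  assumes u: "Re u > 1 / 2"
  shows "cmod (hlift h u) \<le> norm h / sqrt (2 * Re u - 1) * cmod u"
proof (rule power2_le_imp_le)
  have nz: "u \<noteq> 0" by (rule nonzero_of_Re[OF u])
  have "(cmod (hlift h u))\<^sup>2 * ((2 * Re u - 1) / (cmod u)\<^sup>2) \<le> (norm h)\<^sup>2"
    using cmod_hardy2_apply_le[OF cayley_half_plane_in_disc[OF p u], of h]
    unfolding hlift_def cayley_half_plane(1)[OF p nz] .
  then show "(cmod (hlift h u))\<^sup>2 \<le> (norm h / sqrt (2 * Re u - 1) * cmod u)\<^sup>2"
    using u nz by (simp add: power_mult_distrib power_divide field_simps)
qed (use u in auto)

text \<open>The orbits u + n \<tau> stay on a vertical line, forward and backward. A chain of length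
  two only produces linear growth, which H^2 permits; the third vector produces the quadratic
  term.\<close>

lemma parabolic_automorphism_not_universal:
  assumes Re: "Re \<tau> = 0"
  shows "\<not> universal_operator (\<lambda>f. composition_operator \<phi> f - l *\<^sub>C f)"
proof
  assume "universal_operator (\<lambda>f. composition_operator \<phi> f - l *\<^sub>C f)"
  then obtain h0 h1 h2 where h: "h0 \<noteq> 0" "composition_operator \<phi> h0 - l *\<^sub>C h0 = 0"
    "composition_operator \<phi> h1 - l *\<^sub>C h1 = h0" "composition_operator \<phi> h2 - l *\<^sub>C h2 = h1"
    by (rule universal_jordan_chain) blast
  obtain u where u: "Re u > 1 / 2" "hlift h0 u \<noteq> 0" using hlift_eq_0_iff[of h0] h(1) by blast
  define g where "g h n = hlift h (u + of_nat n * \<tau>)" for h n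
  have Re_n: "Re (u + of_nat n * \<tau>) = Re u" "Re (u - of_nat n * \<tau>) = Re u" for n
    using Re by auto
  have step: "hlift f' v = hlift f (v + \<tau>) - l * hlift f v"
    if "composition_operator \<phi> f - l *\<^sub>C f = f'" "Re v > 1 / 2" for f f' v
    unfolding that(1)[symmetric] hlift_diff_scaleC hlift_composition_operator[OF that(2)] ..
  have g_step: "g f (Suc n) = l * g f n + g f' n" if "composition_operator \<phi> f - l *\<^sub>C f = f'" for f f' n
  proof -
    have "Re (u + of_nat n * \<tau>) > 1 / 2" unfolding Re_n by (rule u(1))
    from step[OF that this] have "hlift f ((u + of_nat n * \<tau>) + \<tau>) = l * g f n + g f' n"
      by (simp add: g_def)
    moreover have "u + of_nat (Suc n) * \<tau> = (u + of_nat n * \<tau>) + \<tau>" by (simp add: algebra_simps)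
    ultimately show ?thesis unfolding g_def[of f "Suc n"] by (simp only:)
  qed
  have zero: "hlift 0 v = 0" for v by (simp add: hlift_def hardy2_apply_zero)
  define k where "k h = norm h / sqrt (2 * Re u - 1) * (cmod u + cmod \<tau>)" for h :: hardy2
  have k: "cmod (hlift h v) \<le> k h * (1 + real n)"
    if "v = u + of_nat n * \<tau> \<or> v = u - of_nat n * \<tau>" for h v n
  proof -
    have v: "Re v = Re u" using that Re_n by auto
    have "cmod v \<le> cmod u + real n * cmod \<tau>"
      using that norm_triangle_ineq[of u "of_nat n * \<tau>"] norm_triangle_ineq4[of u "of_nat n * \<tau>"]
      by (auto simp: norm_mult)
    also have "\<dots> \<le> (cmod u + cmod \<tau>) * (1 + real n)" by (simp add: algebra_simps)
    finally have "norm h / sqrt (2 * Re u - 1) * cmod v \<le>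
        norm h / sqrt (2 * Re u - 1) * ((cmod u + cmod \<tau>) * (1 + real n))"
      using u by (intro mult_left_mono) auto
    then show ?thesis using hlift_growth[of v h] u v by (simp add: k_def mult.assoc)
  qed
  have g0: "g h0 n = l ^ n * hlift h0 u" for n
    by (induction n) (auto simp: g_step[OF h(2)], auto simp: g_def zero)
  have "cmod (hlift h0 u) * cmod l ^ n \<le> k h0 * (1 + real n)" for n
    using k[of "u + of_nat n * \<tau>" n h0] g0[of n] by (simp add: g_def norm_mult norm_power mult.commute)
  from exp_growth_bound[OF _ this] have l1: "cmod l \<le> 1" using u by simp
  \<comment> \<open>Since \<tau> is imaginary, backward orbits remain in the half-plane; the growth
    bound there gives |l| >= 1, complementing |l| <= 1.\<close>
  have backward: "hlift h0 u = l ^ n * hlift h0 (u - of_nat n * \<tau>)" for n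
  proof (induction n)
    case (Suc n)
    have "hlift h0 (u - of_nat n * \<tau>) = l * hlift h0 (u - of_nat (Suc n) * \<tau>)"
    proof -
      have "Re (u - of_nat (Suc n) * \<tau>) > 1 / 2" unfolding Re_n by (rule u(1))
      from step[OF h(2) this] have "hlift h0 ((u - of_nat (Suc n) * \<tau>) + \<tau>) = l * hlift h0 (u - of_nat (Suc n) * \<tau>)"
        by (simp add: zero)
      moreover have "u - of_nat n * \<tau> = (u - of_nat (Suc n) * \<tau>) + \<tau>" by (simp add: algebra_simps)
      ultimately show ?thesis by (simp only:)
    qed
    then show ?case using Suc by simp
  qed simp
  have l0: "l \<noteq> 0" using backward[of 1] u by auto
  have "cmod (hlift h0 u) * inverse (cmod l) ^ n \<le> k h0 * (1 + real n)" for n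
    using k[of "u - of_nat n * \<tau>" n h0] backward[of n] l0
    by (simp add: norm_mult norm_power field_simps)
  from exp_growth_bound[OF _ this] have "inverse (cmod l) \<le> 1" using u by simp
  with l1 l0 have l: "cmod l = 1" by (simp add: inverse_le_1_iff)
  have g1: "l * g h1 n = l ^ n * (l * hlift h1 u + of_nat n * hlift h0 u)" for n
  proof (induction n)
    case (Suc n)
    then show ?case unfolding g_step[OF h(3)] g0 by (simp add: distrib_left mult_ac) (simp add: algebra_simps)
  qed (simp add: g_def)
  \<comment> \<open>The n-th power of a Jordan block of size three, multiplied by l^2 to clear
    negative powers of l.\<close>
  have g2: "l ^ 2 * g h2 n = l ^ n * (l ^ 2 * hlift h2 u + l * of_nat n * hlift h1 u
      + of_real (real n * (real n - 1) / 2) * hlift h0 u)" for n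
  proof (induction n)
    case (Suc n)
    have "l ^ 2 * g h2 (Suc n) = l * (l ^ 2 * g h2 n) + l * (l * g h1 n)"
      unfolding g_step[OF h(4)] by (simp add: algebra_simps power2_eq_square)
    also have "\<dots> = l ^ Suc n * (l ^ 2 * hlift h2 u + l * of_nat (Suc n) * hlift h1 u
        + (of_real (real n * (real n - 1) / 2) + of_nat n) * hlift h0 u)"
      unfolding Suc g1 by (simp add: algebra_simps)
    also have "of_real (real n * (real n - 1) / 2) + (of_nat n :: complex) =
        of_real (real (Suc n) * (real (Suc n) - 1) / 2)"
      by (simp add: field_simps)
    finally show ?case .
  qed (simp add: g_def)
  define K where "K = k h2 + cmod (hlift h2 u) + cmod (hlift h1 u)"
  have quad: "real n * (real n - 1) / 2 * cmod (hlift h0 u) \<le> K * (1 + real n)" for n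
  proof (cases "n = 0")
    case True
    have "cmod (hlift h2 u) \<le> k h2" using k[of u 0 h2] by simp
    then have "0 \<le> k h2" by (rule order_trans[OF norm_ge_zero])
    then show ?thesis using True by (simp add: K_def)
  next
    case False
    have "of_real (real n * (real n - 1) / 2) * hlift h0 u =
        l ^ 2 * g h2 n / l ^ n - l ^ 2 * hlift h2 u - l * of_nat n * hlift h1 u"
      unfolding g2 using l0 by simp
    also have "cmod \<dots> \<le> cmod (l ^ 2 * g h2 n / l ^ n) + cmod (l ^ 2 * hlift h2 u) + cmod (l * of_nat n * hlift h1 u)"
      by (meson add_mono norm_triangle_ineq4 order_refl order_trans)
    also have "\<dots> = cmod (g h2 n) + cmod (hlift h2 u) + real n * cmod (hlift h1 u)"
      by (simp add: norm_mult norm_power norm_divide l)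
    also have "\<dots> \<le> k h2 * (1 + real n) + cmod (hlift h2 u) * (1 + real n) + cmod (hlift h1 u) * (1 + real n)"
      unfolding g_def by (intro add_mono k) (auto simp: algebra_simps)
    finally show ?thesis
      using False by (simp add: norm_mult K_def algebra_simps del: of_real_divide of_real_mult of_real_diff)
  qed
  define c where "c = cmod (hlift h0 u)"
  have c: "c > 0" using u by (simp add: c_def)
  have K: "K \<ge> 0" using quad[of 0] by simp
  \<comment> \<open>Past this point the quadratic lower bound exceeds the linear upper bound in
    \<open>quad\<close>.\<close>
  obtain n :: nat where n: "real n > 2 + 4 * K / c" using reals_Archimedean2 by blast
  have "4 * K / c \<ge> 0" using K c by simp
  then have n2: "real n > 2" using n by linarith
  have "4 * K < c * (real n - 2)" using n c by (simp add: field_simps)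
  then have "(4 * K) * (1 + real n) < c * (real n - 2) * (1 + real n)" using n2 by (intro mult_strict_right_mono) auto
  also have "\<dots> \<le> c * (2 * (real n * (real n - 1)))"
  proof -
    have "real n * (real n - 1) \<ge> 0" using n2 by (intro mult_nonneg_nonneg) auto
    then have "(real n - 2) * (1 + real n) \<le> 2 * (real n * (real n - 1))" by (simp add: algebra_simps)
    then show ?thesis using c by (simp add: mult.assoc)
  qed
  finally show False using quad[of n] by (simp add: c_def algebra_simps)
qed

text \<open>A solution of \<open>h(u + \<tau>) = l h(u)\<close> extends to the plane, and after removing the exponential factor
  it grows at most linearly there.\<close>

lemma parabolic_eigenfunction:
  assumes Re: "Re \<tau> > 0" and l: "l \<noteq> 0" and h: "composition_operator \<phi> h - l *\<^sub>C h = 0"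
  shows "\<exists>a. \<forall>u. Re u > 1 / 2 \<longrightarrow> hlift h u = a * exp (of_real (ln (cmod l) / Re \<tau>) * u)"
proof -
  have step: "hlift h (v + \<tau>) = l * hlift h v" if "Re v > 1 / 2" for v
  proof -
    have "hlift (composition_operator \<phi> h - l *\<^sub>C h) v = 0" unfolding h by (simp add: hlift_def hardy2_apply_zero)
    then show ?thesis unfolding hlift_diff_scaleC hlift_composition_operator[OF that] by simp
  qed
  have steps: "hlift h (v + of_nat n * \<tau>) = l ^ n * hlift h v" if v: "Re v > 1 / 2" for v n
  proof (induction n)
    case (Suc n)
    have "Re (v + of_nat n * \<tau>) > 1 / 2"
    proof -
      have "real n * Re \<tau> \<ge> 0" using Re by simp
      then show ?thesis using v by simp
    qed
    from step[OF this] have "hlift h ((v + of_nat n * \<tau>) + \<tau>) = l ^ Suc n * hlift h v" using Suc by simp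
    moreover have "v + of_nat (Suc n) * \<tau> = (v + of_nat n * \<tau>) + \<tau>" by (simp add: algebra_simps)
    ultimately show ?case by (simp only:)
  qed simp
  \<comment> \<open>A number of translations that moves u into Re u >= 1. The functional equation,
    read backwards, then defines the extension \<open>E\<close>; by \<open>E_eq\<close> the number
    chosen does not matter.\<close>
  define N where "N u = nat \<lceil>(1 - Re u) / Re \<tau>\<rceil>" for u
  define E where "E u = hlift h (u + of_nat (N u) * \<tau>) / l ^ N u" for u
  have N: "Re (u + of_nat (N u) * \<tau>) > 1 / 2" for u
  proof -
    have "(1 - Re u) / Re \<tau> \<le> real (N u)" unfolding N_def by (rule of_nat_ceiling)
    then have "1 - Re u \<le> real (N u) * Re \<tau>" using Re by (simp add: field_simps)
    then show ?thesis by simp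
  qed
  have E_eq: "E u = hlift h (u + of_nat n * \<tau>) / l ^ n" if n: "Re (u + of_nat n * \<tau>) > 1 / 2" for u n
  proof -
    have "hlift h (u + of_nat n * \<tau>) * l ^ N u = hlift h (u + of_nat (N u) * \<tau>) * l ^ n"
      using steps[OF n, of "N u"] steps[OF N[of u], of n] by (simp add: algebra_simps)
    then show ?thesis using l by (simp add: E_def field_simps)
  qed
  have E_hlift: "E u = hlift h u" if "Re u > 1 / 2" for u using E_eq[of u 0] that by simp
  have E_hol: "E holomorphic_on UNIV"
  proof -
    define S where "S n = {u. Re (u + of_nat n * \<tau>) > 1 / 2}" for n
    have "open (S n)" for n
      unfolding S_def by (intro open_Collect_less continuous_intros)
    moreover have "E holomorphic_on S n" for n
    proof -
      have "(\<lambda>u. u + of_nat n * \<tau>) holomorphic_on S n" by (intro holomorphic_intros)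
      from holomorphic_on_compose_gen[OF this hlift_holomorphic[of h]]
      have "(\<lambda>u. hlift h (u + of_nat n * \<tau>) / l ^ n) holomorphic_on S n"
        unfolding o_def using l by (intro holomorphic_intros) (auto simp: S_def image_subset_iff)
      then show ?thesis by (rule holomorphic_transform) (simp add: S_def E_eq)
    qed
    ultimately have "E holomorphic_on (\<Union>n\<in>UNIV. S n)" by (intro holomorphic_on_UN_open)
    moreover have "(\<Union>n\<in>UNIV. S n) = UNIV" using N by (auto simp: S_def)
    ultimately show ?thesis by simp
  qed
  have E_step: "E (u + of_nat n * \<tau>) = l ^ n * E u" for u n
  proof -
    have eq: "u + of_nat n * \<tau> + of_nat (N u) * \<tau> = (u + of_nat (N u) * \<tau>) + of_nat n * \<tau>"
      by (simp add: algebra_simps)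
    have "Re (u + of_nat n * \<tau> + of_nat (N u) * \<tau>) > 1 / 2"
    proof -
      have "real n * Re \<tau> \<ge> 0" using Re by simp
      then show ?thesis unfolding eq using N[of u] by simp
    qed
    then have "E (u + of_nat n * \<tau>) = hlift h (u + of_nat n * \<tau> + of_nat (N u) * \<tau>) / l ^ N u" by (rule E_eq)
    also have "\<dots> = l ^ n * E u" unfolding eq steps[OF N] E_def by simp
    finally show ?thesis .
  qed
  define L where "L = ln (cmod l)"
  \<comment> \<open>A translation by \<tau> multiplies |E| by |l| and the exponential by 1 / |l|, so
    |G| is \<tau>-periodic and can be estimated on a strip.\<close>
  define G where "G u = E u * exp (- of_real (L / Re \<tau>) * u)" for u
  have G_hol: "G holomorphic_on UNIV" unfolding G_def by (intro holomorphic_intros E_hol)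
  define B where "B = norm h * (1 + (1 / Re \<tau> + 1 + 1 / Re \<tau>) * cmod \<tau>) * exp (\<bar>L\<bar> * (1 + Re \<tau>) / Re \<tau>)"
  have bound: "cmod (G u) \<le> B * (1 + cmod u)" for u
  proof -
    \<comment> \<open>The floor brings v = u - m \<tau> into the strip 1 <= Re v <= 1 + Re \<tau>,
      away from the boundary line, where \<open>hlift_growth\<close> is linear with a uniform
      constant. \<open>m\<close> may be negative, hence the two cases for \<open>Ev\<close>.\<close>
    define m where "m = \<lfloor>(Re u - 1) / Re \<tau>\<rfloor>"
    define v where "v = u - of_int m * \<tau>"
    have m: "real_of_int m \<le> (Re u - 1) / Re \<tau>" "(Re u - 1) / Re \<tau> < real_of_int m + 1"
      unfolding m_def by linarith+
    have v: "1 \<le> Re v" "Re v \<le> 1 + Re \<tau>"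
      using m Re by (auto simp: v_def field_simps)
    have "Ev": "cmod (E u) = exp (real_of_int m * L) * cmod (E v)"
    proof (cases "m \<ge> 0")
      case True
      then have "u = v + of_nat (nat m) * \<tau>" by (simp add: v_def)
      then have "cmod (E u) = cmod l ^ nat m * cmod (E v)" by (metis E_step norm_mult norm_power)
      also have "cmod l ^ nat m = exp (real_of_int m * L)"
        using l True exp_of_nat_mult[of "nat m" L] by (simp add: L_def)
      finally show ?thesis .
    next
      case False
      then have "v = u + of_nat (nat (- m)) * \<tau>" by (simp add: v_def)
      then have "cmod (E v) = cmod l ^ nat (- m) * cmod (E u)" by (metis E_step norm_mult norm_power)
      also have "cmod l ^ nat (- m) = exp (- real_of_int m * L)"
        using l False exp_of_nat_mult[of "nat (- m)" L] by (simp add: L_def)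
      finally show ?thesis by (simp add: exp_minus field_simps)
    qed
    have "cmod (E v) \<le> norm h / sqrt (2 * Re v - 1) * cmod v"
      using E_hlift[of v] hlift_growth[of v h] v by simp
    also have "\<dots> \<le> norm h / 1 * cmod v"
      using v by (intro mult_right_mono divide_left_mono) (auto simp: real_le_rsqrt)
    finally have Ev_le: "cmod (E v) \<le> norm h * cmod v" by simp
    have "\<bar>real_of_int m\<bar> \<le> \<bar>(Re u - 1) / Re \<tau>\<bar> + 1" using m by linarith
    also have "\<bar>(Re u - 1) / Re \<tau>\<bar> \<le> (cmod u + 1) / Re \<tau>"
      using Re abs_Re_le_cmod[of u] by (simp add: divide_right_mono)
    finally have m_le: "\<bar>real_of_int m\<bar> \<le> (cmod u + 1) / Re \<tau> + 1" by simp
    have "cmod v \<le> cmod u + \<bar>real_of_int m\<bar> * cmod \<tau>"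
      using norm_triangle_ineq4[of u "of_int m * \<tau>"] by (simp add: v_def norm_mult)
    also have "\<dots> \<le> cmod u + ((cmod u + 1) / Re \<tau> + 1) * cmod \<tau>"
      using m_le by (intro add_left_mono mult_right_mono) auto
    also have "\<dots> \<le> (1 + (1 / Re \<tau> + 1 + 1 / Re \<tau>) * cmod \<tau>) * (1 + cmod u)"
    proof -
      have "(cmod u + 1) / Re \<tau> + 1 \<le> (1 / Re \<tau> + 1 + 1 / Re \<tau>) * (1 + cmod u)"
        using Re by (simp add: field_simps)
      from mult_right_mono[OF this, of "cmod \<tau>"] show ?thesis by (simp add: algebra_simps)
    qed
    finally have v_le: "cmod v \<le> (1 + (1 / Re \<tau> + 1 + 1 / Re \<tau>) * cmod \<tau>) * (1 + cmod u)" .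
    have "real_of_int m * L - L / Re \<tau> * Re u = - (L * Re v / Re \<tau>)"
      using Re by (simp add: v_def field_simps)
    also have "\<dots> \<le> \<bar>L\<bar> * (1 + Re \<tau>) / Re \<tau>"
    proof -
      have "- (L * Re v) \<le> \<bar>L\<bar> * Re v" using v by (simp add: abs_if)
      also have "\<dots> \<le> \<bar>L\<bar> * (1 + Re \<tau>)" using v by (intro mult_left_mono) auto
      finally have "- (L * Re v) / Re \<tau> \<le> \<bar>L\<bar> * (1 + Re \<tau>) / Re \<tau>" using Re by (intro divide_right_mono) auto
      then show ?thesis by simp
    qed
    finally have expo: "real_of_int m * L - L / Re \<tau> * Re u \<le> \<bar>L\<bar> * (1 + Re \<tau>) / Re \<tau>" .
    have "cmod (G u) = cmod (E v) * exp (real_of_int m * L - L / Re \<tau> * Re u)"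
    proof -
      have "cmod (exp (- of_real (L / Re \<tau>) * u)) = exp (- (L / Re \<tau> * Re u))"
        unfolding norm_exp_eq_Re by simp
      then show ?thesis
        unfolding G_def norm_mult Ev by (simp add: exp_diff exp_minus field_simps)
    qed
    also have "\<dots> \<le> (norm h * ((1 + (1 / Re \<tau> + 1 + 1 / Re \<tau>) * cmod \<tau>) * (1 + cmod u))) *
        exp (\<bar>L\<bar> * (1 + Re \<tau>) / Re \<tau>)"
      using expo by (intro mult_mono order_trans[OF Ev_le] mult_left_mono v_le) (use Re in auto)
    finally show ?thesis by (simp add: B_def mult_ac)
  qed
  have B: "B \<ge> 0" using bound[of 0] order_trans[OF norm_ge_zero] by fastforce
  have liouville: "G u = (\<Sum>k\<le>1. (deriv ^^ k) G 0 / fact k * u ^ k)" for u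
  proof (rule Liouville_polynomial[OF G_hol, where A = 1 and B = "2 * B"])
    show "norm (G z) \<le> 2 * B * norm z ^ 1" if "1 \<le> norm z" for z
    proof -
      have "B * (1 + cmod z) \<le> B * (2 * cmod z)" using B that by (intro mult_left_mono) auto
      then show ?thesis using bound[of z] by simp
    qed
  qed
  have "G u = G 0 + deriv G 0 * u" for u
    by (rule trans[OF liouville[of u]]) simp
  then obtain a b where G: "\<And>u. G u = a + b * u" by metis
  have E: "E u = (a + b * u) * exp (of_real (L / Re \<tau>) * u)" for u
  proof -
    have "E u = G u * exp (of_real (L / Re \<tau>) * u)"
      by (simp add: G_def mult.assoc exp_minus flip: exp_add)
    then show ?thesis by (simp add: G)
  qed
  define e where "e = exp (of_real (L / Re \<tau>) * \<tau>)"
  have eq: "(a + b * (u + \<tau>)) * e = l * (a + b * u)" for u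
  proof -
    have "E (u + \<tau>) = (a + b * (u + \<tau>)) * e * exp (of_real (L / Re \<tau>) * u)"
      by (simp add: E e_def distrib_left exp_add)
    moreover have "E (u + \<tau>) = l * (a + b * u) * exp (of_real (L / Re \<tau>) * u)"
      using E_step[of u 1] by (simp add: E)
    ultimately show ?thesis by simp
  qed
  \<comment> \<open>The points u = 0 and u = 1 give (a + b \<tau>) e = l a and b e = l b.
    Subtracting a times the second from b times the first leaves b^2 \<tau> e = 0.\<close>
  have eq0: "(a + b * \<tau>) * e = l * a" using eq[of 0] by simp
  have "b * e = (a + b * (1 + \<tau>)) * e - (a + b * \<tau>) * e" by (simp add: algebra_simps)
  then have eq1: "b * e = l * b" unfolding eq eq0 by (simp add: algebra_simps)
  have "b * (b * \<tau>) * e = b * ((a + b * \<tau>) * e) - a * (b * e)" by (simp add: algebra_simps)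
  then have "b * (b * \<tau>) * e = 0" unfolding eq0 eq1 by simp
  then have "b = 0" using \<tau> by (simp add: e_def)
  then show ?thesis using E E_hlift by (intro exI[of _ a]) (auto simp: L_def)
qed

lemma parabolic_not_universal: "\<not> universal_operator (\<lambda>f. composition_operator \<phi> f - l *\<^sub>C f)"
proof (cases "Re \<tau> = 0")
  case True
  then show ?thesis by (rule parabolic_automorphism_not_universal)
next
  case False
  then have Re: "Re \<tau> > 0" using \<tau> by simp
  show ?thesis
  proof
    assume "universal_operator (\<lambda>f. composition_operator \<phi> f - l *\<^sub>C f)"
    then obtain f g where fg: "composition_operator \<phi> f - l *\<^sub>C f = 0" "composition_operator \<phi> g - l *\<^sub>C g = 0"
      and indep: "\<And>a b. a *\<^sub>C f + b *\<^sub>C g = 0 \<Longrightarrow> a = 0 \<and> b = 0"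
      by (rule universal_kernel_not_one_dimensional) blast
    show False
    proof (cases "l = 0")
      \<comment> \<open>For l = 0 the composition with a nonconstant map is annihilated: f vanishes
        on a translated half-plane and hence everywhere.\<close>
      case True
      have "hlift f u = 0" if u: "Re u > 1 / 2" for u
      proof -
        define S where "S = {u. Re u > 1 / 2 + Re \<tau>}"
        have zero: "hlift f v = 0" if "v \<in> S" for v
        proof -
          have "Re (v - \<tau>) > 1 / 2" using that by (simp add: S_def)
          from hlift_composition_operator[OF this, of f] fg(1) True show ?thesis
            by (simp add: hlift_def hardy2_apply_zero)
        qed
        show ?thesis
        proof (rule analytic_continuation_open[of S "{u. Re u > 1 / 2}" "hlift f" "\<lambda>_. 0"])
          show "open S" "open {u. Re u > 1 / 2}" "connected {u. Re u > 1 / 2}"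
            unfolding S_def by (rule open_halfspace_Re_gt convex_connected[OF convex_halfspace_Re_gt])+
          have "1 + \<tau> \<in> S" by (simp add: S_def)
          then show "S \<noteq> {}" by blast
          show "S \<subseteq> {u. Re u > 1 / 2}" using Re by (auto simp: S_def)
        qed (use zero u hlift_holomorphic in \<open>auto intro: holomorphic_intros\<close>)
      qed
      then have "f = 0" by (rule hlift_eq_0_iff)
      then show False using indep[of 1 0] by simp
    next
      case False
      from parabolic_eigenfunction[OF Re False fg(1)] parabolic_eigenfunction[OF Re False fg(2)]
      obtain a b where ab: "\<And>u. Re u > 1 / 2 \<Longrightarrow> hlift f u = a * exp (of_real (ln (cmod l) / Re \<tau>) * u)"
        "\<And>u. Re u > 1 / 2 \<Longrightarrow> hlift g u = b * exp (of_real (ln (cmod l) / Re \<tau>) * u)" by blast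
      \<comment> \<open>Both kernel elements are multiples of one and the same exponential, which
        contradicts their independence.\<close>
      have "b *\<^sub>C f - a *\<^sub>C g = 0"
        by (rule hlift_eq_0_iff) (simp add: hlift_diff_scaleC hlift_scaleC ab)
      then have 0: "b *\<^sub>C f + (- a) *\<^sub>C g = 0" by (simp add: scaleC_minus_left)
      then have "a = 0" using indep[OF 0] by simp
      then have "f = 0" by (intro hlift_eq_0_iff) (simp add: ab)
      then show False using indep[of 1 0] by simp
    qed
  qed
qed

end

section \<open>Fixed points of linear fractional maps\<close>

context
  fixes a b c d :: complex
  assumes lf: "lin_frac_self_map a b c d" and nid: "lin_frac_sphere a b c d \<noteq> id"
begin

lemma lin_frac_det: "a * d - b * c \<noteq> 0"
  using lf by (simp add: lin_frac_self_map_def)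

lemma lin_frac_in_disc:
  assumes z: "cmod z < 1"
  shows "c * z + d \<noteq> 0" "cmod (lin_frac a b c d z) < 1"
proof -
  have "Some z \<in> disk_sphere" using z by (simp add: disk_sphere_def)
  then have "lin_frac_sphere a b c d (Some z) \<in> disk_sphere"
    using lf unfolding lin_frac_self_map_def by blast
  then show "c * z + d \<noteq> 0" "cmod (lin_frac a b c d z) < 1" by (auto simp: disk_sphere_def split: if_splits)
qed

lemma self_map_lin_frac: "self_map (lin_frac a b c d)"
  unfolding self_map_def lin_frac_def[abs_def]
proof (intro conjI allI impI)
  show "(\<lambda>z. (a * z + b) / (c * z + d)) holomorphic_on ball 0 1"
    using lin_frac_in_disc(1) by (intro holomorphic_intros) auto
qed (use lin_frac_in_disc(2) in \<open>simp add: lin_frac_def\<close>)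

text \<open>The cross-multiplied inequality passes to the closure without dividing. A pole on the
  circle would then be a zero of the numerator as well, contradicting the nonzero
  determinant.\<close>

lemma lin_frac_on_closed_disc:
  assumes z: "cmod z \<le> 1"
  shows "cmod (a * z + b) \<le> cmod (c * z + d)" "c * z + d \<noteq> 0"
proof -
  have "z \<in> closure (ball 0 1)" using z by simp
  moreover have "closed {z. cmod (a * z + b) \<le> cmod (c * z + d)}"
    by (intro closed_Collect_le continuous_intros)
  moreover have "ball 0 1 \<subseteq> {z. cmod (a * z + b) \<le> cmod (c * z + d)}"
    using lin_frac_in_disc by (auto simp: lin_frac_def norm_divide intro: less_imp_le)
  ultimately show le: "cmod (a * z + b) \<le> cmod (c * z + d)"
    using closure_minimal by blast
  show "c * z + d \<noteq> 0"
  proof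
    assume 0: "c * z + d = 0"
    with le have "a * z + b = 0" by simp
    moreover have "a * d - b * c = a * (c * z + d) - c * (a * z + b)" by (simp add: algebra_simps)
    ultimately show False using lin_frac_det 0 by simp
  qed
qed

lemma fixed_point_in_closed_disc:
  obtains \<alpha> where "cmod \<alpha> \<le> 1" "lin_frac a b c d \<alpha> = \<alpha>"
proof -
  have "continuous_on (cball 0 1) (lin_frac a b c d)"
    unfolding lin_frac_def[abs_def] using lin_frac_on_closed_disc(2) by (intro continuous_intros) auto
  moreover have "lin_frac a b c d \<in> cball 0 1 \<rightarrow> cball 0 1"
    using lin_frac_on_closed_disc by (auto simp: lin_frac_def norm_divide divide_le_eq)
  ultimately show ?thesis
    using brouwer_ball[of 1 0 "lin_frac a b c d"] that by auto
qed

lemma lin_frac_not_id: "a = d \<Longrightarrow> b = 0 \<Longrightarrow> c = 0 \<Longrightarrow> False"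
proof -
  assume "a = d" "b = 0" "c = 0"
  then have "lin_frac_sphere a b c d x = x" for x
    using lin_frac_det by (cases x) (auto simp: lin_frac_def)
  then show False using nid by auto
qed

section \<open>Normal form at a fixed point and the case distinction\<close>

context
  fixes \<alpha> :: complex
  assumes \<alpha>: "c * \<alpha> + d \<noteq> 0" "lin_frac a b c d \<alpha> = \<alpha>"
begin

text \<open>The reciprocal of the derivative at \<open>\<alpha>\<close>: at a fixed point a d - b c
  = (a - \<alpha> c) (c \<alpha> + d). Together with \<open>inv_shift\<close> it gives the affine
  map in the coordinate 1 / (z - \<alpha>).\<close>

definition inv_multiplier where "inv_multiplier = (c * \<alpha> + d) / (a - \<alpha> * c)"
definition inv_shift where "inv_shift = c / (a - \<alpha> * c)"

lemma fixed_point_eq: "a * \<alpha> + b = \<alpha> * (c * \<alpha> + d)"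
  using \<alpha> by (simp add: lin_frac_def field_simps)

lemma derivative_nz: "a - \<alpha> * c \<noteq> 0"
proof
  assume "a - \<alpha> * c = 0"
  then have "a = \<alpha> * c" by simp
  moreover from this fixed_point_eq have "b = \<alpha> * d" by (simp add: algebra_simps)
  ultimately show False using lin_frac_det by simp
qed

lemma inv_multiplier_nz: "inv_multiplier \<noteq> 0" using \<alpha> derivative_nz by (simp add: inv_multiplier_def)

lemma affine_at_fixed_point:
  assumes z: "c * z + d \<noteq> 0" "z \<noteq> \<alpha>"
  shows "lin_frac a b c d z \<noteq> \<alpha>" "1 / (lin_frac a b c d z - \<alpha>) = inv_multiplier / (z - \<alpha>) + inv_shift"
proof -
  have "a * z + b - \<alpha> * (c * z + d) = (a - \<alpha> * c) * (z - \<alpha>)"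
    using fixed_point_eq by (simp add: algebra_simps)
  then have eq: "lin_frac a b c d z - \<alpha> = (a - \<alpha> * c) * (z - \<alpha>) / (c * z + d)"
    using z(1) by (simp add: lin_frac_def diff_divide_distrib[symmetric] field_simps)
  then show "lin_frac a b c d z \<noteq> \<alpha>" using derivative_nz z by auto
  have "1 / (lin_frac a b c d z - \<alpha>) = (c * z + d) / ((a - \<alpha> * c) * (z - \<alpha>))" unfolding eq by simp
  also have "\<dots> = (c * \<alpha> + d) / ((a - \<alpha> * c) * (z - \<alpha>)) + (c * (z - \<alpha>)) / ((a - \<alpha> * c) * (z - \<alpha>))"
    by (simp add: add_divide_distrib[symmetric] algebra_simps)
  also have "\<dots> = inv_multiplier / (z - \<alpha>) + inv_shift" using z(2) by (simp add: inv_multiplier_def inv_shift_def)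
  finally show "1 / (lin_frac a b c d z - \<alpha>) = inv_multiplier / (z - \<alpha>) + inv_shift" .
qed

lemma not_translation_by_0: "inv_multiplier = 1 \<Longrightarrow> inv_shift \<noteq> 0"
proof
  assume "inv_multiplier = 1" "inv_shift = 0"
  then have "c = 0" "a = d" using derivative_nz by (auto simp: inv_multiplier_def inv_shift_def)
  moreover from this fixed_point_eq have "b = 0" by (simp add: mult.commute)
  ultimately show False by (intro lin_frac_not_id)
qed

text \<open>Finite fixed points are roots of c z^2 + (d - a) z - b, whose sum is (a - d) / c; for c
  = 0 the second root has moved to infinity.\<close>

lemma other_fixed_point:
  assumes q: "lin_frac_sphere a b c d q = q" "q \<noteq> Some \<alpha>"
  shows "c \<noteq> 0 \<and> q = Some ((a - \<alpha> * c - d) / c) \<or> c = 0 \<and> q = None"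
proof (cases q)
  case None
  then show ?thesis using q by (auto split: if_splits)
next
  case (Some z)
  then have z: "c * z + d \<noteq> 0" "lin_frac a b c d z = z" "z \<noteq> \<alpha>" using q by (auto split: if_splits)
  from affine_at_fixed_point[OF z(1,3)] z have "1 / (z - \<alpha>) = inv_multiplier / (z - \<alpha>) + inv_shift" by simp
  then have "1 = inv_multiplier + inv_shift * (z - \<alpha>)" using z(3) by (simp add: field_simps)
  then have "1 = ((c * \<alpha> + d) + c * (z - \<alpha>)) / (a - \<alpha> * c)"
    by (simp add: inv_multiplier_def inv_shift_def add_divide_distrib)
  then have "a - \<alpha> * c = (c * \<alpha> + d) + c * (z - \<alpha>)"
    using derivative_nz by (simp add: eq_divide_eq)
  then have cz: "c * z = a - \<alpha> * c - d" by (simp add: algebra_simps)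
  have "c \<noteq> 0"
  proof
    assume "c = 0"
    with cz have "a = d" by simp
    with \<open>c = 0\<close> have "inv_multiplier = 1" "inv_shift = 0" using derivative_nz unfolding inv_multiplier_def inv_shift_def by auto
    then show False using not_translation_by_0 by blast
  qed
  then show ?thesis using cz Some by (simp add: field_simps)
qed

lemma other_fixed_points_eq:
  assumes "lin_frac_sphere a b c d q = q" "q \<noteq> Some \<alpha>" "lin_frac_sphere a b c d q' = q'" "q' \<noteq> Some \<alpha>"
  shows "q = q'"
  using other_fixed_point[OF assms(1,2)] other_fixed_point[OF assms(3,4)] by auto

lemma interior_fixed_point:
  assumes in_disc: "cmod \<alpha> < 1"
  shows "\<not> universal_operator (\<lambda>f. composition_operator (lin_frac a b c d) f - l *\<^sub>C f)"
    "p \<noteq> q \<Longrightarrow> p \<notin> disk_sphere \<Longrightarrow> q \<notin> disk_sphere \<Longrightarrow>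
      lin_frac_sphere a b c d p = p \<Longrightarrow> lin_frac_sphere a b c d q = q \<Longrightarrow> False"
proof -
  have "Some \<alpha> \<in> disk_sphere" using in_disc by (simp add: disk_sphere_def)
  then show "p \<noteq> q \<Longrightarrow> p \<notin> disk_sphere \<Longrightarrow> q \<notin> disk_sphere \<Longrightarrow>
      lin_frac_sphere a b c d p = p \<Longrightarrow> lin_frac_sphere a b c d q = q \<Longrightarrow> False"
    using other_fixed_points_eq[of p q] by metis
  have M1: "inv_multiplier \<noteq> 1"
  proof
    \<comment> \<open>In the coordinate 1 / (z - \<alpha>) the map would be a translation. Starting
      at - n times the shift, a point close to \<alpha> and so in the disk for large n, n steps lead
      to 0, that is to infinity, although orbits stay in the disk.\<close>
    assume M1: "inv_multiplier = 1"
    note N0 = not_translation_by_0[OF this]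
    have "((\<lambda>n. cmod (\<alpha> - 1 / inv_shift * (1 / of_nat n))) \<longlongrightarrow> cmod (\<alpha> - 1 / inv_shift * 0)) sequentially"
      by (intro tendsto_intros lim_1_over_n)
    then have "eventually (\<lambda>n. cmod (\<alpha> - 1 / inv_shift * (1 / of_nat n)) < 1) sequentially"
      by (rule order_tendstoD) (use in_disc in simp)
    then have "eventually (\<lambda>n. cmod (\<alpha> - 1 / inv_shift * (1 / of_nat n)) < 1 \<and> n > 0) sequentially"
      by (intro eventually_conj eventually_gt_at_top)
    then obtain n where n: "cmod (\<alpha> - 1 / inv_shift * (1 / of_nat n)) < 1" "n > 0"
      unfolding eventually_sequentially by blast
    define z where "z k = (lin_frac a b c d ^^ k) (\<alpha> - 1 / inv_shift * (1 / of_nat n))" for k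
    have z: "cmod (z k) < 1 \<and> z k \<noteq> \<alpha> \<and> 1 / (z k - \<alpha>) = inv_shift * (of_nat k - of_nat n)" for k
    proof (induction k)
      case 0
      then show ?case using n N0 by (simp add: z_def)
    next
      case (Suc k)
      then have zk: "cmod (z k) < 1" "z k \<noteq> \<alpha>" "1 / (z k - \<alpha>) = inv_shift * (of_nat k - of_nat n)" by auto
      have "z (Suc k) = lin_frac a b c d (z k)" by (simp add: z_def)
      then show ?case
        using lin_frac_in_disc[OF zk(1)] affine_at_fixed_point[OF lin_frac_in_disc(1)[OF zk(1)] zk(2)] zk(3) M1
        by (simp add: algebra_simps)
    qed
    from z[of n] show False by simp
  qed
  show "\<not> universal_operator (\<lambda>f. composition_operator (lin_frac a b c d) f - l *\<^sub>C f)"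
  proof
    assume "universal_operator (\<lambda>f. composition_operator (lin_frac a b c d) f - l *\<^sub>C f)"
    then obtain h0 h1 h2 where "h0 \<noteq> 0" "composition_operator (lin_frac a b c d) h0 - l *\<^sub>C h0 = 0"
      "composition_operator (lin_frac a b c d) h1 - l *\<^sub>C h1 = h0"
      by (rule universal_jordan_chain) blast
    then show False
      using no_jordan_block_at_interior_fixed_point[OF self_map_lin_frac in_disc \<alpha>(2) _ inv_multiplier_nz M1]
        affine_at_fixed_point lin_frac_in_disc(1) by blast
  qed
qed

text \<open>In the coordinate u the map is affine, and preserving the half-plane forces its slope A
  to be positive. For A = 1 there is no further fixed point; otherwise the second one,
  \<open>w\<close>, decides both sides of the equivalence by its position relative to the line Re u
  = 1/2.\<close>

lemma boundary_fixed_point: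
  assumes bd: "cmod \<alpha> = 1"
  shows "(\<exists>l. universal_operator (\<lambda>f. composition_operator (lin_frac a b c d) f - l *\<^sub>C f)) \<longleftrightarrow>
         (\<exists>p q. p \<noteq> q \<and> p \<notin> disk_sphere \<and> q \<notin> disk_sphere \<and>
            lin_frac_sphere a b c d p = p \<and> lin_frac_sphere a b c d q = q)"
proof -
  define B where "B = - \<alpha> * inv_shift"
  have \<alpha>0: "\<alpha> \<noteq> 0" using bd by auto
  have u_affine: "\<alpha> / (\<alpha> - lin_frac a b c d z) = inv_multiplier * (\<alpha> / (\<alpha> - z)) + B" if z: "cmod z < 1" for z
  proof -
    have "z \<noteq> \<alpha>" using z bd by auto
    from affine_at_fixed_point[OF lin_frac_in_disc(1)[OF z] this]
    have "- \<alpha> * (1 / (lin_frac a b c d z - \<alpha>)) = - \<alpha> * (inv_multiplier / (z - \<alpha>) + inv_shift)" by simp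
    then show ?thesis by (simp add: B_def minus_divide_right distrib_left)
  qed
  have half_plane: "Re (inv_multiplier * u + B) > 1 / 2" if u: "Re u > 1 / 2" for u
  proof -
    have z: "cmod (\<alpha> * (1 - 1 / u)) < 1" by (rule cayley_half_plane_in_disc[OF bd u])
    have "\<alpha> / (\<alpha> - \<alpha> * (1 - 1 / u)) = u" by (rule cayley_half_plane(2)[OF bd nonzero_of_Re[OF u]])
    with u_affine[OF z] cayley_disc(1)[OF bd lin_frac_in_disc(2)[OF z]] show ?thesis by simp
  qed
  have \<phi>_eq: "lin_frac a b c d z = \<alpha> * (1 - 1 / (inv_multiplier * (\<alpha> / (\<alpha> - z)) + B))" if z: "cmod z < 1" for z
    using cayley_disc(2)[OF bd lin_frac_in_disc(2)[OF z]] unfolding u_affine[OF z] by simp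
  have "Im inv_multiplier = 0"
  proof (rule ccontr)
    assume inv_multiplier: "Im inv_multiplier \<noteq> 0"
    \<comment> \<open>The image of 1 + t i would have real part exactly 0.\<close>
    define t where "t = (Re inv_multiplier + Re B) / Im inv_multiplier"
    have "Re (inv_multiplier * (1 + of_real t * \<i>) + B) > 1 / 2" by (rule half_plane) simp
    moreover have "Re (inv_multiplier * (1 + of_real t * \<i>) + B) = 0" using inv_multiplier by (simp add: t_def)
    ultimately show False by simp
  qed
  then obtain A where A: "inv_multiplier = of_real A" by (metis complex_is_Real_iff Reals_cases)
  have "A > 0"
  proof (rule ccontr)
    assume "\<not> A > 0"
    then have A0: "A < 0" using inv_multiplier_nz A by (cases "A = 0") auto
    \<comment> \<open>At least 1, so that u = t lies in the half-plane, and large enough that a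
      negative slope makes the image nonpositive.\<close>
    define t where "t = max 1 (- Re B / A)"
    have "A * t \<le> A * (- Re B / A)" using A0 by (intro mult_left_mono_neg) (auto simp: t_def)
    then have "A * t + Re B \<le> 0" using A0 by simp
    moreover have "t \<ge> 1" by (simp add: t_def)
    then have "Re (inv_multiplier * of_real t + B) > 1 / 2" by (intro half_plane) simp
    ultimately show False by (simp add: A)
  qed
  have ReB: "A / 2 + Re B \<ge> 1 / 2"
  proof (rule tendsto_lowerbound)
    show "((\<lambda>t. A * t + Re B) \<longlongrightarrow> A / 2 + Re B) (at_right (1 / 2))" by (auto intro!: tendsto_eq_intros)
    have "Re (inv_multiplier * of_real t + B) > 1 / 2" if "t > 1 / 2" for t by (rule half_plane) (use that in simp)
    then show "eventually (\<lambda>t. 1 / 2 \<le> A * t + Re B) (at_right (1 / 2))"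
      unfolding eventually_at_right_field by (intro exI[of _ 1]) (auto simp: A less_imp_le)
  qed simp
  have \<alpha>_fixed: "lin_frac_sphere a b c d (Some \<alpha>) = Some \<alpha>" using \<alpha> by simp
  have \<alpha>_out: "Some \<alpha> \<notin> disk_sphere" using bd by (auto simp: disk_sphere_def)
  show ?thesis
  proof (cases "A = 1")
    case True
    then have M1: "inv_multiplier = 1" by (simp add: A)
    have N0: "inv_shift \<noteq> 0" by (rule not_translation_by_0[OF M1])
    have B: "B \<noteq> 0" "Re B \<ge> 0" using N0 \<alpha>0 ReB True by (auto simp: B_def)
    have "\<not> universal_operator (\<lambda>f. composition_operator (lin_frac a b c d) f - l *\<^sub>C f)" for l
      using parabolic_not_universal[OF bd self_map_lin_frac _ B] \<phi>_eq by (simp add: M1)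
    moreover have "q = Some \<alpha>" if "lin_frac_sphere a b c d q = q" for q
    proof (rule ccontr)
      assume q: "q \<noteq> Some \<alpha>"
      have "c \<noteq> 0" using N0 by (auto simp: inv_shift_def)
      moreover have "a - \<alpha> * c - d = \<alpha> * c" using M1 derivative_nz by (simp add: inv_multiplier_def field_simps)
      ultimately have "(a - \<alpha> * c - d) / c = \<alpha>" by (simp only:) simp
      then show False using other_fixed_point[OF that q] q \<open>c \<noteq> 0\<close> by simp
    qed
    ultimately show ?thesis by metis
  next
    case A1: False
    \<comment> \<open>The fixed point in the coordinate u; w = 0 is infinity in the coordinate z and
      corresponds to c = 0.\<close>
    define w where "w = B / (1 - inv_multiplier)"
    have M1: "inv_multiplier \<noteq> 1" using A1 A by simp
    have \<phi>_w: "lin_frac a b c d z = half_plane_map \<alpha> w A 0 z" if "cmod z < 1" for z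
    proof -
      have "inv_multiplier * u + B = w + of_real A * (u - w) + of_real 0" for u
      proof -
        have "B = w * (1 - inv_multiplier)" using M1 by (simp add: w_def)
        then show ?thesis by (simp add: A algebra_simps)
      qed
      then show ?thesis unfolding half_plane_map_def \<phi>_eq[OF that] by (simp only:)
    qed
    have Re_w: "(1 - A) * Re w = Re B"
    proof -
      have "B = of_real (1 - A) * w" using M1 by (simp add: w_def A)
      then show ?thesis by simp
    qed
    have w_q: "w \<noteq> 0 \<and> lin_frac_sphere a b c d (Some (\<alpha> * (1 - 1 / w))) = Some (\<alpha> * (1 - 1 / w))" if "c \<noteq> 0"
    proof -
      define q where "q = (a - \<alpha> * c - d) / c"
      have N0: "inv_shift \<noteq> 0" using that derivative_nz by (simp add: inv_shift_def)
      then have w0: "w \<noteq> 0" using \<alpha>0 M1 by (simp add: w_def B_def)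
      have "\<alpha> / w = - ((1 - inv_multiplier) / inv_shift)" using \<alpha>0 M1 N0 by (simp add: w_def B_def field_simps)
      also have "(1 - inv_multiplier) / inv_shift = ((a - \<alpha> * c) - (c * \<alpha> + d)) / c"
        using that derivative_nz by (simp add: inv_multiplier_def inv_shift_def field_simps)
      finally have q: "\<alpha> * (1 - 1 / w) = q"
        using that by (simp add: q_def right_diff_distrib diff_divide_distrib add_divide_distrib)
      have cqd: "c * q + d = a - \<alpha> * c" using that by (simp add: q_def)
      have "a * q + b - q * (c * q + d) = \<alpha> * c * q + b" unfolding cqd by (simp add: algebra_simps)
      also have "\<dots> = \<alpha> * (a - \<alpha> * c - d) + b" using that by (simp add: q_def)
      also have "\<dots> = 0" using fixed_point_eq by (simp add: algebra_simps)
      finally have "a * q + b = q * (c * q + d)" by simp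
      moreover have "c * q + d \<noteq> 0" unfolding cqd by (rule derivative_nz)
      ultimately have "lin_frac a b c d q = q" by (simp add: lin_frac_def)
      then show ?thesis unfolding q using w0 cqd derivative_nz by simp
    qed
    show ?thesis
    proof (cases "Re w > 1 / 2")
      case True
      define q where "q = \<alpha> * (1 - 1 / w)"
      have "cmod q < 1" unfolding q_def by (rule cayley_half_plane_in_disc[OF bd True])
      have "c \<noteq> 0"
      proof
        assume "c = 0"
        then have "inv_shift = 0" unfolding inv_shift_def by simp
        then have "w = 0" by (simp add: w_def B_def)
        then show False using True by simp
      qed
      from w_q[OF this] have q: "c * q + d \<noteq> 0" "lin_frac a b c d q = q" unfolding q_def[symmetric] by (auto split: if_splits)
      show ?thesis
        \<comment> \<open>The version exported from the context of \<alpha> is instantiated at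
          \<open>q\<close>, the fixed point inside the disk; it refutes both sides.\<close>
        using Submission.interior_fixed_point[OF lf nid q \<open>cmod q < 1\<close>] by blast
    next
      case False
      then have w: "Re w \<le> 1 / 2" by simp
      \<comment> \<open>For A < 1 the bound on \<open>Re B\<close> gives Re w >= 1/2, so a point
        \<open>w\<close> strictly to the left of the line occurs only with A > 1.\<close>
      have "A > 1 \<or> Re w = 1 / 2"
      proof (rule disjCI)
        assume "Re w \<noteq> 1 / 2"
        with w have w': "Re w < 1 / 2" by simp
        show "A > 1"
        proof (rule ccontr)
          assume "\<not> A > 1"
          then have "(1 - A) * Re w < (1 - A) * (1 / 2)" using A1 w' by (intro mult_strict_left_mono) auto
          then show False using ReB unfolding Re_w by (simp add: field_simps)
        qed
      qed
      from universal_half_plane_map[OF bd w this \<open>A > 0\<close> A1]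
      have "\<exists>l. universal_operator (\<lambda>f. composition_operator (lin_frac a b c d) f - l *\<^sub>C f)"
        using composition_operator_cong[of "lin_frac a b c d" "half_plane_map \<alpha> w A 0"] \<phi>_w by simp
      moreover have "\<exists>q. q \<noteq> Some \<alpha> \<and> q \<notin> disk_sphere \<and> lin_frac_sphere a b c d q = q"
      proof (cases "c = 0")
        case True
        then show ?thesis by (intro exI[of _ None]) (auto simp: disk_sphere_def)
      next
        case c: False
        define q where "q = \<alpha> * (1 - 1 / w)"
        have w0: "w \<noteq> 0" and q: "lin_frac_sphere a b c d (Some q) = Some q"
          using w_q[OF c] by (auto simp: q_def)
        have "q \<noteq> \<alpha>" using w0 \<alpha>0 by (simp add: q_def right_diff_distrib)
        moreover have "\<not> cmod q < 1"
        proof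
          assume "cmod q < 1"
          from cayley_disc(1)[OF bd this] show False
            unfolding q_def cayley_half_plane(2)[OF bd w0] using w by simp
        qed
        ultimately show ?thesis using q by (intro exI[of _ "Some q"]) (auto simp: disk_sphere_def)
      qed
      ultimately show ?thesis using \<alpha>_fixed \<alpha>_out by metis
    qed
  qed
qed

end

end

theorem theorem2:
  fixes a b c d :: complex
  assumes "lin_frac_self_map a b c d"
    and "lin_frac_sphere a b c d \<noteq> id"
  shows "(\<exists>l::complex. universal_operator
            (\<lambda>f::hardy2. composition_operator (lin_frac a b c d) f - l *\<^sub>C f)) \<longleftrightarrow>
         (\<exists>p q. p \<noteq> q \<and> p \<notin> disk_sphere \<and> q \<notin> disk_sphere \<and>
            lin_frac_sphere a b c d p = p \<and> lin_frac_sphere a b c d q = q)"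
proof -
  obtain \<alpha> where \<alpha>: "cmod \<alpha> \<le> 1" "lin_frac a b c d \<alpha> = \<alpha>"
    by (rule fixed_point_in_closed_disc[OF assms])
  have nz: "c * \<alpha> + d \<noteq> 0" by (rule lin_frac_on_closed_disc(2)[OF assms \<alpha>(1)])
  show ?thesis
  proof (cases "cmod \<alpha> = 1")
    case True
    then show ?thesis by (rule boundary_fixed_point[OF assms nz \<alpha>(2)])
  next
    case False
    then have "cmod \<alpha> < 1" using \<alpha> by simp
    from interior_fixed_point[OF assms nz \<alpha>(2) this] show ?thesis by blast
  qed
qed

end
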